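(* Let $\Lambda$ be a finite abelian group. If $(P,M,\Lambda,q,\sigma)$ is a principal $\Lambda$-bundle (total space $P$, base manifold $M$, projection $q$, right action $\sigma$, written $p.\lambda:=\sigma(p,\lambda)$), $A$ a unital Fréchet algebra with trivial center and $\pi:\Lambda\times A\rightarrow A$ a smooth action of $\Lambda$ on $A$ by algebra automorphisms, then the dynamical system $(C^{\infty}(P,A),\Lambda,\alpha)$ with \[\alpha:\Lambda\times C^{\infty}(P,A)\rightarrow C^{\infty}(P,A),\quad(\lambda.f)(p):=\pi(\lambda).f(p.\lambda),\] is a noncommutative principal $\Lambda$-bundle.
   Context: Manifolds are finite-dimensional, paracompact, second countable and smooth; algebras are associative and complex. "Trivial center" means the center equals $\mathbb{C}\cdot 1_A$. $C^\infty(P,A)$ is the algebra of smooth $A$-valued functions with the smooth compact-open topology. For an algebra $A$, $\Gamma_A$ denotes the set of nonzero algebra homomorphisms $A\to\mathbb{C}$; $C_A$ is the center of $A$. A dynamical system $(A,\Lambda,\alpha)$ consists of a unital locally convex algebra $A$ and a group homomorphism $\alpha:\Lambda\to\mathrm{Aut}(A)$ inducing a continuous action. $C_A^\Lambda$ is the fixed point algebra of the induced $\Lambda$-action on $C_A$. For $\chi\in\widehat{\Lambda}=\mathrm{Hom}(\Lambda,\mathbb{T})$, $A_\chi=\{a\in A:\alpha(\lambda)a=\chi(\lambda)a\ \forall\lambda\in\Lambda\}$. Trivial bundles: let $\{\lambda_1,\ldots,\lambda_k\}$ be a set of generators of $\Lambda$ of minimal cardinality, of orders $n_1,\ldots,n_k$,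 such that $\Lambda$ is the internal direct product of the cyclic subgroups $\langle\lambda_i\rangle$. Define $\widehat{\lambda}_i\in\widehat{\Lambda}$ by $\widehat{\lambda}_i(\lambda_i)=\exp(2\pi i/n_i)$ (imaginary unit in the exponent) and $\widehat{\lambda}_i(\lambda_j)=1$ for $j\neq i$. $(A,\Lambda,\alpha)$ is a trivial noncommutative principal $\Lambda$-bundle if there exists such a set of generators for which each $A_{\widehat{\lambda}_i}$ contains an invertible element $a_i$ with $a_i^{n_i}=1_A$. Smooth localization: for a unital locally convex algebra $A$ and $a\in A$, let $f_a\in C^\infty(\mathbb{R},A)$, $f_a(t)=1_A-ta$, where $C^\infty(\mathbb{R},A)$ carries the smooth compact-open topology, let $I_a$ be the closure of the two-sided ideal generated by $f_a$, and set $A_{\{a\}}:=C^\infty(\mathbb{R},A)/I_a$. For $z\in C_A^\Lambda$, $\alpha_{\{z\}}(\lambda,[f]):=[\alpha(\lambda)\circ f]$ defines an action of $\Lambda$ on $A_{\{z\}}$, giving a dynamical system $(A_{\{z\}},\Lambda,\alpha_{\{z\}})$. A dynamical system $(A,\Lambda,\alpha)$ is a noncommutative principal $\Lambda$-bundle if for each $\chi\in\Gamma_{C_A^\Lambda}$ there exists $z\in C_A^\Lambda$ with $\chi(z)\neq0$ such that $(A_{\{z\}},\Lambda,\alpha_{\{z\}})$ is a trivial noncommutative principal $\Lambda$-bundle. *)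

theory Defs
  imports "HOL-Analysis.Analysis" "HOL-Algebra.Product_Groups" "HOL-Algebra.Multiplicative_Group"
    "HOL-Algebra.QuotRing" "HOL-Algebra.Module"
begin

section \<open>Locally convex algebras\<close>

text \<open>
  Algebras have an explicit carrier, since the function algebras and quotient algebras below are
  not types. Scalars are real or complex; the topology is meant to live on the carrier.
\<close>

record ('k, 'a) top_algebra = "('k, 'a) module" +
  topo :: "'a topology"

definition scalar_algebra :: "('k::real_normed_field, 'k) top_algebra" where
  "scalar_algebra =
     \<lparr>carrier = UNIV, mult = (*), one = 1, ring.zero = 0, add = (+), smult = (*), topo = euclidean\<rparr>"

definition convex_in :: "('k::real_normed_field, 'a) top_algebra \<Rightarrow> 'a set \<Rightarrow> bool" where
  "convex_in A C \<longleftrightarrow>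
     (\<forall>x\<in>C. \<forall>y\<in>C. \<forall>t::real. 0 \<le> t \<and> t \<le> 1 \<longrightarrow>
        (of_real (1 - t) \<odot>\<^bsub>A\<^esub> x) \<oplus>\<^bsub>A\<^esub> (of_real t \<odot>\<^bsub>A\<^esub> y) \<in> C)"

locale lc_algebra =
  fixes A :: "('k::real_normed_field, 'a) top_algebra" (structure)
  assumes ring: "ring A"
    and module: "Module.module (scalar_algebra :: ('k, 'k) top_algebra) A"
    and smult_mult_left: "\<lbrakk>a \<in> carrier A; b \<in> carrier A\<rbrakk> \<Longrightarrow> (c \<odot> a) \<otimes> b = c \<odot> (a \<otimes> b)"
    and smult_mult_right: "\<lbrakk>a \<in> carrier A; b \<in> carrier A\<rbrakk> \<Longrightarrow> a \<otimes> (c \<odot> b) = c \<odot> (a \<otimes> b)"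
    and topspace_topo: "topspace (topo A) = carrier A"
    and hausdorff: "Hausdorff_space (topo A)"
    and continuous_add:
      "continuous_map (prod_topology (topo A) (topo A)) (topo A) (\<lambda>(a, b). a \<oplus> b)"
    and continuous_smult:
      "continuous_map (prod_topology euclidean (topo A)) (topo A) (\<lambda>(c, a). c \<odot> a)"
    and continuous_mult:
      "continuous_map (prod_topology (topo A) (topo A)) (topo A) (\<lambda>(a, b). a \<otimes> b)"
    and locally_convex:
      "\<lbrakk>openin (topo A) U; \<zero> \<in> U\<rbrakk> \<Longrightarrow>
         \<exists>V. openin (topo A) V \<and> \<zero> \<in> V \<and> V \<subseteq> U \<and> convex_in A V"

definition frechet_algebra :: "('k::real_normed_field, 'a) top_algebra \<Rightarrow> bool" where
  "frechet_algebra A \<longleftrightarrow> lc_algebra A \<and>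
     (\<exists>d. Metric_space (carrier A) d \<and> Metric_space.mcomplete (carrier A) d \<and>
          Metric_space.mtopology (carrier A) d = topo A \<and>
          (\<forall>x\<in>carrier A. \<forall>y\<in>carrier A. \<forall>z\<in>carrier A. d (x \<oplus>\<^bsub>A\<^esub> z) (y \<oplus>\<^bsub>A\<^esub> z) = d x y))"

text \<open>Algebra homomorphisms are not required to preserve the unit.\<close>

definition algebra_hom ::
  "('k, 'a) top_algebra \<Rightarrow> ('k, 'b) top_algebra \<Rightarrow> ('a \<Rightarrow> 'b) \<Rightarrow> bool" where
  "algebra_hom A B h \<longleftrightarrow> h \<in> carrier A \<rightarrow> carrier B \<and>
     (\<forall>x\<in>carrier A. \<forall>y\<in>carrier A. h (x \<oplus>\<^bsub>A\<^esub> y) = h x \<oplus>\<^bsub>B\<^esub> h y) \<and>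
     (\<forall>x\<in>carrier A. \<forall>y\<in>carrier A. h (x \<otimes>\<^bsub>A\<^esub> y) = h x \<otimes>\<^bsub>B\<^esub> h y) \<and>
     (\<forall>c. \<forall>x\<in>carrier A. h (c \<odot>\<^bsub>A\<^esub> x) = c \<odot>\<^bsub>B\<^esub> h x)"

definition algebra_aut :: "('k, 'a) top_algebra \<Rightarrow> ('a \<Rightarrow> 'a) \<Rightarrow> bool" where
  "algebra_aut A h \<longleftrightarrow> algebra_hom A A h \<and> bij_betw h (carrier A) (carrier A)"

definition characters :: "(complex, 'a) top_algebra \<Rightarrow> ('a \<Rightarrow> complex) set" where
  "characters A = {\<omega>. algebra_hom A scalar_algebra \<omega> \<and> (\<exists>a\<in>carrier A. \<omega> a \<noteq> 0)}"

definition center :: "('k, 'a) top_algebra \<Rightarrow> 'a set" where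
  "center A = {z \<in> carrier A. \<forall>a\<in>carrier A. z \<otimes>\<^bsub>A\<^esub> a = a \<otimes>\<^bsub>A\<^esub> z}"

definition trivial_center :: "('k, 'a) top_algebra \<Rightarrow> bool" where
  "trivial_center A \<longleftrightarrow> center A = range (\<lambda>c. c \<odot>\<^bsub>A\<^esub> \<one>\<^bsub>A\<^esub>)"

definition subalgebra_on :: "('k, 'a) top_algebra \<Rightarrow> 'a set \<Rightarrow> ('k, 'a) top_algebra" where
  "subalgebra_on A B = A\<lparr>carrier := B, topo := subtopology (topo A) B\<rparr>"


section \<open>Smooth maps with values in locally convex spaces\<close>

text \<open>Derivative at the parameter 0 of a curve in E.\<close>

definition has_curve_deriv ::
  "('k::real_normed_field, 'a) top_algebra \<Rightarrow> (real \<Rightarrow> 'a) \<Rightarrow> 'a \<Rightarrow> bool" where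
  "has_curve_deriv E c d \<longleftrightarrow>
     limitin (topo E) (\<lambda>h. of_real (1 / h) \<odot>\<^bsub>E\<^esub> (c h \<ominus>\<^bsub>E\<^esub> c 0)) d (at 0)"

definition curve_deriv ::
  "('k::real_normed_field, 'a) top_algebra \<Rightarrow> (real \<Rightarrow> 'a) \<Rightarrow> 'a" where
  "curve_deriv E c = (THE d. has_curve_deriv E c d)"

primrec iter_partial ::
  "('k::real_normed_field, 'a) top_algebra \<Rightarrow> ((nat \<Rightarrow> real) \<Rightarrow> 'a) \<Rightarrow> nat list \<Rightarrow> (nat \<Rightarrow> real) \<Rightarrow> 'a"
where
  "iter_partial E f [] = f"
| "iter_partial E f (i # js) =
     (\<lambda>x. curve_deriv E (\<lambda>h. iter_partial E f js (x(i := x i + h))))"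

text \<open>Smoothness on a set V which is open in \<open>Euclidean_space n\<close>.\<close>

definition smooth_on ::
  "nat \<Rightarrow> (nat \<Rightarrow> real) set \<Rightarrow> ('k::real_normed_field, 'a) top_algebra \<Rightarrow> ((nat \<Rightarrow> real) \<Rightarrow> 'a) \<Rightarrow> bool"
where
  "smooth_on n V E f \<longleftrightarrow>
     (\<forall>js\<in>lists {..<n}.
        continuous_map (subtopology (Euclidean_space n) V) (topo E) (iter_partial E f js) \<and>
        (\<forall>x\<in>V. \<forall>i<n. \<exists>d. has_curve_deriv E (\<lambda>h. iter_partial E f js (x(i := x i + h))) d))"

primrec iter_dir_deriv ::
  "('k::real_normed_field, 'a) top_algebra \<Rightarrow> ('l::real_normed_field, 'b) top_algebra \<Rightarrow>
     ('a \<Rightarrow> 'b) \<Rightarrow> 'a list \<Rightarrow> 'a \<Rightarrow> 'b"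
where
  "iter_dir_deriv E F f [] = f"
| "iter_dir_deriv E F f (v # vs) =
     (\<lambda>x. curve_deriv F (\<lambda>h. iter_dir_deriv E F f vs (x \<oplus>\<^bsub>E\<^esub> of_real h \<odot>\<^bsub>E\<^esub> v)))"

text \<open>
  Smoothness in the sense of Michal and Bastiani of a map between locally convex spaces: all
  iterated directional derivatives exist and are jointly continuous in the base point (index 0)
  and the directions (indices 1 to k).
\<close>

definition lc_smooth ::
  "('k::real_normed_field, 'a) top_algebra \<Rightarrow> ('l::real_normed_field, 'b) top_algebra \<Rightarrow>
     ('a \<Rightarrow> 'b) \<Rightarrow> bool"
where
  "lc_smooth E F f \<longleftrightarrow>
     (\<forall>vs\<in>lists (carrier E). \<forall>v\<in>carrier E. \<forall>x\<in>carrier E.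
        \<exists>d. has_curve_deriv F (\<lambda>h. iter_dir_deriv E F f vs (x \<oplus>\<^bsub>E\<^esub> of_real h \<odot>\<^bsub>E\<^esub> v)) d) \<and>
     (\<forall>k. continuous_map (product_topology (\<lambda>_. topo E) {..k}) (topo F)
        (\<lambda>w. iter_dir_deriv E F f (map w [1..<Suc k]) (w 0)))"


section \<open>Smooth manifolds\<close>

text \<open>
  A chart is a pair of its domain and its coordinate map into \<open>Euclidean_space n\<close>; this model
  space includes dimension 0. The atlas need not be maximal.
\<close>

record 'p manifold =
  mdim :: nat
  mtop :: "'p topology"
  charts :: "('p set \<times> ('p \<Rightarrow> nat \<Rightarrow> real)) set"

abbreviation points :: "'p manifold \<Rightarrow> 'p set" where
  "points X \<equiv> topspace (mtop X)"

definition paracompact_space :: "'p topology \<Rightarrow> bool" where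
  "paracompact_space T \<longleftrightarrow>
     (\<forall>\<U>. (\<forall>U\<in>\<U>. openin T U) \<and> \<Union>\<U> = topspace T \<longrightarrow>
        (\<exists>\<V>. (\<forall>V\<in>\<V>. openin T V \<and> (\<exists>U\<in>\<U>. V \<subseteq> U)) \<and> \<Union>\<V> = topspace T \<and>
             locally_finite_in T \<V>))"

definition smooth_manifold :: "'p manifold \<Rightarrow> bool" where
  "smooth_manifold X \<longleftrightarrow>
     Hausdorff_space (mtop X) \<and> second_countable (mtop X) \<and> paracompact_space (mtop X) \<and>
     (\<Union>(U, \<phi>)\<in>charts X. U) = points X \<and>
     (\<forall>(U, \<phi>)\<in>charts X.
        openin (mtop X) U \<and> openin (Euclidean_space (mdim X)) (\<phi> ` U) \<and>
        homeomorphic_map (subtopology (mtop X) U)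
          (subtopology (Euclidean_space (mdim X)) (\<phi> ` U)) \<phi>) \<and>
     (\<forall>(U, \<phi>)\<in>charts X. \<forall>(V, \<psi>)\<in>charts X. \<forall>j<mdim X.
        smooth_on (mdim X) (\<phi> ` (U \<inter> V)) (scalar_algebra :: (real, real) top_algebra)
          (\<lambda>x. \<psi> (inv_into U \<phi> x) j))"

definition smooth_map :: "'p manifold \<Rightarrow> 'q manifold \<Rightarrow> ('p \<Rightarrow> 'q) \<Rightarrow> bool" where
  "smooth_map X Y f \<longleftrightarrow> continuous_map (mtop X) (mtop Y) f \<and>
     (\<forall>(U, \<phi>)\<in>charts X. \<forall>(V, \<psi>)\<in>charts Y. \<forall>j<mdim Y.
        smooth_on (mdim X) (\<phi> ` {p \<in> U. f p \<in> V}) (scalar_algebra :: (real, real) top_algebra)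
          (\<lambda>x. \<psi> (f (inv_into U \<phi> x)) j))"

definition diffeomorphism :: "'p manifold \<Rightarrow> 'q manifold \<Rightarrow> ('p \<Rightarrow> 'q) \<Rightarrow> bool" where
  "diffeomorphism X Y f \<longleftrightarrow> smooth_map X Y f \<and>
     (\<exists>g. smooth_map Y X g \<and> (\<forall>x\<in>points X. g (f x) = x) \<and> (\<forall>y\<in>points Y. f (g y) = y))"

definition open_submanifold :: "'p manifold \<Rightarrow> 'p set \<Rightarrow> 'p manifold" where
  "open_submanifold X W =
     \<lparr>mdim = mdim X, mtop = subtopology (mtop X) W,
      charts = (\<lambda>(U, \<phi>). (U \<inter> W, \<phi>)) ` charts X\<rparr>"

text \<open>Product of a manifold with a countable set, regarded as a manifold of dimension 0.\<close>

definition times_discrete :: "'p manifold \<Rightarrow> 'g set \<Rightarrow> ('p \<times> 'g) manifold" where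
  "times_discrete X S =
     \<lparr>mdim = mdim X, mtop = prod_topology (mtop X) (discrete_topology S),
      charts = {(U \<times> {s}, \<phi> \<circ> fst) | U \<phi> s. (U, \<phi>) \<in> charts X \<and> s \<in> S}\<rparr>"

definition real_line :: "real manifold" where
  "real_line =
     \<lparr>mdim = 1, mtop = euclidean, charts = {(UNIV, \<lambda>t i. if i = 0 then t else 0)}\<rparr>"


section \<open>Algebras of smooth functions\<close>

definition smooth_functions ::
  "'p manifold \<Rightarrow> ('k::real_normed_field, 'a) top_algebra \<Rightarrow> ('p \<Rightarrow> 'a) set" where
  "smooth_functions X E =
     {f \<in> points X \<rightarrow>\<^sub>E carrier E.
        \<forall>(U, \<phi>)\<in>charts X. smooth_on (mdim X) (\<phi> ` U) E (f \<circ> inv_into U \<phi>)}"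

text \<open>
  The smooth compact-open topology: the initial topology with respect to the maps sending f to its
  iterated partial derivatives in charts, where the latter carry the compact-open topology.
  (The whole space has to be inserted only for the empty manifold, which may have no charts.)
\<close>

definition smooth_compact_open ::
  "'p manifold \<Rightarrow> ('k::real_normed_field, 'a) top_algebra \<Rightarrow> ('p \<Rightarrow> 'a) topology" where
  "smooth_compact_open X E = topology_generated_by
     (insert (smooth_functions X E)
       {{f \<in> smooth_functions X E. iter_partial E (f \<circ> inv_into U \<phi>) js ` K \<subseteq> W} | U \<phi> js K W.
          (U, \<phi>) \<in> charts X \<and> js \<in> lists {..<mdim X} \<and>
          compactin (Euclidean_space (mdim X)) K \<and> K \<subseteq> \<phi> ` U \<and> openin (topo E) W})"

definition smooth_algebra ::
  "'p manifold \<Rightarrow> ('k::real_normed_field, 'a) top_algebra \<Rightarrow> ('k, 'p \<Rightarrow> 'a) top_algebra" where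
  "smooth_algebra X A =
     \<lparr>carrier = smooth_functions X A,
      mult = (\<lambda>f g. \<lambda>p\<in>points X. f p \<otimes>\<^bsub>A\<^esub> g p),
      one = (\<lambda>p\<in>points X. \<one>\<^bsub>A\<^esub>),
      ring.zero = (\<lambda>p\<in>points X. \<zero>\<^bsub>A\<^esub>),
      add = (\<lambda>f g. \<lambda>p\<in>points X. f p \<oplus>\<^bsub>A\<^esub> g p),
      smult = (\<lambda>c f. \<lambda>p\<in>points X. c \<odot>\<^bsub>A\<^esub> f p),
      topo = smooth_compact_open X A\<rparr>"


section \<open>Dynamical systems\<close>

text \<open>
  Groups of interest are finite, and they are regarded as discrete topological groups and as Lie
  groups of dimension 0.
\<close>

definition algebra_action ::
  "'g monoid \<Rightarrow> ('k, 'a) top_algebra \<Rightarrow> ('g \<Rightarrow> 'a \<Rightarrow> 'a) \<Rightarrow> bool" where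
  "algebra_action G A \<alpha> \<longleftrightarrow>
     (\<forall>g\<in>carrier G. algebra_aut A (\<alpha> g)) \<and>
     (\<forall>a\<in>carrier A. \<alpha> \<one>\<^bsub>G\<^esub> a = a) \<and>
     (\<forall>g\<in>carrier G. \<forall>h\<in>carrier G. \<forall>a\<in>carrier A. \<alpha> (g \<otimes>\<^bsub>G\<^esub> h) a = \<alpha> g (\<alpha> h a))"

definition dynamical_system ::
  "'g monoid \<Rightarrow> (complex, 'a) top_algebra \<Rightarrow> ('g \<Rightarrow> 'a \<Rightarrow> 'a) \<Rightarrow> bool" where
  "dynamical_system G A \<alpha> \<longleftrightarrow> lc_algebra A \<and> algebra_action G A \<alpha> \<and>
     continuous_map (prod_topology (discrete_topology (carrier G)) (topo A)) (topo A)
       (\<lambda>(g, a). \<alpha> g a)"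

text \<open>As the group is discrete, smoothness of an action is smoothness of each of its maps.\<close>

definition smooth_algebra_action ::
  "'g monoid \<Rightarrow> (complex, 'a) top_algebra \<Rightarrow> ('g \<Rightarrow> 'a \<Rightarrow> 'a) \<Rightarrow> bool" where
  "smooth_algebra_action G A \<alpha> \<longleftrightarrow>
     algebra_action G A \<alpha> \<and> (\<forall>g\<in>carrier G. lc_smooth A A (\<alpha> g))"

definition fixed_center ::
  "'g monoid \<Rightarrow> ('k, 'a) top_algebra \<Rightarrow> ('g \<Rightarrow> 'a \<Rightarrow> 'a) \<Rightarrow> 'a set" where
  "fixed_center G A \<alpha> = {z \<in> center A. \<forall>g\<in>carrier G. \<alpha> g z = z}"

definition isotypic ::
  "'g monoid \<Rightarrow> (complex, 'a) top_algebra \<Rightarrow> ('g \<Rightarrow> 'a \<Rightarrow> 'a) \<Rightarrow> ('g \<Rightarrow> complex) \<Rightarrow> 'a set" where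
  "isotypic G A \<alpha> \<omega> = {a \<in> carrier A. \<forall>g\<in>carrier G. \<alpha> g a = \<omega> g \<odot>\<^bsub>A\<^esub> a}"


section \<open>Trivial noncommutative principal bundles\<close>

definition circle_group :: "complex monoid" where
  "circle_group = \<lparr>carrier = sphere 0 1, mult = (*), one = 1\<rparr>"

definition minimal_generators :: "'g monoid \<Rightarrow> 'g set \<Rightarrow> bool" where
  "minimal_generators G S \<longleftrightarrow>
     finite S \<and> S \<subseteq> carrier G \<and> generate G S = carrier G \<and>
     (\<forall>T. finite T \<and> T \<subseteq> carrier G \<and> generate G T = carrier G \<longrightarrow> card S \<le> card T)"

definition internal_cyclic_product :: "'g monoid \<Rightarrow> 'g set \<Rightarrow> bool" where
  "internal_cyclic_product G S \<longleftrightarrow>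
     (\<lambda>x. finprod G x S) \<in> iso (product_group S (\<lambda>s. subgroup_generated G {s})) G"

definition dual_generator :: "'g monoid \<Rightarrow> 'g set \<Rightarrow> 'g \<Rightarrow> 'g \<Rightarrow> complex" where
  "dual_generator G S s =
     (THE \<omega>. \<omega> \<in> hom G circle_group \<and> \<omega> \<in> extensional (carrier G) \<and>
        \<omega> s = exp (2 * pi * \<i> / of_nat (group.ord G s)) \<and> (\<forall>t\<in>S - {s}. \<omega> t = 1))"

definition trivial_nc_principal_bundle ::
  "'g monoid \<Rightarrow> (complex, 'a) top_algebra \<Rightarrow> ('g \<Rightarrow> 'a \<Rightarrow> 'a) \<Rightarrow> bool" where
  "trivial_nc_principal_bundle G A \<alpha> \<longleftrightarrow> dynamical_system G A \<alpha> \<and>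
     (\<exists>S. minimal_generators G S \<and> internal_cyclic_product G S \<and>
        (\<forall>s\<in>S. \<exists>a \<in> isotypic G A \<alpha> (dual_generator G S s).
           a \<in> Units A \<and> a [^]\<^bsub>A\<^esub> group.ord G s = \<one>\<^bsub>A\<^esub>))"


section \<open>Smooth localization and noncommutative principal bundles\<close>

text \<open>The quotient topology makes W open iff its preimage under the quotient map is open.\<close>

definition quotient_algebra ::
  "('k, 'a) top_algebra \<Rightarrow> 'a set \<Rightarrow> ('k, 'a set) top_algebra" where
  "quotient_algebra A I =
     \<lparr>carrier = carrier (A Quot I),
      mult = mult (A Quot I),
      one = one (A Quot I),
      ring.zero = ring.zero (A Quot I),
      add = add (A Quot I),
      smult = (\<lambda>c X. \<Union>x\<in>X. I +>\<^bsub>A\<^esub> (c \<odot>\<^bsub>A\<^esub> x)),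
      topo = topology (\<lambda>W. W \<subseteq> carrier (A Quot I) \<and>
        openin (topo A) {x \<in> carrier A. I +>\<^bsub>A\<^esub> x \<in> W})\<rparr>"

definition localization_ideal ::
  "('k::real_normed_field, 'a) top_algebra \<Rightarrow> 'a \<Rightarrow> (real \<Rightarrow> 'a) set" where
  "localization_ideal A a =
     topo (smooth_algebra real_line A) closure_of
       genideal (smooth_algebra real_line A) {\<lambda>t. \<one>\<^bsub>A\<^esub> \<ominus>\<^bsub>A\<^esub> of_real t \<odot>\<^bsub>A\<^esub> a}"

definition smooth_localization ::
  "('k::real_normed_field, 'a) top_algebra \<Rightarrow> 'a \<Rightarrow> ('k, (real \<Rightarrow> 'a) set) top_algebra" where
  "smooth_localization A a =
     quotient_algebra (smooth_algebra real_line A) (localization_ideal A a)"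

text \<open>The class of f is sent to the class of \<open>\<alpha> g \<circ> f\<close>.\<close>

definition localized_action ::
  "('k::real_normed_field, 'a) top_algebra \<Rightarrow> 'a \<Rightarrow> ('g \<Rightarrow> 'a \<Rightarrow> 'a) \<Rightarrow>
     'g \<Rightarrow> (real \<Rightarrow> 'a) set \<Rightarrow> (real \<Rightarrow> 'a) set" where
  "localized_action A z \<alpha> g X =
     (\<Union>f\<in>X. localization_ideal A z +>\<^bsub>smooth_algebra real_line A\<^esub> (\<alpha> g \<circ> f))"

definition nc_principal_bundle ::
  "'g monoid \<Rightarrow> (complex, 'a) top_algebra \<Rightarrow> ('g \<Rightarrow> 'a \<Rightarrow> 'a) \<Rightarrow> bool" where
  "nc_principal_bundle G A \<alpha> \<longleftrightarrow> dynamical_system G A \<alpha> \<and>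
     (\<forall>\<omega> \<in> characters (subalgebra_on A (fixed_center G A \<alpha>)).
        \<exists>z \<in> fixed_center G A \<alpha>. \<omega> z \<noteq> 0 \<and>
          trivial_nc_principal_bundle G (smooth_localization A z) (localized_action A z \<alpha>))"


section \<open>Principal bundles with discrete structure group\<close>

definition principal_bundle ::
  "'p manifold \<Rightarrow> 'm manifold \<Rightarrow> 'g monoid \<Rightarrow> ('p \<Rightarrow> 'm) \<Rightarrow> ('p \<Rightarrow> 'g \<Rightarrow> 'p) \<Rightarrow> bool" where
  "principal_bundle P M G q \<sigma> \<longleftrightarrow>
     smooth_manifold P \<and> smooth_manifold M \<and> smooth_map P M q \<and>
     smooth_map (times_discrete P (carrier G)) P (\<lambda>(p, g). \<sigma> p g) \<and>
     (\<forall>p\<in>points P. \<sigma> p \<one>\<^bsub>G\<^esub> = p) \<and>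
     (\<forall>p\<in>points P. \<forall>g\<in>carrier G. \<forall>h\<in>carrier G. \<sigma> p (g \<otimes>\<^bsub>G\<^esub> h) = \<sigma> (\<sigma> p g) h) \<and>
     (\<forall>p\<in>points P. \<forall>g\<in>carrier G. q (\<sigma> p g) = q p) \<and>
     (\<forall>m\<in>points M. \<exists>U \<Phi>. openin (mtop M) U \<and> m \<in> U \<and>
        diffeomorphism (open_submanifold P {p \<in> points P. q p \<in> U})
          (times_discrete (open_submanifold M U) (carrier G)) \<Phi> \<and>
        (\<forall>p\<in>points P. q p \<in> U \<longrightarrow> fst (\<Phi> p) = q p \<and>
           (\<forall>g\<in>carrier G. \<Phi> (\<sigma> p g) = (q p, snd (\<Phi> p) \<otimes>\<^bsub>G\<^esub> g))))"

definition bundle_action ::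
  "'p manifold \<Rightarrow> ('p \<Rightarrow> 'g \<Rightarrow> 'p) \<Rightarrow> ('g \<Rightarrow> 'a \<Rightarrow> 'a) \<Rightarrow> 'g \<Rightarrow> ('p \<Rightarrow> 'a) \<Rightarrow> 'p \<Rightarrow> 'a" where
  "bundle_action P \<sigma> \<pi> g f = (\<lambda>p\<in>points P. \<pi> g (f (\<sigma> p g)))"

end

theory Submission
  imports Defs "HOL-Computational_Algebra.Polynomial"
begin

text \<open>
  For a \<open>\<Lambda>\<close>-invariant smooth function \<open>v\<close> on \<open>P\<close>, put \<open>z = v 1\<close>. If the bundle is
  trivial over the support of \<open>v\<close>, a trivialization is a locally constant equivariant map
  \<open>\<gamma>\<close> into \<open>\<Lambda>\<close>, and with an invariant cut-off \<open>u\<close> equal to 1 where \<open>v\<close> does not vanish the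
  constant curve \<open>a = u \<chi>(\<gamma>) 1\<close> lies in the isotypic component of the character \<open>\<chi>\<close>.
  As \<open>z (a\<^sup>n - 1) = 0\<close>, the element \<open>a\<^sup>n - 1 = (1 - t z) (a\<^sup>n - 1)\<close> belongs to the ideal that
  defines the localization, so \<open>a\<close> trivialises the localization at \<open>z\<close>.

  Some such \<open>v\<close> is not killed by a given character \<open>\<omega>\<close>. Otherwise take a countable locally
  finite family \<open>w n \<ge> 0\<close> of such functions without common zero, and put
  \<open>f = (\<Sum>n. w n)\<close>, \<open>h = (\<Sum>n. n w n)\<close> and \<open>c = \<omega> h / \<omega> f\<close>. Finite sums of the \<open>w n\<close> are
  killed, hence for \<open>T = (\<Sum>n\<ge>N. (n - Re c) w n)\<close> with large \<open>N\<close> the strictly positive function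
  \<open>T\<^sup>2 + (Im c)\<^sup>2 f\<^sup>2 + (\<Sum>n<N. w n)\<close> is both invertible and killed.

  Spaces of smooth functions are handled through an exponential law: a map into such a space is
  continuous as soon as all partial derivatives are jointly continuous in the parameter and the
  point.
\<close>

section \<open>Finite abelian groups as products of cyclic groups\<close>

text \<open>The argument on characters adapts the classical proof that the characters of an algebra
  of smooth functions are point evaluations. That proof uses a function with compact level sets;
  here the quotient of \<open>h\<close> by \<open>f\<close> is large wherever only functions
  \<open>w n\<close> of large index are nonzero, and compactness is replaced by finiteness of the
  index set. The obstacle is that \<omega> is given as a linear and multiplicative map only: it need
  not be continuous, so it cannot be moved through an infinite sum, and its values may be complex.
  Hence the detour through a sum of squares of real functions. Two demands of the definitions shape
  the rest. The generators have to be independent and at the same time least in number, so the group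
  has to be decomposed within minimal generating sets. And a trivial bundle is in particular a
  dynamical system, so the function algebras and their quotients must be shown to be Hausdorff
  locally convex algebras with a continuous action. Their topology is given by convex open sets, and
  the calculus is built directly on these.\<close>

locale finite_comm_group = comm_group G for G :: "'g monoid" (structure) +
  assumes finite_carrier: "finite (carrier G)"

text \<open>An elementary operation on generators, undone by
  \<open>y = inv x \<otimes> (x \<otimes> y)\<close>; each family therefore lies in the subgroup
  generated by the other.\<close>

lemma (in finite_comm_group) generate_swap_mult:
  assumes S: "S \<subseteq> carrier G" "x \<in> S" "y \<in> S" "x \<noteq> y"
  shows "generate G (insert (x \<otimes> y) (S - {y})) = generate G S"
proof
  have c: "x \<in> carrier G" "y \<in> carrier G" using S by auto
  show "generate G (insert (x \<otimes> y) (S - {y})) \<subseteq> generate G S"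
  proof (rule generate_subgroup_incl)
    show "insert (x \<otimes> y) (S - {y}) \<subseteq> generate G S"
      using S by (auto intro: generate.incl generate.eng)
    show "subgroup (generate G S) G" using S generate_is_subgroup by auto
  qed
  let ?T = "insert (x \<otimes> y) (S - {y})"
  have T: "?T \<subseteq> carrier G" using S by auto
  have sg: "subgroup (generate G ?T) G" using T generate_is_subgroup by auto
  have "inv x \<otimes> (x \<otimes> y) \<in> generate G ?T"
    using S by (intro generate.eng generate.inv generate.incl) auto
  then have "y \<in> generate G ?T" using c by (simp add: m_assoc[symmetric])
  moreover have "z \<in> generate G ?T" if "z \<in> S" "z \<noteq> y" for z
    using that by (intro generate.incl) auto
  ultimately have "S \<subseteq> generate G ?T" by blast
  then show "generate G S \<subseteq> generate G ?T"
    by (rule generate_subgroup_incl) (rule sg)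
qed

text \<open>A collision of \<open>x \<otimes> y\<close> with another generator would leave the
  strictly smaller generating set \<open>S - {y}\<close>. Hence the new set has as many elements as
  \<open>S\<close> and is again minimal.\<close>

lemma (in finite_comm_group) minimal_generators_swap_mult:
  assumes S: "minimal_generators G S" "x \<in> S" "y \<in> S" "x \<noteq> y"
  shows "minimal_generators G (insert (x \<otimes> y) (S - {y}))" "x \<otimes> y \<notin> S - {y}"
proof -
  have fin: "finite S" and sub: "S \<subseteq> carrier G" and gen: "generate G S = carrier G"
    and min: "\<And>T. finite T \<Longrightarrow> T \<subseteq> carrier G \<Longrightarrow> generate G T = carrier G \<Longrightarrow> card S \<le> card T"
    using S(1) unfolding minimal_generators_def by auto
  let ?T = "insert (x \<otimes> y) (S - {y})"
  have T: "finite ?T" "?T \<subseteq> carrier G" "generate G ?T = carrier G"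
    using fin sub S gen generate_swap_mult[OF sub S(2-4)] by auto
  have "card S \<le> card ?T" by (rule min[OF T])
  moreover have "card (S - {y}) < card S" using fin S(3) by (metis card_Diff1_less)
  ultimately show "x \<otimes> y \<notin> S - {y}" by (metis insert_absorb not_le)
  then have "card ?T = card S"
    using fin S(3) by (simp add: card_Suc_Diff1 del: card_Diff_insert)
  then show "minimal_generators G ?T"
    unfolding minimal_generators_def using T min by simp
qed

text \<open>Rado's Euclidean argument: subtracting exponents turns a relation into a torsion element
  that belongs to another minimal generating set.\<close>

lemma (in finite_comm_group) relation_imp_torsion_generator:
  assumes "minimal_generators G S" "T \<subseteq> S"
    and "finprod G (\<lambda>x. x [^] (m x :: nat)) (S - T) = \<one>"
    and "\<exists>x\<in>S - T. m x > 0"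
  shows "\<exists>S' y d. minimal_generators G S' \<and> T \<subseteq> S' \<and> y \<in> S' - T \<and> d > 0 \<and> y [^] (d::nat) = \<one> \<and>
           (\<forall>x\<in>S - T. d dvd m x)"
  using assms
proof (induction "\<Sum>x\<in>S - T. m x" arbitrary: S m rule: less_induct)
  case less
  note MS = less.prems(1)
  have fin: "finite S" and sub: "S \<subseteq> carrier G"
    using MS unfolding minimal_generators_def by auto
  obtain a where a: "a \<in> S - T" "m a > 0" using less.prems by auto
  show ?case
  proof (cases "\<exists>b\<in>S - T. b \<noteq> a \<and> m b > 0")
    case False
    \<comment> \<open>A single positive exponent is left, so the relation itself is the torsion
      statement, with \<open>d = m a\<close>.\<close>
    then have z: "m b = 0" if "b \<in> S - T" "b \<noteq> a" for b using that by auto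
    have "finprod G (\<lambda>x. x [^] m x) (S - T) = finprod G (\<lambda>x. if a = x then x [^] m x else \<one>) (S - T)"
      by (rule finprod_cong') (use sub a z in auto)
    also have "\<dots> = a [^] m a"
      using a fin sub by (subst finprod_singleton) auto
    finally have "a [^] m a = \<one>" using less.prems by simp
    then show ?thesis
      using MS less.prems(2) a z by (intro exI[of _ S] exI[of _ a] exI[of _ "m a"]) (metis dvd_0_right dvd_refl)
  next
    case True
    then obtain b where b: "b \<in> S - T" "b \<noteq> a" "m b > 0" by auto
    obtain x y where xy: "x \<in> S - T" "y \<in> S - T" "x \<noteq> y" "m y > 0" "m y \<le> m x"
      using a b by (metis linorder_linear)
    have c: "x \<in> carrier G" "y \<in> carrier G" using xy sub by auto
    let ?S = "insert (x \<otimes> y) (S - {y})"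
    \<comment> \<open>Since \<open>x^i y^j = x^(i-j) (x y)^j\<close>, the relation survives while
      its total exponent drops by \<open>m y > 0\<close>. A \<open>d\<close> dividing
      \<open>m y\<close> and \<open>m x - m y\<close> also divides \<open>m x\<close>, so
      divisibility carries back to the old exponents.\<close>
    let ?m = "m(x := m x - m y, x \<otimes> y := m y)"
    have S': "minimal_generators G ?S" and nin: "x \<otimes> y \<notin> S - {y}"
      using minimal_generators_swap_mult[OF MS, of x y] xy by auto
    have T: "T \<subseteq> ?S" using less.prems(2) xy by auto
    have ninT: "x \<otimes> y \<notin> T" using nin less.prems(2) xy by auto
    define Q where "Q = S - T - {x, y}"
    have R: "?S - T = insert (x \<otimes> y) (insert x Q)" and R': "S - T = insert x (insert y Q)"
      using xy ninT by (auto simp: Q_def)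
    have nR: "x \<otimes> y \<notin> insert x Q" using nin xy by (auto simp: Q_def)
    have ninR: "x \<notin> Q" "y \<notin> Q" by (auto simp: Q_def)
    have finR: "finite Q" "Q \<subseteq> carrier G" using fin sub by (auto simp: Q_def)
    have eqR: "finprod G (\<lambda>t. t [^] ?m t) Q = finprod G (\<lambda>t. t [^] m t) Q"
      using nR finR ninR by (intro finprod_cong') auto
    have cR: "finprod G (\<lambda>t. t [^] m t) Q \<in> carrier G" using finR by (intro finprod_closed) auto
    have clR: "(\<lambda>t. t [^] m t) \<in> Q \<rightarrow> carrier G" using finR by auto
    have clR': "(\<lambda>t. t [^] ?m t) \<in> Q \<rightarrow> carrier G" using finR by auto
    have "finprod G (\<lambda>t. t [^] ?m t) (?S - T)
        = ((x \<otimes> y) [^] m y) \<otimes> ((x [^] (m x - m y)) \<otimes> finprod G (\<lambda>t. t [^] m t) Q)"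
      unfolding R using nR finR c clR' xy(3) ninR
      by (subst finprod_insert, simp, simp, simp add: Pi_iff, simp, subst finprod_insert)
         (auto simp: eqR simp del: fun_upd_apply, auto)
    also have "(x \<otimes> y) [^] m y = x [^] m y \<otimes> y [^] m y"
      using c by (simp add: nat_pow_distrib)
    also have "(x [^] m y \<otimes> y [^] m y) \<otimes> ((x [^] (m x - m y)) \<otimes> finprod G (\<lambda>t. t [^] m t) Q)
        = (x [^] m y \<otimes> x [^] (m x - m y)) \<otimes> (y [^] m y \<otimes> finprod G (\<lambda>t. t [^] m t) Q)"
      using c cR by (simp add: m_ac)
    also have "x [^] m y \<otimes> x [^] (m x - m y) = x [^] m x"
      using c xy by (simp add: nat_pow_mult)
    also have "x [^] m x \<otimes> (y [^] m y \<otimes> finprod G (\<lambda>t. t [^] m t) Q) = finprod G (\<lambda>t. t [^] m t) (S - T)"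
      unfolding R' using finR c clR xy(3) ninR by simp
    also note less.prems(3)
    finally have rel: "finprod G (\<lambda>t. t [^] ?m t) (?S - T) = \<one>" .
    have sR: "(\<Sum>t\<in>Q. ?m t) = (\<Sum>t\<in>Q. m t)" using nR ninR by (intro sum.cong) auto
    have xny: "x \<otimes> y \<noteq> x" using nR by auto
    have "(\<Sum>t\<in>?S - T. ?m t) = m y + (m x - m y + (\<Sum>t\<in>Q. m t))"
      unfolding R using nR finR xny ninR by (simp add: sR del: fun_upd_apply) (simp add: sR)
    moreover have "(\<Sum>t\<in>S - T. m t) = m x + (m y + (\<Sum>t\<in>Q. m t))"
      unfolding R' using finR xy(3) ninR by simp
    ultimately have lt: "(\<Sum>t\<in>?S - T. ?m t) < (\<Sum>t\<in>S - T. m t)" using xy by simp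
    have pos: "\<exists>t\<in>?S - T. ?m t > 0" unfolding R using xy by auto
    obtain S' z d where D: "minimal_generators G S'" "T \<subseteq> S'" "z \<in> S' - T" "d > 0" "z [^] d = \<one>"
      and dvd: "\<forall>t\<in>?S - T. d dvd ?m t"
      using less.hyps[OF lt S' T rel pos] by blast
    have d1: "d dvd m y" and d2: "d dvd m x - m y" using dvd xny unfolding R by auto
    then have "d dvd m x" using xy(5) by (metis dvd_add le_add_diff_inverse)
    moreover have "d dvd m t" if "t \<in> Q" for t
    proof -
      have "d dvd ?m t" using dvd that unfolding R by blast
      moreover have "t \<noteq> x" "t \<noteq> x \<otimes> y" using that nR by (auto simp: Q_def)
      ultimately show ?thesis by simp
    qed
    ultimately have "\<forall>t\<in>S - T. d dvd m t" using d1 unfolding R' by auto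
    then show ?thesis using D by blast
  qed
qed

text \<open>The independent generators are chosen greedily, each of least possible order.\<close>

lemma (in finite_comm_group) ex_independent_minimal_generators:
  shows "\<exists>S. minimal_generators G S \<and>
    (\<forall>m. finprod G (\<lambda>x. x [^] (m x :: nat)) S = \<one> \<longrightarrow> (\<forall>x\<in>S. x [^] m x = \<one>))"
proof -
  define rank where "rank = (LEAST k. \<exists>T. finite T \<and> T \<subseteq> carrier G \<and> generate G T = carrier G \<and> card T = k)"
  have "generate G (carrier G) = carrier G"
    by (metis subset_refl generate_incl generate.incl subsetI subset_antisym)
  then have "\<exists>k T. finite T \<and> T \<subseteq> carrier G \<and> generate G T = carrier G \<and> card T = k"
    using finite_carrier by blast
  then have "\<exists>T. finite T \<and> T \<subseteq> carrier G \<and> generate G T = carrier G \<and> card T = rank"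
    unfolding rank_def by (rule LeastI_ex)
  moreover have "rank \<le> card T" if "finite T" "T \<subseteq> carrier G" "generate G T = carrier G" for T
    unfolding rank_def by (rule Least_le) (use that in blast)
  ultimately obtain S0 where S0: "minimal_generators G S0" "card S0 = rank"
    unfolding minimal_generators_def by metis
  have card: "card S = rank" if "minimal_generators G S" for S
    using that S0 unfolding minimal_generators_def by (metis order_antisym)
  \<comment> \<open>All minimal generating sets above \<open>T\<close> are quantified over, because
    each round of the induction may pass to a different one.\<close>
  define indep where "indep T \<longleftrightarrow> (\<forall>S m. minimal_generators G S \<longrightarrow> T \<subseteq> S \<longrightarrow>
      finprod G (\<lambda>x. x [^] (m x :: nat)) S = \<one> \<longrightarrow> (\<forall>x\<in>T. x [^] m x = \<one>))" for T
  have "\<exists>T S. card T = k \<and> minimal_generators G S \<and> T \<subseteq> S \<and> indep T" if "k \<le> rank" for k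
    using that
  proof (induction k)
    case 0
    show ?case by (rule exI[of _ "{}"]) (use S0 in \<open>auto simp: indep_def\<close>)
  next
    case (Suc k)
    then obtain T S where T: "card T = k" "minimal_generators G S" "T \<subseteq> S" "indep T" by auto
    \<comment> \<open>Candidates are collected from every minimal generating set above
      \<open>T\<close>, not just from the current \<open>S\<close>: the torsion generator found
      below lives in some other set \<open>S'\<close> and must still compete with
      \<open>x\<close>.\<close>
    let ?C = "\<lambda>y. \<exists>S. minimal_generators G S \<and> T \<subseteq> S \<and> y \<in> S - T"
    have "T \<noteq> S" using card[OF T(2)] T(1) Suc.prems by auto
    then have "\<exists>y. ?C y" using T by blast
    then obtain x where x: "?C x" and xmin: "\<And>y. ?C y \<Longrightarrow> ord x \<le> ord y"
      using ex_has_least_nat[of ?C _ ord] by metis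
    then obtain S1 where S1: "minimal_generators G S1" "T \<subseteq> S1" "x \<in> S1 - T" by blast
    have xc: "x \<in> carrier G" using S1 unfolding minimal_generators_def by auto
    have finT: "finite T" using S1 unfolding minimal_generators_def by (meson finite_subset)
    have "indep (insert x T)"
      unfolding indep_def
    proof (intro allI impI)
      fix S m assume S: "minimal_generators G S" "insert x T \<subseteq> S"
        and rel: "finprod G (\<lambda>x. x [^] (m x :: nat)) S = \<one>"
      have finS: "finite S" and sub: "S \<subseteq> carrier G" using S unfolding minimal_generators_def by auto
      have relT: "\<forall>t\<in>T. t [^] m t = \<one>" using T(4) S rel unfolding indep_def by blast
      have "x [^] m x = \<one>"
      proof (rule ccontr)
        assume nx: "x [^] m x \<noteq> \<one>"
        \<comment> \<open>Reducing the exponent of \<open>x\<close> below \<open>ord x\<close> keeps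
          the relation, and independence of \<open>T\<close> removes its part over \<open>T\<close>.
          The resulting \<open>y\<close> satisfies
          \<open>ord y \<le> d \<le> m x mod ord x < ord x\<close>, against the choice of
          \<open>x\<close>.\<close>
        let ?m = "m(x := m x mod ord x)"
        have ordpos: "ord x > 0" using xc finite_carrier by (metis ord_ge_1 less_eq_Suc_le One_nat_def)
        have pm: "x [^] (m x mod ord x) = x [^] m x" 
          by (metis mod_mult_div_eq nat_pow_closed nat_pow_mult nat_pow_one nat_pow_pow pow_ord_eq_1 r_one xc)
        have "finprod G (\<lambda>t. t [^] m t) S = finprod G (\<lambda>t. t [^] m t) T \<otimes> finprod G (\<lambda>t. t [^] m t) (S - T)"
          using finS sub S(2) finT
          by (subst finprod_Un_disjoint[symmetric]) (auto simp: Un_absorb1 intro!: finprod_cong')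
        also have "finprod G (\<lambda>t. t [^] m t) T = \<one>" using relT by (intro finprod_one_eqI) auto
        also have "finprod G (\<lambda>t. t [^] m t) (S - T) = finprod G (\<lambda>t. t [^] ?m t) (S - T)"
          using sub pm by (intro finprod_cong') auto
        finally have r: "finprod G (\<lambda>t. t [^] ?m t) (S - T) = \<one>"
          using rel sub by (subst (asm) l_one) (auto intro!: finprod_closed)
        have xST: "x \<in> S - T" using S(2) S1 by auto
        have mpos: "?m x > 0" using nx pm nat_pow_0 by (metis fun_upd_same gr0I)
        obtain S' y d where D: "minimal_generators G S'" "T \<subseteq> S'" "y \<in> S' - T" "d > 0" "y [^] d = \<one>"
          "\<forall>t\<in>S - T. d dvd ?m t"
          using relation_imp_torsion_generator[OF S(1) _ r] S(2) xST mpos by blast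
        have "y \<in> carrier G" using D unfolding minimal_generators_def by auto
        then have "ord y \<le> d" using D(4,5) by (meson dvd_imp_le pow_eq_id)
        moreover have "d \<le> ?m x" using D(6) xST mpos by (meson dvd_imp_le)
        moreover have "?m x < ord x" using ordpos by simp
        moreover have "ord x \<le> ord y" using xmin D(1-3) by blast
        ultimately show False by simp
      qed
      then show "\<forall>t\<in>insert x T. t [^] m t = \<one>" using relT by auto
    qed
    moreover have "card (insert x T) = Suc k" using finT T(1) S1 by simp
    ultimately show ?case using S1 by (intro exI[of _ "insert x T"] exI[of _ S1]) auto
  qed
  then obtain T S where T: "card T = rank" "minimal_generators G S" "T \<subseteq> S" "indep T" by blast
  then have "T = S" using card[OF T(2)] unfolding minimal_generators_def by (metis card_subset_eq)
  then have "indep S" using T(4) by simp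
  then have "finprod G (\<lambda>x. x [^] m x) S = \<one> \<longrightarrow> (\<forall>x\<in>S. x [^] m x = \<one>)" for m :: "'g \<Rightarrow> nat"
    using T(2) unfolding indep_def by blast
  then show ?thesis using T(2) by blast
qed

text \<open>Independence is formulated with natural exponents; finite order allows an integer
  exponent to be reduced modulo \<open>ord s\<close>.\<close>

lemma (in finite_comm_group) carrier_cyclic_nat:
  assumes "s \<in> carrier G" "y \<in> carrier (subgroup_generated G {s})"
  obtains k :: nat where "y = s [^] k"
proof -
  obtain k :: int where k: "y = s [^] k"
    using assms carrier_subgroup_generated_by_singleton[OF assms(1)] by auto
  have o: "ord s > 0" using assms finite_carrier by (metis ord_ge_1 less_eq_Suc_le One_nat_def)
  have "s [^] k = s [^] (k mod int (ord s))"
    using assms(1) o by (simp add: int_pow_eq mod_eq_dvd_iff[symmetric])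
  also have "\<dots> = s [^] nat (k mod int (ord s))"
    using o by (metis int_nat_eq int_pow_int of_nat_0_less_iff pos_mod_sign)
  finally show ?thesis using that k by simp
qed

text \<open>The image of the product map is a subgroup containing \<open>S\<close>, hence
  everything; a trivial kernel is what the independence hypothesis expresses.\<close>

lemma (in finite_comm_group) internal_cyclic_productI:
  assumes S: "minimal_generators G S"
    and ind: "\<And>m. finprod G (\<lambda>x. x [^] (m x :: nat)) S = \<one> \<Longrightarrow> \<forall>x\<in>S. x [^] m x = \<one>"
  shows "internal_cyclic_product G S"
proof -
  have finS: "finite S" and sub: "S \<subseteq> carrier G" and gen: "generate G S = carrier G"
    using S unfolding minimal_generators_def by auto
  let ?P = "product_group S (\<lambda>s. subgroup_generated G {s})"
  let ?F = "\<lambda>x. finprod G x S"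
  have cP: "x \<in> S \<rightarrow> carrier G" if "x \<in> carrier ?P" for x
  proof
    fix s assume s: "s \<in> S"
    have "x s \<in> carrier (subgroup_generated G {s})" using that s by auto
    then show "x s \<in> carrier G" using carrier_subgroup_generated_subset by blast
  qed
  have hom: "?F \<in> hom ?P G"
  proof (rule homI)
    fix x assume "x \<in> carrier ?P" then show "?F x \<in> carrier G" using cP by auto
  next
    fix x y assume x: "x \<in> carrier ?P" and y: "y \<in> carrier ?P"
    have "?F (x \<otimes>\<^bsub>?P\<^esub> y) = finprod G (\<lambda>s. x s \<otimes> y s) S"
      using cP[OF x] cP[OF y] by (intro finprod_cong') auto
    also have "\<dots> = ?F x \<otimes> ?F y" using cP[OF x] cP[OF y] by (rule finprod_multf)
    finally show "?F (x \<otimes>\<^bsub>?P\<^esub> y) = ?F x \<otimes> ?F y" .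
  qed
  have "group ?P" by (intro product_group) auto
  then interpret F: group_hom ?P G ?F
    using hom by (simp add: group_hom_def group_hom_axioms_def is_group)
  have sgen: "s \<in> carrier (subgroup_generated G {s})" if "s \<in> S" for s
    using that sub by (auto simp: carrier_subgroup_generated intro: generate.incl)
  show ?thesis
    unfolding internal_cyclic_product_def F.iso_iff
  proof (intro conjI ballI impI)
    have "S \<subseteq> ?F ` carrier ?P"
    proof
      fix s assume s: "s \<in> S"
      let ?x = "\<lambda>t\<in>S. if s = t then t else \<one>"
      have xP: "?x \<in> carrier ?P" using sgen
        by (auto simp: carrier_subgroup_generated intro: generate.one)
      have "?F ?x = finprod G (\<lambda>t. if s = t then t else \<one>) S"
        using sub by (intro finprod_cong') auto
      also have "\<dots> = s" using s finS sub finprod_singleton[of s S "\<lambda>t. t"] by auto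
      finally show "s \<in> ?F ` carrier ?P" by (rule image_eqI[OF sym xP])
    qed
    then have "generate G S \<subseteq> ?F ` carrier ?P"
      using F.img_is_subgroup by (rule generate_subgroup_incl)
    then show "carrier G \<subseteq> ?F ` carrier ?P" using gen by simp
  next
    fix x assume x: "x \<in> carrier ?P" and one: "?F x = \<one>"
    have "\<exists>k::nat. x s = s [^] k" if "s \<in> S" for s
    proof -
      have "x s \<in> carrier (subgroup_generated G {s})" using x that by auto
      then show ?thesis using carrier_cyclic_nat[of s "x s"] that sub by blast
    qed
    then obtain m where m: "\<And>s. s \<in> S \<Longrightarrow> x s = s [^] (m s :: nat)" by metis
    have "finprod G (\<lambda>s. s [^] m s) S = ?F x"
      by (rule finprod_cong') (use m cP[OF x] sub in auto)
    then have "\<forall>s\<in>S. s [^] m s = \<one>" using ind one by simp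
    then show "x = \<one>\<^bsub>?P\<^esub>"
      using x m by (auto simp: PiE_iff extensional_def fun_eq_iff)
  qed
qed

lemma (in finite_comm_group) ex_minimal_internal_cyclic_product:
  shows "\<exists>S. minimal_generators G S \<and> internal_cyclic_product G S"
  using ex_independent_minimal_generators internal_cyclic_productI by metis

section \<open>Characters dual to a system of independent generators\<close>

lemma exp_cyclic_eq:
  assumes "(n::nat) > 0" "int n dvd k - l"
  shows "exp (2 * pi * \<i> * of_int k / of_nat n) = exp (2 * pi * \<i> * of_int l / of_nat n)"
proof -
  obtain j where "k - l = int n * j" using assms by (auto simp: dvd_def)
  then have "k = l + int n * j" by simp
  then have "2 * pi * \<i> * of_int k / of_nat n = 2 * pi * \<i> * of_int l / of_nat n + of_int (2 * j) * pi * \<i>"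
    using assms by (simp add: field_simps)
  then show ?thesis by (metis exp_eq add.commute mult.commute mult.left_commute)
qed

text \<open>Invert the product isomorphism, project to the factor of \<open>s\<close>, and embed
  this cyclic group into the circle by sending \<open>s\<close> to a primitive root of
  unity.\<close>

lemma (in finite_comm_group) ex_dual_generator:
  assumes S: "minimal_generators G S"
    and P: "internal_cyclic_product G S" and s: "s \<in> S"
  shows "\<exists>\<omega>. \<omega> \<in> hom G circle_group \<and> \<omega> \<in> extensional (carrier G) \<and>
        \<omega> s = exp (2 * pi * \<i> / of_nat (ord s)) \<and> (\<forall>t\<in>S - {s}. \<omega> t = 1)"
proof -
  have finS: "finite S" and sub: "S \<subseteq> carrier G" and gen: "generate G S = carrier G"
    using S unfolding minimal_generators_def by auto
  let ?P = "product_group S (\<lambda>s. subgroup_generated G {s})"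
  let ?F = "\<lambda>x. finprod G x S"
  have F: "?F \<in> iso ?P G" using P unfolding internal_cyclic_product_def .
  have sc: "s \<in> carrier G" using s sub by auto
  have o: "ord s > 0" using finite_carrier sc by (metis ord_ge_1 less_eq_Suc_le One_nat_def)
  define R where "R = inv_into (carrier ?P) ?F"
  have gP: "group ?P" by (intro product_group) auto
  have R: "R \<in> iso G ?P" unfolding R_def using group.iso_set_sym[OF gP F] by simp
  then have Rh: "R \<in> hom G ?P" by (simp add: iso_def)
  have RF: "R (?F x) = x" if "x \<in> carrier ?P" for x
    using F that unfolding R_def iso_def bij_betw_def by (auto intro: inv_into_f_f)
  have Rc: "R g \<in> carrier ?P" if "g \<in> carrier G" for g using Rh that by (meson hom_in_carrier)
  have sgen: "t \<in> carrier (subgroup_generated G {t})" if "t \<in> S" for t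
    using that sub by (auto simp: carrier_subgroup_generated intro: generate.incl)
  have RS: "R t s = (if s = t then s else \<one>)" if t: "t \<in> S" for t
  proof -
    let ?x = "\<lambda>u\<in>S. if t = u then u else \<one>"
    have "?x \<in> carrier ?P" using sgen
      by (auto simp: carrier_subgroup_generated intro: generate.one)
    moreover have "?F ?x = finprod G (\<lambda>u. if t = u then u else \<one>) S"
      using sub by (intro finprod_cong') auto
    moreover have "\<dots> = t" using t finS sub finprod_singleton[of t S "\<lambda>t. t"] by auto
    ultimately have "R t = ?x" using RF by metis
    then show ?thesis using s by auto
  qed
  define ex where "ex g = (SOME k::int. R g s = s [^] k)" for g
  have ex: "R g s = s [^] ex g" if "g \<in> carrier G" for g
  proof -
    have "R g s \<in> carrier (subgroup_generated G {s})" using Rc[OF that] s by auto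
    then have "\<exists>k::int. R g s = s [^] k"
      using carrier_subgroup_generated_by_singleton[OF sc] by auto
    then show ?thesis unfolding ex_def by (rule someI_ex)
  qed
  define \<omega> where "\<omega> = (\<lambda>g\<in>carrier G. exp (2 * pi * \<i> * of_int (ex g) / of_nat (ord s)))"
  \<comment> \<open>The exponents chosen by \<open>ex\<close> are not additive; but the value
    depends only on the exponent modulo \<open>ord s\<close>, so any exponent of the component may
    be used instead.\<close>
  have w: "\<omega> g = exp (2 * pi * \<i> * of_int k / of_nat (ord s))" if "g \<in> carrier G" "R g s = s [^] k" for g k
  proof -
    have "s [^] ex g = s [^] k" using ex that by metis
    then have "int (ord s) dvd ex g - k" using sc by (simp add: int_pow_eq dvd_diff_commute)
    from exp_cyclic_eq[OF o this] show ?thesis unfolding \<omega>_def using that by simp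
  qed
  have "\<omega> \<in> hom G circle_group"
  proof (rule homI)
    fix g assume "g \<in> carrier G"
    then show "\<omega> g \<in> carrier circle_group"
      by (simp add: \<omega>_def circle_group_def norm_exp_eq_Re)
  next
    fix g h assume g: "g \<in> carrier G" and h: "h \<in> carrier G"
    have "R (g \<otimes> h) s = s [^] (ex g + ex h)"
      using hom_mult[OF Rh g h] ex[OF g] ex[OF h] s sc by (simp add: int_pow_mult)
    then have "\<omega> (g \<otimes> h) = exp (2 * pi * \<i> * of_int (ex g + ex h) / of_nat (ord s))"
      using w g h by simp
    also have "\<dots> = \<omega> g * \<omega> h"
      using g h by (simp add: \<omega>_def exp_add[symmetric] distrib_left add_divide_distrib)
    finally show "\<omega> (g \<otimes> h) = \<omega> g \<otimes>\<^bsub>circle_group\<^esub> \<omega> h" by (simp add: circle_group_def)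
  qed
  moreover have "\<omega> \<in> extensional (carrier G)" by (simp add: \<omega>_def)
  moreover have "\<omega> s = exp (2 * pi * \<i> / of_nat (ord s))"
    using w[of s 1] RS[OF s] sc by simp
  moreover have "\<omega> t = 1" if "t \<in> S - {s}" for t
    using w[of t 0] RS[of t] sub that by auto
  ultimately show ?thesis by blast
qed

text \<open>\<open>dual_generator\<close> is a definite description, so uniqueness is needed too: a
  character is determined by its values on generators. Likewise an induction over
  \<open>generate\<close> carries the power identity from the generators to the whole group.\<close>

lemma (in finite_comm_group) dual_generator:
  assumes S: "minimal_generators G S"
    and P: "internal_cyclic_product G S" and s: "s \<in> S"
  shows "dual_generator G S s \<in> hom G circle_group"
    and "g \<in> carrier G \<Longrightarrow> dual_generator G S s g ^ ord s = 1"
proof -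
  have finS: "finite S" and sub: "S \<subseteq> carrier G" and gen: "generate G S = carrier G"
    using S unfolding minimal_generators_def by auto
  let ?Q = "\<lambda>\<omega>. \<omega> \<in> hom G circle_group \<and> \<omega> \<in> extensional (carrier G) \<and>
        \<omega> s = exp (2 * pi * \<i> / of_nat (ord s)) \<and> (\<forall>t\<in>S - {s}. \<omega> t = 1)"
  have circ: "group circle_group"
    by (rule groupI) (auto simp: circle_group_def norm_mult intro!: bexI[of _ "inverse _"] left_inverse simp: norm_inverse)
  have gh: "group_hom G circle_group \<omega>" if "\<omega> \<in> hom G circle_group" for \<omega>
    using that circ by (simp add: group_hom_def group_hom_axioms_def group_axioms)
  have uniq: "\<omega> = \<omega>'" if "?Q \<omega>" "?Q \<omega>'" for \<omega> \<omega>'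
  proof -
    interpret w: group_hom G circle_group \<omega> using gh that by blast
    interpret w': group_hom G circle_group \<omega>' using gh that by blast
    have "\<omega> g = \<omega>' g" if "g \<in> generate G S" for g
      using that
    proof induction
      case one show ?case by simp
    next
      case (incl h) then show ?case using \<open>?Q \<omega>\<close> \<open>?Q \<omega>'\<close> by (cases "h = s") auto
    next
      case (inv h)
      have "\<omega> h = \<omega>' h" using inv \<open>?Q \<omega>\<close> \<open>?Q \<omega>'\<close> by (cases "h = s") auto
      then show ?case using inv sub by (simp add: subset_iff)
    next
      case (eng g h)
      then show ?case using gen by simp
    qed
    then show ?thesis using that gen by (intro extensionalityI[of _ "carrier G"]) auto
  qed
  have "\<exists>!\<omega>. ?Q \<omega>" using ex_dual_generator[OF assms] uniq by blast
  then have Q: "?Q (dual_generator G S s)" unfolding dual_generator_def by (rule theI')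
  then show "dual_generator G S s \<in> hom G circle_group" by blast
  interpret w: group_hom G circle_group "dual_generator G S s" using gh Q by blast
  have o: "ord s > 0" using finite_carrier s sub by (metis ord_ge_1 less_eq_Suc_le One_nat_def subsetD)
  show "dual_generator G S s g ^ ord s = 1" if "g \<in> carrier G"
  proof -
    have "g \<in> generate G S" using that gen by simp
    then show ?thesis
    proof induction
      case one show ?case using w.hom_one by (simp add: circle_group_def)
    next
      case (incl h)
      show ?case
      proof (cases "h = s")
        case True
        have "exp (2 * pi * \<i> / of_nat (ord s)) ^ ord s = exp (of_nat (ord s) * (2 * pi * \<i> / of_nat (ord s)))"
          by (rule exp_of_nat_mult[symmetric])
        also have "\<dots> = 1" using o by simp
        finally show ?thesis using True Q by simp
      qed (use incl Q in auto)
    next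
      case (inv h)
      have *: "dual_generator G S s h ^ ord s = 1"
      proof (cases "h = s")
        case True
        have "exp (2 * pi * \<i> / of_nat (ord s)) ^ ord s = exp (of_nat (ord s) * (2 * pi * \<i> / of_nat (ord s)))"
          by (rule exp_of_nat_mult[symmetric])
        also have "\<dots> = 1" using o by simp
        finally show ?thesis using True Q by simp
      qed (use inv Q in auto)
      have "h \<in> carrier G" using inv sub by auto
      then have "dual_generator G S s h * dual_generator G S s (m_inv G h) = 1"
        using w.hom_mult[of h "m_inv G h"] w.hom_one by (simp add: circle_group_def)
      then have "dual_generator G S s h ^ ord s * dual_generator G S s (m_inv G h) ^ ord s = 1"
        by (metis power_mult_distrib power_one)
      then show ?case using * by simp
    next
      case (eng g h)
      then show ?case using w.hom_mult[of g h] gen by (simp add: circle_group_def power_mult_distrib)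
    qed
  qed
qed

section \<open>Locally convex algebras and the mean value theorem\<close>

context lc_algebra
begin

sublocale ring A by (rule ring)

interpretation M: module "scalar_algebra :: ('k, 'k) top_algebra" A by (rule module)

lemma smult_closed [simp, intro]: "a \<in> carrier A \<Longrightarrow> c \<odot> a \<in> carrier A"
  using M.smult_closed by (simp add: scalar_algebra_def)

lemma smult_add_left: "a \<in> carrier A \<Longrightarrow> (c + d) \<odot> a = c \<odot> a \<oplus> d \<odot> a"
  using M.smult_l_distr[of c d a] by (simp add: scalar_algebra_def)

lemma smult_add_right: "a \<in> carrier A \<Longrightarrow> b \<in> carrier A \<Longrightarrow> c \<odot> (a \<oplus> b) = c \<odot> a \<oplus> c \<odot> b"
  using M.smult_r_distr[of c a b] by (simp add: scalar_algebra_def)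

lemma smult_smult: "a \<in> carrier A \<Longrightarrow> c \<odot> (d \<odot> a) = (c * d) \<odot> a"
  using M.smult_assoc1[of c d a] by (simp add: scalar_algebra_def)

lemma smult_1 [simp]: "a \<in> carrier A \<Longrightarrow> 1 \<odot> a = a"
  using M.smult_one by (simp add: scalar_algebra_def)

lemma smult_0_left [simp]: "a \<in> carrier A \<Longrightarrow> 0 \<odot> a = \<zero>"
  using M.smult_l_null by (simp add: scalar_algebra_def)

lemma smult_0_right [simp]: "c \<odot> \<zero> = \<zero>"
  using M.smult_r_null[of c] by (simp add: scalar_algebra_def)

lemma smult_minus_right: "a \<in> carrier A \<Longrightarrow> c \<odot> (\<ominus> a) = \<ominus> (c \<odot> a)"
  using M.smult_r_minus[of c a] by (simp add: scalar_algebra_def)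

lemma smult_diff_right:
  "a \<in> carrier A \<Longrightarrow> b \<in> carrier A \<Longrightarrow> c \<odot> (a \<ominus> b) = c \<odot> a \<ominus> c \<odot> b"
  by (simp add: a_minus_def smult_add_right smult_minus_right)

lemma smult_minus_1: "a \<in> carrier A \<Longrightarrow> (- 1) \<odot> a = \<ominus> a"
proof -
  assume a: "a \<in> carrier A"
  have "(- 1) \<odot> a \<oplus> a = (- 1 + 1) \<odot> a" using a by (subst smult_add_left) auto
  then have "(- 1) \<odot> a \<oplus> a = \<zero>" using a by simp
  then show ?thesis using a by (metis minus_equality smult_closed)
qed

lemma diff_add_diff:
  "a \<in> carrier A \<Longrightarrow> b \<in> carrier A \<Longrightarrow> c \<in> carrier A \<Longrightarrow> (a \<ominus> b) \<oplus> (b \<ominus> c) = a \<ominus> c"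
  by (simp add: a_minus_def a_assoc r_neg2 r_neg1)

lemma add_diff_add:
  "a \<in> carrier A \<Longrightarrow> b \<in> carrier A \<Longrightarrow> c \<in> carrier A \<Longrightarrow> d \<in> carrier A \<Longrightarrow>
   (a \<oplus> b) \<ominus> (c \<oplus> d) = (a \<ominus> c) \<oplus> (b \<ominus> d)"
  by (simp add: a_minus_def minus_add a_ac)

lemma add_diff_cancel: "a \<in> carrier A \<Longrightarrow> b \<in> carrier A \<Longrightarrow> a \<oplus> (b \<ominus> a) = b"
  by (simp add: a_minus_def a_lcomm[of a b] r_neg)

lemma diff_self [simp]: "a \<in> carrier A \<Longrightarrow> a \<ominus> a = \<zero>"
  by (simp add: a_minus_def r_neg)

text \<open>Reduces increments to the left to increments to the right, for which the mean value
  theorem is stated.\<close>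

lemma slope_swap:
  assumes "a \<in> carrier A" "b \<in> carrier A"
  shows "of_real (1 / (s - t)) \<odot> (a \<ominus> b) = of_real (1 / (t - s)) \<odot> (b \<ominus> a)"
proof -
  have "of_real (1 / (s - t)) = (of_real (1 / (t - s)) * (- 1) :: 'k)"
    by (metis minus_diff_eq mult_minus1_right minus_divide_right of_real_minus)
  moreover have "\<ominus> (a \<ominus> b) = b \<ominus> a" using assms by (simp add: a_minus_def minus_add a_comm)
  ultimately show ?thesis
    using assms by (metis smult_smult smult_minus_1 minus_closed)
qed

lemma continuous_map_add:
  assumes "continuous_map X (topo A) f" "continuous_map X (topo A) g"
  shows "continuous_map X (topo A) (\<lambda>x. f x \<oplus> g x)"
  using continuous_map_compose[OF continuous_map_pairedI[OF assms] continuous_add] by (simp add: o_def)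

lemma continuous_map_mult:
  assumes "continuous_map X (topo A) f" "continuous_map X (topo A) g"
  shows "continuous_map X (topo A) (\<lambda>x. f x \<otimes> g x)"
  using continuous_map_compose[OF continuous_map_pairedI[OF assms] continuous_mult] by (simp add: o_def)

lemma continuous_map_smult:
  assumes "continuous_map X euclidean c" "continuous_map X (topo A) f"
  shows "continuous_map X (topo A) (\<lambda>x. c x \<odot> f x)"
  using continuous_map_compose[OF continuous_map_pairedI[OF assms] continuous_smult] by (simp add: o_def)

lemma continuous_map_const_A: "a \<in> carrier A \<Longrightarrow> continuous_map X (topo A) (\<lambda>x. a)"
  by (simp add: topspace_topo)

lemma continuous_map_minus:
  assumes "continuous_map X (topo A) f"
  shows "continuous_map X (topo A) (\<lambda>x. \<ominus> f x)"
proof -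
  have "continuous_map X (topo A) (\<lambda>x. (- 1) \<odot> f x)" using assms by (intro continuous_map_smult) auto
  moreover have "f x \<in> carrier A" if "x \<in> topspace X" for x
    using assms that topspace_topo by (auto simp: continuous_map_def)
  ultimately show ?thesis
    by (elim continuous_map_eq) (simp add: smult_minus_1)
qed

lemma continuous_map_diff:
  assumes "continuous_map X (topo A) f" "continuous_map X (topo A) g"
  shows "continuous_map X (topo A) (\<lambda>x. f x \<ominus> g x)"
  unfolding a_minus_def using assms by (intro continuous_map_add continuous_map_minus)

lemma limitin_add:
  assumes "limitin (topo A) f a F" "limitin (topo A) g b F"
  shows "limitin (topo A) (\<lambda>x. f x \<oplus> g x) (a \<oplus> b) F"
  using continuous_map_limit[OF continuous_add, of "\<lambda>x. (f x, g x)" "(a, b)" F] assms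
  by (simp add: limitin_pairwise o_def)

lemma limitin_smult:
  assumes "(c \<longlongrightarrow> r) F" "limitin (topo A) g b F"
  shows "limitin (topo A) (\<lambda>x. c x \<odot> g x) (r \<odot> b) F"
  using continuous_map_limit[OF continuous_smult, of "\<lambda>x. (c x, g x)" "(r, b)" F] assms
  by (simp add: limitin_pairwise o_def)

section \<open>Derivatives of curves at the parameter 0\<close>

lemma has_curve_deriv_closed: "has_curve_deriv A c d \<Longrightarrow> d \<in> carrier A"
  unfolding has_curve_deriv_def using limitin_topspace topspace_topo by metis

lemma has_curve_deriv_unique:
  assumes "has_curve_deriv A c d" "has_curve_deriv A c d'"
  shows "d = d'"
  using assms unfolding has_curve_deriv_def
  by (rule limitin_Hausdorff_unique) (auto simp: hausdorff)

lemma curve_deriv_eq: "has_curve_deriv A c d \<Longrightarrow> curve_deriv A c = d"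
  unfolding curve_deriv_def by (rule the_equality) (auto dest: has_curve_deriv_unique)

text \<open>The filter is \<open>nhds 0\<close> and not \<open>at 0\<close>: the value at 0 enters
  every difference quotient and has to agree as well.\<close>

lemma has_curve_deriv_cong:
  assumes "\<forall>\<^sub>F h in nhds 0. c h = c' h" "has_curve_deriv A c d"
  shows "has_curve_deriv A c' d"
proof -
  have e: "\<forall>\<^sub>F h in at 0. c h = c' h" and 0: "c 0 = c' 0"
    using assms(1) by (auto simp: eventually_at_filter elim: eventually_mono dest: eventually_nhds_x_imp_x)
  show ?thesis
    using assms(2) unfolding has_curve_deriv_def
    by (rule limitin_transform_eventually[rotated]) (use e 0 in \<open>auto elim: eventually_mono\<close>)
qed

lemma has_curve_deriv_const: "a \<in> carrier A \<Longrightarrow> has_curve_deriv A (\<lambda>h. a) \<zero>"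
  unfolding has_curve_deriv_def by (simp add: topspace_topo)

text \<open>\<open>c h\<close> is \<open>c 0\<close> plus \<open>h\<close> times the difference
  quotient. The product rule needs this continuity for one of its factors.\<close>

lemma has_curve_deriv_imp_limitin:
  assumes d: "has_curve_deriv A c d" and c: "\<forall>\<^sub>F h in nhds 0. c h \<in> carrier A"
  shows "limitin (topo A) c (c 0) (at 0)"
proof -
  have e: "\<forall>\<^sub>F h in at 0. c h \<in> carrier A \<and> h \<noteq> 0" and 0: "c 0 \<in> carrier A"
    using c by (auto simp: eventually_at_filter elim: eventually_mono dest: eventually_nhds_x_imp_x)
  have "limitin (topo A) (\<lambda>h. c 0 \<oplus> of_real h \<odot> (of_real (1 / h) \<odot> (c h \<ominus> c 0))) (c 0 \<oplus> of_real 0 \<odot> d) (at 0)"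
    using d 0 unfolding has_curve_deriv_def
    by (intro limitin_add limitin_smult tendsto_of_real tendsto_ident_at) (auto simp: topspace_topo)
  then have "limitin (topo A) (\<lambda>h. c 0 \<oplus> of_real h \<odot> (of_real (1 / h) \<odot> (c h \<ominus> c 0))) (c 0) (at 0)"
    using 0 has_curve_deriv_closed[OF d] by simp
  moreover have "\<forall>\<^sub>F h in at 0. c 0 \<oplus> of_real h \<odot> (of_real (1 / h) \<odot> (c h \<ominus> c 0)) = c h"
    using e
  proof eventually_elim
    case (elim h)
    then show ?case using 0 by (simp add: smult_smult add_diff_cancel flip: of_real_mult)
  qed
  ultimately show ?thesis by (rule limitin_transform_eventually[rotated])
qed

lemma has_curve_deriv_add:
  assumes c: "has_curve_deriv A c d" "\<forall>\<^sub>F h in nhds 0. c h \<in> carrier A"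
    and c': "has_curve_deriv A c' d'" "\<forall>\<^sub>F h in nhds 0. c' h \<in> carrier A"
  shows "has_curve_deriv A (\<lambda>h. c h \<oplus> c' h) (d \<oplus> d')"
proof -
  have e: "\<forall>\<^sub>F h in at 0. c h \<in> carrier A \<and> c' h \<in> carrier A" and 0: "c 0 \<in> carrier A" "c' 0 \<in> carrier A"
    using c(2) c'(2)
    by (auto simp: eventually_at_filter elim: eventually_elim2 dest: eventually_nhds_x_imp_x)
  show ?thesis
    unfolding has_curve_deriv_def
    by (rule limitin_transform_eventually[OF _ limitin_add[OF c(1)[unfolded has_curve_deriv_def] c'(1)[unfolded has_curve_deriv_def]]],
        rule eventually_mono[OF e]) (use 0 in \<open>auto simp: add_diff_add smult_add_right\<close>)
qed

text \<open>\<open>locally_convex\<close> speaks of neighbourhoods of zero only. Translation by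
  \<open>a\<close> moves them, and convexity survives because the weights \<open>1 - t\<close> and
  \<open>t\<close> add up to 1.\<close>

lemma convex_openin_at:
  assumes U: "openin (topo A) U" "a \<in> U"
  obtains V where "openin (topo A) V" "a \<in> V" "V \<subseteq> U" "convex_in A V"
proof -
  have a: "a \<in> carrier A" using U openin_subset topspace_topo by blast
  let ?U = "{x \<in> carrier A. a \<oplus> x \<in> U}"
  have "continuous_map (topo A) (topo A) (\<lambda>x. a \<oplus> x)"
    using a by (intro continuous_map_add continuous_map_const_A) auto
  then have "openin (topo A) ?U" using U openin_continuous_map_preimage topspace_topo by metis
  moreover have "\<zero> \<in> ?U" using a U by simp
  ultimately obtain V where V: "openin (topo A) V" "\<zero> \<in> V" "V \<subseteq> ?U" "convex_in A V"
    using locally_convex by meson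
  let ?V = "{x \<in> carrier A. x \<ominus> a \<in> V}"
  have "continuous_map (topo A) (topo A) (\<lambda>x. x \<ominus> a)"
    using a by (intro continuous_map_diff continuous_map_const_A) auto
  then have "openin (topo A) ?V" using V openin_continuous_map_preimage topspace_topo by metis
  moreover have "a \<in> ?V" using a V by simp
  moreover have "?V \<subseteq> U"
  proof
    fix x assume "x \<in> ?V"
    then have "x \<in> carrier A" "a \<oplus> (x \<ominus> a) \<in> U" using V by auto
    then show "x \<in> U" using a add_diff_cancel by metis
  qed
  moreover have "convex_in A ?V"
    unfolding convex_in_def
  proof (intro ballI allI impI)
    fix x y t assume x: "x \<in> ?V" and y: "y \<in> ?V" and t: "0 \<le> (t::real) \<and> t \<le> 1"
    have "of_real (1 - t) \<odot> (x \<ominus> a) \<oplus> of_real t \<odot> (y \<ominus> a) \<in> V"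
      using V(4) x y t unfolding convex_in_def by blast
    moreover have "of_real (1 - t) \<odot> a \<oplus> of_real t \<odot> a = a"
      using a by (simp add: smult_add_left[symmetric] flip: of_real_add)
    then have "of_real (1 - t) \<odot> (x \<ominus> a) \<oplus> of_real t \<odot> (y \<ominus> a)
       = (of_real (1 - t) \<odot> x \<oplus> of_real t \<odot> y) \<ominus> a"
      using x y a by (simp add: smult_diff_right add_diff_add[symmetric])
    ultimately show "of_real (1 - t) \<odot> x \<oplus> of_real t \<odot> y \<in> ?V" using x y by auto
  qed
  ultimately show ?thesis using that by blast
qed

text \<open>The slope over the whole interval is the mean of the slopes over the two pieces,
  weighted by their lengths; \<open>?l\<close> is the share of the left piece.\<close>

lemma convex_slope:
  assumes K: "convex_in A K" and st: "s < x" "x < (t::real)"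
    and c: "c s \<in> carrier A" "c x \<in> carrier A" "c t \<in> carrier A"
    and 1: "of_real (1 / (x - s)) \<odot> (c x \<ominus> c s) \<in> K" and 2: "of_real (1 / (t - x)) \<odot> (c t \<ominus> c x) \<in> K"
  shows "of_real (1 / (t - s)) \<odot> (c t \<ominus> c s) \<in> K"
proof -
  let ?l = "(x - s) / (t - s)"
  have "of_real (1 - ?l) \<odot> (of_real (1 / (t - x)) \<odot> (c t \<ominus> c x))
      \<oplus> of_real ?l \<odot> (of_real (1 / (x - s)) \<odot> (c x \<ominus> c s)) \<in> K"
    using K[unfolded convex_in_def, rule_format, OF 2 1, of ?l] st by simp
  moreover have "(1 - ?l) * (1 / (t - x)) = 1 / (t - s)" "?l * (1 / (x - s)) = 1 / (t - s)"
    using st by (auto simp: field_simps)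
  then have "of_real (1 - ?l) \<odot> (of_real (1 / (t - x)) \<odot> (c t \<ominus> c x)) = of_real (1 / (t - s)) \<odot> (c t \<ominus> c x)"
    "of_real ?l \<odot> (of_real (1 / (x - s)) \<odot> (c x \<ominus> c s)) = of_real (1 / (t - s)) \<odot> (c x \<ominus> c s)"
    using c by (metis smult_smult of_real_mult minus_closed)+
  ultimately have "of_real (1 / (t - s)) \<odot> (c t \<ominus> c x) \<oplus> of_real (1 / (t - s)) \<odot> (c x \<ominus> c s) \<in> K"
    by simp
  then show ?thesis using c by (simp add: smult_add_right[symmetric] diff_add_diff)
qed

text \<open>A mean value theorem without seminorms: convexity makes the condition on the slopes
  additive over adjacent intervals, so that Bolzano's bisection principle applies.\<close>

lemma mean_value_convex:
  assumes ab: "a < b" and K: "openin (topo A) K" "convex_in A K"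
    and c: "\<And>t. t \<in> {a..b} \<Longrightarrow> c t \<in> carrier A"
    and d: "\<And>t. t \<in> {a..b} \<Longrightarrow> \<exists>d\<in>K. has_curve_deriv A (\<lambda>h. c (t + h)) d"
  shows "of_real (1 / (b - a)) \<odot> (c b \<ominus> c a) \<in> K"
proof -
  \<comment> \<open>Degenerate intervals, and those reaching beyond \<open>{a..b}\<close>, satisfy
    \<open>P\<close> vacuously, as Bolzano's principle quantifies over all intervals around a
    point.\<close>
  define P where "P s t \<longleftrightarrow> (a \<le> s \<and> s < t \<and> t \<le> b \<longrightarrow> of_real (1 / (t - s)) \<odot> (c t \<ominus> c s) \<in> K)" for s t
  have tr: "P s u" if "P s t" "P t u" "s \<le> t" "t \<le> u" for s t u
  proof (cases "s = t \<or> t = u")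
    case False
    then show ?thesis using that convex_slope[OF K(2), of s t u c] c unfolding P_def by auto
  qed (use that in auto)
  have "P a b"
  proof (rule Bolzano)
    show "a \<le> b" using ab by simp
    fix x assume x: "a \<le> x" "x \<le> b"
    then obtain d where d: "d \<in> K" "has_curve_deriv A (\<lambda>h. c (x + h)) d" using assms(5)[of x] by auto
    have "\<forall>\<^sub>F h in at 0. of_real (1 / h) \<odot> (c (x + h) \<ominus> c (x + 0)) \<in> K"
      using d(2) limitinD[OF _ K(1) d(1)] unfolding has_curve_deriv_def by blast
    then obtain e where e: "e > 0" "\<And>h. h \<noteq> 0 \<Longrightarrow> \<bar>h\<bar> < e \<Longrightarrow> of_real (1 / h) \<odot> (c (x + h) \<ominus> c x) \<in> K"
      unfolding eventually_at by (auto simp: dist_real_def)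
    have r: "P x t" if "t - x < e" for t
      unfolding P_def using e(2)[of "t - x"] that by auto
    have l: "P s x" if "x - s < e" for s
      unfolding P_def
    proof (intro impI)
      assume s: "a \<le> s \<and> s < x \<and> x \<le> b"
      have "of_real (1 / (s - x)) \<odot> (c (x + (s - x)) \<ominus> c x) \<in> K" using e(2)[of "s - x"] that s by auto
      then show "of_real (1 / (x - s)) \<odot> (c x \<ominus> c s) \<in> K"
        using c s x slope_swap[of "c s" "c x" s x] by simp
    qed
    \<comment> \<open>A short interval around \<open>x\<close> is cut at \<open>x\<close>; both
      pieces have \<open>x\<close> as an end point, where the derivative controls the slope, and
      \<open>tr\<close> joins them.\<close>
    show "\<exists>d>0. \<forall>a b. a \<le> x \<and> x \<le> b \<and> b - a < d \<longrightarrow> P a b"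
      using e(1) tr r l by (intro exI[of _ e]) (smt (verit))
  qed (use tr in blast)
  then show ?thesis using ab unfolding P_def by simp
qed

end

section \<open>Coordinates and boxes in Euclidean space, and the derivative along a curve\<close>

lemma continuous_map_to_Euclidean_space:
  "continuous_map X (Euclidean_space n) f \<longleftrightarrow>
    (\<forall>x\<in>topspace X. f x \<in> topspace (Euclidean_space n)) \<and> (\<forall>i<n. continuous_map X euclideanreal (\<lambda>x. f x i))"
  (is "?l \<longleftrightarrow> ?r")
proof
  assume ?l
  then show ?r
    unfolding Euclidean_space_def continuous_map_in_subtopology
    by (auto simp: continuous_map_componentwise_UNIV)
next
  assume r: ?r
  then have "continuous_map X (Euclidean_space n) (\<lambda>x i. if i < n then f x i else 0)"
    by (simp add: continuous_map_componentwise_Euclidean_space)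
  then show ?l
    by (rule continuous_map_eq) (use r in \<open>auto simp: topspace_Euclidean_space\<close>)
qed

lemma continuous_map_Euclidean_coordinate:
  "continuous_map (Euclidean_space n) euclideanreal (\<lambda>x. x i)"
  unfolding Euclidean_space_def
  by (intro continuous_map_from_subtopology) (metis UNIV_I continuous_map_product_coordinates)

lemma Euclidean_upd_in [simp]:
  "x \<in> topspace (Euclidean_space n) \<Longrightarrow> i < n \<Longrightarrow> x(i := r) \<in> topspace (Euclidean_space n)"
  by (auto simp: topspace_Euclidean_space)

lemma eventually_upd_in_openin:
  assumes V: "openin (Euclidean_space n) V" "x \<in> V" "i < n"
  shows "\<forall>\<^sub>F h in nhds 0. x(i := x i + h) \<in> V"
proof -
  have x: "x \<in> topspace (Euclidean_space n)" using V openin_subset by blast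
  have "continuous_map euclideanreal (Euclidean_space n) (\<lambda>h. x(i := x i + h))"
    unfolding continuous_map_to_Euclidean_space
  proof (intro conjI ballI allI impI)
    fix j show "continuous_map euclideanreal euclideanreal (\<lambda>h. (x(i := x i + h)) j)"
      by (cases "j = i") (auto intro!: continuous_intros)
  qed (use x V in simp)
  then have "open {h. x(i := x i + h) \<in> V}"
    using V(1) openin_continuous_map_preimage by fastforce
  then show ?thesis unfolding eventually_nhds using V(2) by (intro exI[of _ "{h. x(i := x i + h) \<in> V}"]) simp
qed

text \<open>Points of \<open>Euclidean_space n\<close> agree in all coordinates from
  \<open>n\<close> on, so a basic open set of the infinite product effectively bounds only
  \<open>n\<close> of them, and the least of \<open>n\<close> radii will do.\<close>

lemma openin_Euclidean_box:
  assumes V: "openin (Euclidean_space n) V" "x \<in> V"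
  obtains e where "e > 0" "\<forall>y\<in>topspace (Euclidean_space n). (\<forall>i<n. \<bar>y i - x i\<bar> < e) \<longrightarrow> y \<in> V"
proof -
  obtain T where T: "openin (powertop_real UNIV) T" "V = T \<inter> {x. \<forall>i\<ge>n. x i = 0}"
    using V unfolding Euclidean_space_def openin_subtopology by blast
  then obtain U where U: "finite {i. U i \<noteq> UNIV}" "\<And>i. open (U i)" "x \<in> Pi\<^sub>E UNIV U" "Pi\<^sub>E UNIV U \<subseteq> T"
    using V(2) unfolding openin_product_topology_alt by fastforce
  have "\<exists>e>0. \<forall>r. \<bar>r - x i\<bar> < e \<longrightarrow> r \<in> U i" for i
    using U(2,3) unfolding open_dist dist_real_def by (meson PiE_mem UNIV_I)
  then obtain e where e: "\<And>i. e i > 0" "\<And>i r. \<bar>r - x i\<bar> < e i \<Longrightarrow> r \<in> U i" by metis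
  \<comment> \<open>The 1 keeps the minimum defined when \<open>n = 0\<close>.\<close>
  define m where "m = Min (insert 1 (e ` {..<n}))"
  have "m > 0" unfolding m_def using e by (subst Min_gr_iff) auto
  moreover have "y \<in> V" if y: "y \<in> topspace (Euclidean_space n)" "\<forall>i<n. \<bar>y i - x i\<bar> < m" for y
  proof -
    have "y i \<in> U i" for i
    proof (cases "i < n")
      case True
      have "m \<le> e i" unfolding m_def using True by (intro Min_le) auto
      then show ?thesis using e(2)[of "y i" i] y(2) True by auto
    next
      case False
      then have "y i = x i" using y(1) V(2) T(2) by (auto simp: topspace_Euclidean_space)
      then show ?thesis using e by simp
    qed
    then show ?thesis using U(4) T(2) y(1) by (auto simp: topspace_Euclidean_space)
  qed
  ultimately show ?thesis using that[of m] by simp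
qed

lemma openin_prod_topologyE:
  assumes "openin (prod_topology X Y) S" "(x, y) \<in> S"
  obtains U V where "openin X U" "openin Y V" "x \<in> U" "y \<in> V" "U \<times> V \<subseteq> S"
  using assms(1)[unfolded openin_prod_topology_alt, rule_format, OF assms(2)] that by auto

text \<open>Move from \<open>y 0\<close> to \<open>y h\<close> one coordinate at a time and apply
  the mean value theorem to each move; continuity of the partial derivatives brings the intermediate
  slopes back to the point \<open>y 0\<close>. The curve is needed only through the derivatives of
  its coordinates at 0.\<close>

lemma (in lc_algebra) has_curve_deriv_partials:
  assumes W: "openin (Euclidean_space m) W" and f: "\<And>y. y \<in> W \<Longrightarrow> f y \<in> carrier A"
    and D: "\<And>j y. j < m \<Longrightarrow> y \<in> W \<Longrightarrow> has_curve_deriv A (\<lambda>h. f (y(j := y j + h))) (D j y)"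
    and cont: "\<And>j. j < m \<Longrightarrow> continuous_map (subtopology (Euclidean_space m) W) (topo A) (D j)"
    and y: "\<forall>\<^sub>F h in nhds 0. y h \<in> W"
    and e: "\<And>j. j < m \<Longrightarrow> ((\<lambda>h. y h j) has_real_derivative e j) (at 0)"
  shows "has_curve_deriv A (\<lambda>h. f (y h)) (finsum A (\<lambda>j. of_real (e j) \<odot> D j (y 0)) {..<m})"
proof -
  have y0: "y 0 \<in> W" using y eventually_nhds_x_imp_x by metis
  have Wsub: "W \<subseteq> topspace (Euclidean_space m)" using W openin_subset by blast
  have Dc: "D j x \<in> carrier A" if "j < m" "x \<in> W" for j x using D[OF that] has_curve_deriv_closed by blast
  \<comment> \<open>\<open>Y j h\<close> has moved its first \<open>j\<close> coordinates: it runs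
    from \<open>y 0\<close> for \<open>j = 0\<close> to \<open>y h\<close> for
    \<open>j = m\<close>.\<close>
  define Y where "Y j h = (\<lambda>i. if i < j then y h i else y 0 i)" for j h
  have yj: "\<forall>\<^sub>F h in nhds 0. \<bar>y h j - y 0 j\<bar> < r" if "j < m" "r > 0" for j r
  proof -
    have "isCont (\<lambda>h. y h j) 0" using e[OF that(1)] DERIV_isCont by blast
    then have "\<forall>\<^sub>F h in at 0. dist (y h j) (y 0 j) < r"
      unfolding isCont_def using that(2) tendstoD by blast
    then show ?thesis using that(2)
      by (auto simp: eventually_at_filter dist_real_def elim!: eventually_mono)
  qed
  then have yall: "\<forall>\<^sub>F h in nhds 0. y h \<in> W \<and> (\<forall>j<m. \<bar>y h j - y 0 j\<bar> < r)" if "r > 0" for r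
  proof -
    have "\<forall>\<^sub>F h in nhds 0. \<forall>j\<in>{..<m}. \<bar>y h j - y 0 j\<bar> < r"
      using yj that by (intro eventually_ball_finite) auto
    then show ?thesis using y by eventually_elim auto
  qed
  obtain r0 where r0: "r0 > 0" "\<forall>x\<in>topspace (Euclidean_space m). (\<forall>i<m. \<bar>x i - y 0 i\<bar> < r0) \<longrightarrow> x \<in> W"
    by (rule openin_Euclidean_box[OF W y0])
  have Ytop: "Y j h \<in> topspace (Euclidean_space m)" if "y h \<in> W" for j h
    using subsetD[OF Wsub that] subsetD[OF Wsub y0] by (simp add: Y_def topspace_Euclidean_space)
  have Ybox: "\<bar>Y j h i - y 0 i\<bar> < r" if "\<forall>j<m. \<bar>y h j - y 0 j\<bar> < r" "r > 0" "i < m" for i j h r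
    using that by (simp add: Y_def)
  have YW: "\<forall>\<^sub>F h in nhds 0. \<forall>j. Y j h \<in> W"
    using yall[OF r0(1)]
  proof eventually_elim
    case (elim h)
    then show ?case using r0(2) Ytop Ybox[OF _ r0(1)] by blast
  qed
  have quot: "limitin (topo A) (\<lambda>h. of_real (1 / h) \<odot> (f (Y (Suc j) h) \<ominus> f (Y j h))) (of_real (e j) \<odot> D j (y 0)) (at 0)"
    if j: "j < m" for j
    unfolding limitin_def
  proof (intro conjI allI impI)
    show "of_real (e j) \<odot> D j (y 0) \<in> topspace (topo A)" using Dc j y0 topspace_topo by simp
    fix N assume N: "openin (topo A) N \<and> of_real (e j) \<odot> D j (y 0) \<in> N"
    \<comment> \<open>Each quotient will be written as
      \<open>of_real (\<delta> / h) \<odot> k\<close>, with \<open>\<delta>\<close> the increment of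
      coordinate \<open>j\<close> and \<open>k\<close> a slope of \<open>f\<close> in that
      direction. Continuity of scalar multiplication splits the target \<open>N\<close> into a
      condition \<open>T\<close> on the scalar and a convex one, \<open>K\<close>, on
      \<open>k\<close>.\<close>
    let ?Z = "{p \<in> topspace (prod_topology euclidean (topo A)). (case p of (c, a) \<Rightarrow> c \<odot> a) \<in> N}"
    have "openin (prod_topology euclidean (topo A)) ?Z"
      using N continuous_smult openin_continuous_map_preimage by blast
    moreover have "(of_real (e j), D j (y 0)) \<in> ?Z" using N Dc[OF j y0] topspace_topo by simp
    ultimately obtain T K0 where TK: "openin euclidean T" "openin (topo A) K0" "of_real (e j) \<in> T" "D j (y 0) \<in> K0" "T \<times> K0 \<subseteq> ?Z"
      by (rule openin_prod_topologyE)
    obtain K where K: "openin (topo A) K" "D j (y 0) \<in> K" "K \<subseteq> K0" "convex_in A K"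
      by (rule convex_openin_at[OF TK(2,4)])
    let ?W = "{x \<in> topspace (subtopology (Euclidean_space m) W). D j x \<in> K}"
    have "openin (subtopology (Euclidean_space m) W) ?W"
      using cont[OF j] K(1) openin_continuous_map_preimage by blast
    then have "openin (Euclidean_space m) ?W" using W openin_open_subtopology by blast
    moreover have "y 0 \<in> ?W" using y0 K Wsub by auto
    ultimately obtain r where r: "r > 0" "\<forall>x\<in>topspace (Euclidean_space m). (\<forall>i<m. \<bar>x i - y 0 i\<bar> < r) \<longrightarrow> x \<in> ?W"
      by (rule openin_Euclidean_box)
    have "((\<lambda>h. (y h j - y 0 j) / h) \<longlongrightarrow> e j) (at 0)"
      using e[OF j] unfolding has_field_derivative_iff by simp
    then have "((\<lambda>h. of_real ((y h j - y 0 j) / h) :: 'k) \<longlongrightarrow> of_real (e j)) (at 0)"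
      by (rule tendsto_of_real)
    then have ev1: "\<forall>\<^sub>F h in at 0. of_real ((y h j - y 0 j) / h) \<in> T"
      using TK(1)[folded open_openin] TK(3) by (rule topological_tendstoD)
    have ev2: "\<forall>\<^sub>F h in at 0. (y h \<in> W \<and> (\<forall>j<m. \<bar>y h j - y 0 j\<bar> < r))"
      using yall[OF r(1)] by (auto simp: eventually_at_filter elim: eventually_mono)
    have ev3: "\<forall>\<^sub>F h in at 0. h \<noteq> (0::real)" by (simp add: eventually_at_filter)
    show "\<forall>\<^sub>F h in at 0. of_real (1 / h) \<odot> (f (Y (Suc j) h) \<ominus> f (Y j h)) \<in> N"
      using ev1 ev2 ev3
    proof eventually_elim
      case (elim h)
      define x where "x = Y j h"
      define \<delta> where "\<delta> = y h j - y 0 j"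
      have xj: "x j = y 0 j" by (simp add: x_def Y_def)
      have Ys: "Y (Suc j) h = x(j := x j + \<delta>)" by (auto simp: x_def Y_def \<delta>_def fun_eq_iff less_Suc_eq)
      have xin: "x(j := x j + t) \<in> ?W" if t: "\<bar>t\<bar> \<le> \<bar>\<delta>\<bar>" for t
      proof (rule r(2)[rule_format])
        have *: "x \<in> topspace (Euclidean_space m)" "\<And>i. i < m \<Longrightarrow> \<bar>x i - y 0 i\<bar> < r"
          unfolding x_def using elim(2) Ytop Ybox[OF _ r(1)] by auto
        show "x(j := x j + t) \<in> topspace (Euclidean_space m)" using * j by simp
        fix i assume i: "i < m"
        have "\<bar>\<delta>\<bar> < r" unfolding \<delta>_def using elim(2) j by auto
        then show "\<bar>(x(j := x j + t)) i - y 0 i\<bar> < r" using * i t xj by auto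
      qed
      have inW: "x(j := x j + t) \<in> W" if "\<bar>t\<bar> \<le> \<bar>\<delta>\<bar>" for t using xin[OF that] by auto
      have fc: "f (x(j := x j + t)) \<in> carrier A" if "\<bar>t\<bar> \<le> \<bar>\<delta>\<bar>" for t using inW[OF that] f by blast
      have der: "\<exists>d\<in>K. has_curve_deriv A (\<lambda>h. f (x(j := x j + (t + h)))) d" if "\<bar>t\<bar> \<le> \<bar>\<delta>\<bar>" for t
        using D[OF j inW[OF that]] xin[OF that] by (intro bexI[of _ "D j (x(j := x j + t))"]) (auto simp: add.assoc)
      have fx: "f x \<in> carrier A" using fc[of 0] by simp
      \<comment> \<open>The increment may vanish for arbitrarily small \<open>h \<noteq> 0\<close>;
        then any element of \<open>K\<close>, such as \<open>D j (y 0)\<close>, serves as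
        \<open>k\<close>.\<close>
      have "\<exists>k\<in>K. f (x(j := x j + \<delta>)) \<ominus> f x = of_real \<delta> \<odot> k"
      proof (cases "\<delta> = 0")
        case True
        then show ?thesis using K(2) fx Dc[OF j y0] by (intro bexI[of _ "D j (y 0)"]) auto
      next
        case False
        let ?k = "of_real (1 / \<delta>) \<odot> (f (x(j := x j + \<delta>)) \<ominus> f x)"
        have fd: "f (x(j := x j + \<delta>)) \<in> carrier A" using fc[of \<delta>] by simp
        have "?k \<in> K"
        proof (cases "\<delta> > 0")
          case True
          then show ?thesis
            using mean_value_convex[OF True K(1,4), of "\<lambda>t. f (x(j := x j + t))"] fc der by simp
        next
          case F: False
          then have "\<delta> < 0" using False by simp
          then have *: "of_real (1 / (0 - \<delta>)) \<odot> (f (x(j := x j + 0)) \<ominus> f (x(j := x j + \<delta>))) \<in> K"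
            using mean_value_convex[OF _ K(1,4), of \<delta> 0 "\<lambda>t. f (x(j := x j + t))"] fc der by simp
          then show ?thesis using fd fx slope_swap[of "f x" "f (x(j := x j + \<delta>))" 0 \<delta>] by simp
        qed
        moreover have "f (x(j := x j + \<delta>)) \<ominus> f x = of_real \<delta> \<odot> ?k"
          using False fd fx by (simp add: smult_smult flip: of_real_mult)
        ultimately show ?thesis by blast
      qed
      then obtain k where k: "k \<in> K" "f (x(j := x j + \<delta>)) \<ominus> f x = of_real \<delta> \<odot> k" by blast
      have kc: "k \<in> carrier A" using k(1) K(1) openin_subset topspace_topo by blast
      have "of_real (1 / h) \<odot> (f (Y (Suc j) h) \<ominus> f (Y j h)) = of_real (\<delta> / h) \<odot> k"
        unfolding Ys x_def[symmetric] k(2) using kc by (simp add: smult_smult flip: of_real_mult)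
      moreover have "(of_real (\<delta> / h), k) \<in> T \<times> K0" using elim(1) k(1) K(3) by (auto simp: \<delta>_def)
      ultimately show ?case using TK(5) by auto
    qed
  qed
  have "limitin (topo A) (\<lambda>h. of_real (1 / h) \<odot> (f (Y k h) \<ominus> f (y 0))) (finsum A (\<lambda>j. of_real (e j) \<odot> D j (y 0)) {..<k}) (at 0)"
    if "k \<le> m" for k
    using that
  proof (induction k)
    case 0
    have "Y 0 h = y 0" for h by (simp add: Y_def)
    then show ?case using f[OF y0] by (simp add: topspace_topo)
  next
    case (Suc k)
    have "limitin (topo A) (\<lambda>h. of_real (1 / h) \<odot> (f (Y (Suc k) h) \<ominus> f (Y k h)) \<oplus> of_real (1 / h) \<odot> (f (Y k h) \<ominus> f (y 0)))
      (of_real (e k) \<odot> D k (y 0) \<oplus> finsum A (\<lambda>j. of_real (e j) \<odot> D j (y 0)) {..<k}) (at 0)"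
      using Suc by (intro limitin_add quot) auto
    moreover have "finsum A (\<lambda>j. of_real (e j) \<odot> D j (y 0)) {..<Suc k} =
      of_real (e k) \<odot> D k (y 0) \<oplus> finsum A (\<lambda>j. of_real (e j) \<odot> D j (y 0)) {..<k}"
      unfolding lessThan_Suc using Suc.prems Dc y0 by (subst finsum_insert) auto
    moreover have "\<forall>\<^sub>F h in at 0. of_real (1 / h) \<odot> (f (Y (Suc k) h) \<ominus> f (Y k h)) \<oplus> of_real (1 / h) \<odot> (f (Y k h) \<ominus> f (y 0))
       = of_real (1 / h) \<odot> (f (Y (Suc k) h) \<ominus> f (y 0))"
      using YW unfolding eventually_at_filter
      by eventually_elim (use f y0 in \<open>simp add: smult_add_right[symmetric] diff_add_diff\<close>)
    ultimately show ?case by (simp only:) (rule limitin_transform_eventually)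
  qed
  from this[of m] have "limitin (topo A) (\<lambda>h. of_real (1 / h) \<odot> (f (Y m h) \<ominus> f (y 0))) (finsum A (\<lambda>j. of_real (e j) \<odot> D j (y 0)) {..<m}) (at 0)"
    by simp
  moreover have "Y m h = y h" if "y h \<in> W" for h
    using subsetD[OF Wsub that] subsetD[OF Wsub y0] by (auto simp: Y_def fun_eq_iff topspace_Euclidean_space not_less)
  then have "\<forall>\<^sub>F h in at 0. of_real (1 / h) \<odot> (f (Y m h) \<ominus> f (y 0)) = of_real (1 / h) \<odot> (f (y h) \<ominus> f (y 0))"
    using y unfolding eventually_at_filter by (auto elim: eventually_mono)
  ultimately show ?thesis unfolding has_curve_deriv_def by (rule limitin_transform_eventually[rotated])
qed

section \<open>Smoothness with a parameter\<close>

lemma continuous_map_locally: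
  assumes "\<And>x. x \<in> topspace X \<Longrightarrow> \<exists>U. openin X U \<and> x \<in> U \<and> continuous_map (subtopology X U) Y f"
  shows "continuous_map X Y f"
proof -
  obtain U where U: "\<And>x. x \<in> topspace X \<Longrightarrow> openin X (U x) \<and> x \<in> U x \<and> continuous_map (subtopology X (U x)) Y f"
    using assms by metis
  show ?thesis
    by (rule pasting_lemma[of "topspace X" X U Y "\<lambda>_. f"]) (use U in auto)
qed

lemma continuous_map_in_topspace: "continuous_map X Y f \<Longrightarrow> x \<in> topspace X \<Longrightarrow> f x \<in> topspace Y"
  by (auto simp: continuous_map_def)

text \<open>The last entry of the list is differentiated first, so this peels off the innermost
  derivative.\<close>

lemma iter_partial_append: "iter_partial E f (js @ [i]) = iter_partial E (iter_partial E f [i]) js"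
  by (induction js) auto

text \<open>Smoothness with a topological parameter: the exponential law turns continuity of maps into
  and out of spaces of smooth functions into instances of this notion.\<close>

definition psmooth ::
  "'z topology \<Rightarrow> nat \<Rightarrow> (nat \<Rightarrow> real) set \<Rightarrow> ('k::real_normed_field, 'a) top_algebra \<Rightarrow>
     ('z \<Rightarrow> (nat \<Rightarrow> real) \<Rightarrow> 'a) \<Rightarrow> bool" where
  "psmooth Z n V E f \<longleftrightarrow>
     (\<forall>js\<in>lists {..<n}.
        continuous_map (prod_topology Z (subtopology (Euclidean_space n) V)) (topo E)
          (\<lambda>p. iter_partial E (f (fst p)) js (snd p)) \<and>
        (\<forall>z\<in>topspace Z. \<forall>x\<in>V. \<forall>i<n.
           \<exists>d. has_curve_deriv E (\<lambda>h. iter_partial E (f z) js (x(i := x i + h))) d))"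

lemma psmooth_imp_smooth_on:
  assumes "psmooth Z n V E f" "z \<in> topspace Z"
  shows "smooth_on n V E (f z)"
  unfolding smooth_on_def
proof (intro ballI conjI)
  fix js assume js: "js \<in> lists {..<n}"
  have "continuous_map (subtopology (Euclidean_space n) V) (prod_topology Z (subtopology (Euclidean_space n) V)) (\<lambda>x. (z, x))"
    using assms(2) by (intro continuous_map_pairedI) auto
  then have "continuous_map (subtopology (Euclidean_space n) V) (topo E)
      ((\<lambda>p. iter_partial E (f (fst p)) js (snd p)) \<circ> (\<lambda>x. (z, x)))"
    using assms(1) js unfolding psmooth_def by (blast intro: continuous_map_compose)
  then show "continuous_map (subtopology (Euclidean_space n) V) (topo E) (iter_partial E (f z) js)"
    by (simp add: o_def)
qed (use assms in \<open>auto simp: psmooth_def\<close>)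

lemma smooth_on_imp_psmooth:
  assumes "smooth_on n V E f"
  shows "psmooth Z n V E (\<lambda>_. f)"
  unfolding psmooth_def
proof (intro ballI conjI)
  fix js assume js: "js \<in> lists {..<n}"
  have "continuous_map (prod_topology Z (subtopology (Euclidean_space n) V)) (topo E) (iter_partial E f js \<circ> snd)"
    using assms js unfolding smooth_on_def by (blast intro: continuous_map_compose continuous_map_snd)
  then show "continuous_map (prod_topology Z (subtopology (Euclidean_space n) V)) (topo E) (\<lambda>p. iter_partial E f js (snd p))"
    by (simp add: o_def)
qed (use assms in \<open>auto simp: smooth_on_def\<close>)

lemma psmooth_reparam:
  assumes "psmooth Z n V E f" "continuous_map Z' Z r"
  shows "psmooth Z' n V E (\<lambda>z. f (r z))"
  unfolding psmooth_def
proof (intro ballI conjI)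
  fix js assume js: "js \<in> lists {..<n}"
  let ?S = "subtopology (Euclidean_space n) V"
  have "continuous_map (prod_topology Z' ?S) (prod_topology Z ?S) (\<lambda>p. (r (fst p), snd p))"
    using continuous_map_compose[OF continuous_map_fst assms(2)]
    by (intro continuous_map_pairedI continuous_map_snd) (simp add: o_def)
  then have "continuous_map (prod_topology Z' ?S) (topo E)
      ((\<lambda>p. iter_partial E (f (fst p)) js (snd p)) \<circ> (\<lambda>p. (r (fst p), snd p)))"
    using assms(1) js unfolding psmooth_def by (blast intro: continuous_map_compose)
  then show "continuous_map (prod_topology Z' ?S) (topo E) (\<lambda>p. iter_partial E (f (r (fst p))) js (snd p))"
    by (simp add: o_def)
next
  fix js z x assume "js \<in> lists {..<n}" "z \<in> topspace Z'" "x \<in> V"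
  moreover have "r z \<in> topspace Z" using assms(2) \<open>z \<in> topspace Z'\<close> by (auto simp: continuous_map_def)
  ultimately show "\<forall>i<n. \<exists>d. has_curve_deriv E (\<lambda>h. iter_partial E (f (r z)) js (x(i := x i + h))) d"
    using assms(1) unfolding psmooth_def by blast
qed

lemma psmooth_continuous:
  assumes "psmooth Z n V E f"
  shows "continuous_map (prod_topology Z (subtopology (Euclidean_space n) V)) (topo E) (\<lambda>p. f (fst p) (snd p))"
  using assms[unfolded psmooth_def, rule_format, OF lists.Nil] by simp

lemma psmooth_partial:
  assumes "psmooth Z n V E f" "i < n"
  shows "psmooth Z n V E (\<lambda>z. iter_partial E (f z) [i])"
  unfolding psmooth_def
proof
  fix js assume js: "js \<in> lists {..<n}"
  then have "js @ [i] \<in> lists {..<n}" using assms(2) by simp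
  from assms(1)[unfolded psmooth_def, rule_format, OF this]
  show "continuous_map (prod_topology Z (subtopology (Euclidean_space n) V)) (topo E)
          (\<lambda>p. iter_partial E (iter_partial E (f (fst p)) [i]) js (snd p)) \<and>
        (\<forall>z\<in>topspace Z. \<forall>x\<in>V. \<forall>i'<n. \<exists>d. has_curve_deriv E (\<lambda>h. iter_partial E (iter_partial E (f z) [i]) js (x(i' := x i' + h))) d)"
    unfolding iter_partial_append by blast
qed

section \<open>Closure properties of smoothness with a parameter\<close>

context
  fixes E :: "('k::real_normed_field, 'a) top_algebra" (structure)
  assumes E: "lc_algebra E"
begin

interpretation lc_algebra E by (rule E)

lemma psmooth_deriv:
  assumes "psmooth Z n V E f" "i < n" "z \<in> topspace Z" "x \<in> V"
  shows "has_curve_deriv E (\<lambda>h. f z (x(i := x i + h))) (iter_partial E (f z) [i] x)"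
proof -
  obtain d where d: "has_curve_deriv E (\<lambda>h. iter_partial E (f z) [] (x(i := x i + h))) d"
    using assms unfolding psmooth_def by (meson lists.Nil)
  then show ?thesis using curve_deriv_eq by simp
qed

lemma psmooth_closed:
  assumes "psmooth Z n V E f" "openin (Euclidean_space n) V" "z \<in> topspace Z" "x \<in> V"
  shows "f z x \<in> carrier E"
proof -
  have "(z, x) \<in> topspace (prod_topology Z (subtopology (Euclidean_space n) V))"
    using assms openin_subset by fastforce
  then show ?thesis
    using continuous_map_in_topspace[OF psmooth_continuous[OF assms(1)]] topspace_topo by fastforce
qed

lemma eventually_psmooth_closed:
  assumes "psmooth Z n V E f" "openin (Euclidean_space n) V" "z \<in> topspace Z" "x \<in> V" "i < n"
  shows "\<forall>\<^sub>F h in nhds 0. f z (x(i := x i + h)) \<in> carrier E"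
  using eventually_upd_in_openin[OF assms(2,4,5)]
  by eventually_elim (rule psmooth_closed[OF assms(1-3)])

text \<open>Spares the computation of iterated derivatives: to treat an operation it suffices to
  exhibit a class of jointly continuous functions, here \<open>\<F>\<close>, that is closed under
  first partial derivatives.\<close>

lemma psmooth_coinduct:
  assumes V: "openin (Euclidean_space n) V" and "\<F> f"
    and cont: "\<And>f. \<F> f \<Longrightarrow> continuous_map (prod_topology Z (subtopology (Euclidean_space n) V)) (topo E) (\<lambda>p. f (fst p) (snd p))"
    and deriv: "\<And>f i. \<F> f \<Longrightarrow> i < n \<Longrightarrow>
      \<exists>g. \<F> g \<and> (\<forall>z\<in>topspace Z. \<forall>x\<in>V. has_curve_deriv E (\<lambda>h. f z (x(i := x i + h))) (g z x))"
  shows "psmooth Z n V E f"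
proof -
  \<comment> \<open>Agreement is claimed on \<open>V\<close> only, since elsewhere
    \<open>curve_deriv\<close> may be an arbitrary value; openness of \<open>V\<close> makes the
    derivatives at its points agree again.\<close>
  have ex: "\<exists>g. \<F> g \<and> (\<forall>z\<in>topspace Z. \<forall>x\<in>V. iter_partial E (f z) js x = g z x)" if "js \<in> lists {..<n}" for js
    using that
  proof (induction js)
    case Nil
    then show ?case using assms(2) by (intro exI[of _ f]) simp
  next
    case (Cons i js)
    then obtain g where g: "\<F> g" "\<forall>z\<in>topspace Z. \<forall>x\<in>V. iter_partial E (f z) js x = g z x" by auto
    have i: "i < n" using Cons by simp
    obtain g' where g': "\<F> g'" "\<forall>z\<in>topspace Z. \<forall>x\<in>V. has_curve_deriv E (\<lambda>h. g z (x(i := x i + h))) (g' z x)"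
      using deriv[OF g(1) i] by blast
    have "iter_partial E (f z) (i # js) x = g' z x" if z: "z \<in> topspace Z" and x: "x \<in> V" for z x
    proof -
      have "\<forall>\<^sub>F h in nhds 0. g z (x(i := x i + h)) = iter_partial E (f z) js (x(i := x i + h))"
        using eventually_upd_in_openin[OF V x i] by eventually_elim (use g(2) z in auto)
      then have "has_curve_deriv E (\<lambda>h. iter_partial E (f z) js (x(i := x i + h))) (g' z x)"
        by (rule has_curve_deriv_cong) (use g' z x in blast)
      then show ?thesis using curve_deriv_eq by simp
    qed
    then show ?case using g'(1) by blast
  qed
  show ?thesis
    unfolding psmooth_def
  proof (intro ballI conjI allI impI)
    fix js assume js: "js \<in> lists {..<n}"
    obtain g where g: "\<F> g" "\<forall>z\<in>topspace Z. \<forall>x\<in>V. iter_partial E (f z) js x = g z x"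
      using ex[OF js] by blast
    show "continuous_map (prod_topology Z (subtopology (Euclidean_space n) V)) (topo E)
          (\<lambda>p. iter_partial E (f (fst p)) js (snd p))"
      by (rule continuous_map_eq[OF cont[OF g(1)]]) (use g(2) in auto)
    fix z x i assume zx: "z \<in> topspace Z" "x \<in> V" and i: "i < n"
    obtain g' where g': "\<forall>z\<in>topspace Z. \<forall>x\<in>V. has_curve_deriv E (\<lambda>h. g z (x(i := x i + h))) (g' z x)"
      using deriv[OF g(1) i] by blast
    have "\<forall>\<^sub>F h in nhds 0. g z (x(i := x i + h)) = iter_partial E (f z) js (x(i := x i + h))"
      using eventually_upd_in_openin[OF V zx(2) i] by eventually_elim (use g(2) zx in auto)
    then have "has_curve_deriv E (\<lambda>h. iter_partial E (f z) js (x(i := x i + h))) (g' z x)"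
      by (rule has_curve_deriv_cong) (use g' zx in blast)
    then show "\<exists>d. has_curve_deriv E (\<lambda>h. iter_partial E (f z) js (x(i := x i + h))) d" by blast
  qed
qed

text \<open>Derivatives at points of the open set \<open>V\<close> see nothing of the values
  outside.\<close>

lemma psmooth_cong:
  assumes V: "openin (Euclidean_space n) V" and f: "psmooth Z n V E f"
    and eq: "\<And>z x. z \<in> topspace Z \<Longrightarrow> x \<in> V \<Longrightarrow> f z x = g z x"
  shows "psmooth Z n V E g"
proof (rule psmooth_coinduct[OF V, where \<F> = "\<lambda>g. \<exists>f. psmooth Z n V E f \<and> (\<forall>z\<in>topspace Z. \<forall>x\<in>V. f z x = g z x)"])
  show "\<exists>f. psmooth Z n V E f \<and> (\<forall>z\<in>topspace Z. \<forall>x\<in>V. f z x = g z x)" using f eq by blast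
next
  fix g assume "\<exists>f. psmooth Z n V E f \<and> (\<forall>z\<in>topspace Z. \<forall>x\<in>V. f z x = g z x)"
  then obtain f where f: "psmooth Z n V E f" "\<forall>z\<in>topspace Z. \<forall>x\<in>V. f z x = g z x" by blast
  show "continuous_map (prod_topology Z (subtopology (Euclidean_space n) V)) (topo E) (\<lambda>p. g (fst p) (snd p))"
    by (rule continuous_map_eq[OF psmooth_continuous[OF f(1)]]) (use f(2) in auto)
  fix i assume i: "i < n"
  show "\<exists>k. (\<exists>f. psmooth Z n V E f \<and> (\<forall>z\<in>topspace Z. \<forall>x\<in>V. f z x = k z x)) \<and>
      (\<forall>z\<in>topspace Z. \<forall>x\<in>V. has_curve_deriv E (\<lambda>h. g z (x(i := x i + h))) (k z x))"
  proof (intro exI[of _ "\<lambda>z. iter_partial E (f z) [i]"] conjI ballI)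
    fix z x assume zx: "z \<in> topspace Z" "x \<in> V"
    have "\<forall>\<^sub>F h in nhds 0. f z (x(i := x i + h)) = g z (x(i := x i + h))"
      using eventually_upd_in_openin[OF V zx(2) i] by eventually_elim (use f(2) zx in auto)
    then show "has_curve_deriv E (\<lambda>h. g z (x(i := x i + h))) (iter_partial E (f z) [i] x)"
      by (rule has_curve_deriv_cong) (rule psmooth_deriv[OF f(1) i zx])
  next
    show "psmooth Z n V E (\<lambda>z. iter_partial E (f z) [i])" using psmooth_partial[OF f(1) i] .
  qed auto
qed

lemma psmooth_subset:
  assumes f: "psmooth Z n V E f" and "V' \<subseteq> V"
  shows "psmooth Z n V' E f"
  unfolding psmooth_def
proof (intro ballI conjI)
  fix js assume "js \<in> lists {..<n}"
  then have "continuous_map (prod_topology Z (subtopology (Euclidean_space n) V)) (topo E) (\<lambda>p. iter_partial E (f (fst p)) js (snd p))"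
    using f unfolding psmooth_def by blast
  then have "continuous_map (subtopology (prod_topology Z (subtopology (Euclidean_space n) V)) (topspace Z \<times> V')) (topo E) (\<lambda>p. iter_partial E (f (fst p)) js (snd p))"
    by (rule continuous_map_from_subtopology)
  moreover have "subtopology (prod_topology Z (subtopology (Euclidean_space n) V)) (topspace Z \<times> V') = prod_topology Z (subtopology (Euclidean_space n) V')"
    using assms(2) by (simp add: subtopology_Times subtopology_subtopology Int_absorb1)
  ultimately show "continuous_map (prod_topology Z (subtopology (Euclidean_space n) V')) (topo E) (\<lambda>p. iter_partial E (f (fst p)) js (snd p))"
    by simp
next
  fix js z x assume "js \<in> lists {..<n}" "z \<in> topspace Z" "x \<in> V'"
  then show "\<forall>i<n. \<exists>d. has_curve_deriv E (\<lambda>h. iter_partial E (f z) js (x(i := x i + h))) d"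
    using f assms(2) unfolding psmooth_def by blast
qed

text \<open>Only continuity has to be glued: \<open>iter_partial\<close> does not mention the
  domain, so the existence of derivatives is read off at each point.\<close>

lemma psmooth_local:
  assumes "\<And>x. x \<in> V \<Longrightarrow> \<exists>U. openin (Euclidean_space n) U \<and> x \<in> U \<and> U \<subseteq> V \<and> psmooth Z n U E f"
  shows "psmooth Z n V E f"
  unfolding psmooth_def
proof (intro ballI conjI)
  fix js assume js: "js \<in> lists {..<n}"
  show "continuous_map (prod_topology Z (subtopology (Euclidean_space n) V)) (topo E) (\<lambda>p. iter_partial E (f (fst p)) js (snd p))"
  proof (rule continuous_map_locally)
    fix p assume p: "p \<in> topspace (prod_topology Z (subtopology (Euclidean_space n) V))"
    then have "snd p \<in> V" by auto
    then obtain U where U: "openin (Euclidean_space n) U" "snd p \<in> U" "U \<subseteq> V" "psmooth Z n U E f"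
      using assms by blast
    have "openin (subtopology (Euclidean_space n) V) U" using U(1,3) by (simp add: openin_subset_topspace_eq openin_subtopology_Int2 subset_openin_subtopology)
    then have "openin (prod_topology Z (subtopology (Euclidean_space n) V)) (topspace Z \<times> U)"
      by (simp add: openin_prod_Times_iff)
    moreover have "p \<in> topspace Z \<times> U" using p U(2) by (auto simp: mem_Times_iff)
    moreover have "subtopology (prod_topology Z (subtopology (Euclidean_space n) V)) (topspace Z \<times> U) = prod_topology Z (subtopology (Euclidean_space n) U)"
      using U(3) by (simp add: subtopology_Times subtopology_subtopology Int_absorb1)
    moreover have "continuous_map (prod_topology Z (subtopology (Euclidean_space n) U)) (topo E) (\<lambda>p. iter_partial E (f (fst p)) js (snd p))"
      using U(4) js unfolding psmooth_def by blast
    ultimately show "\<exists>U. openin (prod_topology Z (subtopology (Euclidean_space n) V)) U \<and> p \<in> U \<and>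
         continuous_map (subtopology (prod_topology Z (subtopology (Euclidean_space n) V)) U) (topo E) (\<lambda>p. iter_partial E (f (fst p)) js (snd p))"
      by (intro exI[of _ "topspace Z \<times> U"]) simp
  qed
next
  fix js z x assume js: "js \<in> lists {..<n}" and z: "z \<in> topspace Z" and x: "x \<in> V"
  obtain U where U: "x \<in> U" "psmooth Z n U E f" using assms[OF x] by blast
  then show "\<forall>i<n. \<exists>d. has_curve_deriv E (\<lambda>h. iter_partial E (f z) js (x(i := x i + h))) d"
    using js z unfolding psmooth_def by blast
qed

text \<open>The Leibniz and chain rules turn one term into a sum of terms of the same shape, so a
  class closed under differentiation consists of finite sums of such terms.\<close>

inductive sum_closure :: "('z \<Rightarrow> (nat \<Rightarrow> real) \<Rightarrow> 'a) set \<Rightarrow> ('z \<Rightarrow> (nat \<Rightarrow> real) \<Rightarrow> 'a) \<Rightarrow> bool" for S where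
  base: "f \<in> S \<Longrightarrow> sum_closure S f"
| add: "sum_closure S f \<Longrightarrow> sum_closure S g \<Longrightarrow> sum_closure S (\<lambda>z x. f z x \<oplus> g z x)"

lemma psmooth_coinduct_sums:
  assumes V: "openin (Euclidean_space n) V" and f: "f \<in> S"
    and cont: "\<And>f. f \<in> S \<Longrightarrow> continuous_map (prod_topology Z (subtopology (Euclidean_space n) V)) (topo E) (\<lambda>p. f (fst p) (snd p))"
    and deriv: "\<And>f i. f \<in> S \<Longrightarrow> i < n \<Longrightarrow>
      \<exists>g. sum_closure S g \<and> (\<forall>z\<in>topspace Z. \<forall>x\<in>V. has_curve_deriv E (\<lambda>h. f z (x(i := x i + h))) (g z x))"
  shows "psmooth Z n V E f"
proof (rule psmooth_coinduct[OF V, where \<F> = "sum_closure S"])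
  show "sum_closure S f" using f by (rule sum_closure.base)
  show c: "continuous_map (prod_topology Z (subtopology (Euclidean_space n) V)) (topo E) (\<lambda>p. f (fst p) (snd p))"
    if "sum_closure S f" for f
    using that by induction (auto intro: cont continuous_map_add)
  have Vs: "V \<subseteq> topspace (Euclidean_space n)" using V openin_subset by blast
  have cl: "f z x \<in> carrier E" if "sum_closure S f" "z \<in> topspace Z" "x \<in> V" for f z x
    using continuous_map_in_topspace[OF c[OF that(1)], of "(z, x)"] that(2,3) Vs topspace_topo by auto
  show "\<exists>g. sum_closure S g \<and> (\<forall>z\<in>topspace Z. \<forall>x\<in>V. has_curve_deriv E (\<lambda>h. f z (x(i := x i + h))) (g z x))"
    if "sum_closure S f" and i: "i < n" for f i
    using that(1)
  proof induction
    case (base f) then show ?case using deriv i by blast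
  next
    case (add f1 f2)
    then obtain g1 g2 where g: "sum_closure S g1" "sum_closure S g2"
      and d: "\<And>z x. z \<in> topspace Z \<Longrightarrow> x \<in> V \<Longrightarrow> has_curve_deriv E (\<lambda>h. f1 z (x(i := x i + h))) (g1 z x)"
        "\<And>z x. z \<in> topspace Z \<Longrightarrow> x \<in> V \<Longrightarrow> has_curve_deriv E (\<lambda>h. f2 z (x(i := x i + h))) (g2 z x)" by blast
    have ev: "\<forall>\<^sub>F h in nhds 0. f z (x(i := x i + h)) \<in> carrier E" if "sum_closure S f" "z \<in> topspace Z" "x \<in> V" for f z x
      using eventually_upd_in_openin[OF V that(3) i] by eventually_elim (rule cl[OF that(1,2)])
    show ?case
      using g add.hyps by (intro exI[of _ "\<lambda>z x. g1 z x \<oplus> g2 z x"] conjI sum_closure.add ballI has_curve_deriv_add d ev)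
  qed
qed

lemma psmooth_add:
  assumes V: "openin (Euclidean_space n) V" and "psmooth Z n V E f" "psmooth Z n V E g"
  shows "psmooth Z n V E (\<lambda>z x. f z x \<oplus> g z x)"
proof (rule psmooth_coinduct[OF V, where \<F> = "\<lambda>h. \<exists>f g. psmooth Z n V E f \<and> psmooth Z n V E g \<and> h = (\<lambda>z x. f z x \<oplus> g z x)"])
  show "\<exists>f' g'. psmooth Z n V E f' \<and> psmooth Z n V E g' \<and> (\<lambda>z x. f z x \<oplus> g z x) = (\<lambda>z x. f' z x \<oplus> g' z x)"
    using assms by blast
next
  fix k assume "\<exists>f g. psmooth Z n V E f \<and> psmooth Z n V E g \<and> k = (\<lambda>z x. f z x \<oplus> g z x)"
  then obtain f g where fg: "psmooth Z n V E f" "psmooth Z n V E g" and k: "k = (\<lambda>z x. f z x \<oplus> g z x)" by blast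
  show "continuous_map (prod_topology Z (subtopology (Euclidean_space n) V)) (topo E) (\<lambda>p. k (fst p) (snd p))"
    unfolding k using fg by (intro continuous_map_add psmooth_continuous)
  fix i assume i: "i < n"
  let ?g = "\<lambda>z x. iter_partial E (f z) [i] x \<oplus> iter_partial E (g z) [i] x"
  have "has_curve_deriv E (\<lambda>h. k z (x(i := x i + h))) (?g z x)" if "z \<in> topspace Z" "x \<in> V" for z x
    unfolding k using fg i that V by (intro has_curve_deriv_add psmooth_deriv eventually_psmooth_closed)
  moreover have "psmooth Z n V E (\<lambda>z. iter_partial E (f z) [i])" "psmooth Z n V E (\<lambda>z. iter_partial E (g z) [i])"
    using fg i psmooth_partial by blast+
  ultimately show "\<exists>g. (\<exists>f h. psmooth Z n V E f \<and> psmooth Z n V E h \<and> g = (\<lambda>z x. f z x \<oplus> h z x)) \<and>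
      (\<forall>z\<in>topspace Z. \<forall>x\<in>V. has_curve_deriv E (\<lambda>h. k z (x(i := x i + h))) (g z x))"
    by (intro exI[of _ ?g]) blast
qed

lemma psmooth_param:
  assumes V: "openin (Euclidean_space n) V" and e: "continuous_map Z (topo E) e"
  shows "psmooth Z n V E (\<lambda>z x. e z)"
proof (rule psmooth_coinduct[OF V, where \<F> = "\<lambda>f. \<exists>e. continuous_map Z (topo E) e \<and> f = (\<lambda>z x. e z)"])
  fix f assume "\<exists>e. continuous_map Z (topo E) e \<and> f = (\<lambda>z (x :: nat \<Rightarrow> real). e z)"
  then obtain e where e: "continuous_map Z (topo E) e" "f = (\<lambda>z x. e z)" by blast
  show "continuous_map (prod_topology Z (subtopology (Euclidean_space n) V)) (topo E) (\<lambda>p. f (fst p) (snd p))"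
    using continuous_map_compose[OF continuous_map_fst e(1)] e(2) by (simp add: o_def)
  have "e z \<in> carrier E" if "z \<in> topspace Z" for z
    using e(1) that topspace_topo by (auto simp: continuous_map_def)
  then have "has_curve_deriv E (\<lambda>h. f z (x(i := x i + h))) \<zero>" if "z \<in> topspace Z" for z x i
    using that e(2) has_curve_deriv_const by simp
  then show "\<exists>g. (\<exists>e. continuous_map Z (topo E) e \<and> g = (\<lambda>z x. e z)) \<and>
      (\<forall>z\<in>topspace Z. \<forall>x\<in>V. has_curve_deriv E (\<lambda>h. f z (x(i := x i + h))) (g z x))" for i
    by (intro exI[of _ "\<lambda>z x. \<zero>"] conjI exI[of _ "\<lambda>z. \<zero>"]) (auto simp: topspace_topo)
qed (use e in blast)

lemma psmooth_const:
  assumes "openin (Euclidean_space n) V" "a \<in> carrier E"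
  shows "psmooth Z n V E (\<lambda>z x. a)"
  using assms by (intro psmooth_param continuous_map_const_A)

end

section \<open>The scalars as a locally convex algebra\<close>

lemma scalar_algebra_simps [simp]:
  "carrier scalar_algebra = UNIV" "monoid.mult scalar_algebra = (*)" "one scalar_algebra = 1"
  "ring.zero scalar_algebra = 0" "add scalar_algebra = (+)" "smult scalar_algebra = (*)"
  "topo scalar_algebra = euclidean"
  by (simp_all add: scalar_algebra_def)

lemma cring_scalar_algebra: "cring (scalar_algebra :: ('k::real_normed_field, 'k) top_algebra)"
proof (rule cringI)
  show "abelian_group (scalar_algebra :: ('k, 'k) top_algebra)"
    by (rule abelian_groupI) (auto intro: exI[of _ "- _"] simp: add.commute left_minus)
  show "comm_monoid (scalar_algebra :: ('k, 'k) top_algebra)"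
    by (rule comm_monoidI) auto
qed (simp add: distrib_right)

lemma scalar_algebra_minus [simp]:
  "x \<ominus>\<^bsub>(scalar_algebra :: ('k::real_normed_field, 'k) top_algebra)\<^esub> y = x - y"
proof -
  interpret cring "scalar_algebra :: ('k, 'k) top_algebra" by (rule cring_scalar_algebra)
  have "\<ominus>\<^bsub>(scalar_algebra :: ('k, 'k) top_algebra)\<^esub> y = - y" by (rule minus_equality) auto
  then show ?thesis by (simp add: a_minus_def)
qed

lemma lc_algebra_scalar_algebra: "lc_algebra (scalar_algebra :: ('k::real_normed_field, 'k) top_algebra)"
proof (rule lc_algebra.intro)
  let ?K = "scalar_algebra :: ('k, 'k) top_algebra"
  interpret cring ?K by (rule cring_scalar_algebra)
  show "ring ?K" by (rule ring_axioms)
  show "module ?K ?K"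
    by (rule moduleI) (auto simp: cring_scalar_algebra is_abelian_group distrib_left distrib_right)
  show "continuous_map (prod_topology (topo ?K) (topo ?K)) (topo ?K) (\<lambda>(a, b). a \<oplus>\<^bsub>?K\<^esub> b)"
    by (simp add: case_prod_unfold) (intro continuous_intros)
  show "continuous_map (prod_topology euclidean (topo ?K)) (topo ?K) (\<lambda>(a, b). a \<odot>\<^bsub>?K\<^esub> b)"
    by (simp add: case_prod_unfold) (intro continuous_intros)
  show "continuous_map (prod_topology (topo ?K) (topo ?K)) (topo ?K) (\<lambda>(a, b). a \<otimes>\<^bsub>?K\<^esub> b)"
    by (simp add: case_prod_unfold) (intro continuous_intros)
  fix U assume "openin (topo ?K) U" "\<zero>\<^bsub>?K\<^esub> \<in> U"
  then obtain e where e: "e > 0" "ball (0::'k) e \<subseteq> U"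
    by (auto simp: open_contains_ball)
  have "convex_in ?K (ball 0 e)"
    unfolding convex_in_def
  proof (intro ballI allI impI)
    fix x y :: 'k and t :: real assume *: "x \<in> ball 0 e" "y \<in> ball 0 e" "0 \<le> t \<and> t \<le> 1"
    have "norm (of_real (1 - t) * x + of_real t * y) \<le> (1 - t) * norm x + t * norm y"
      using * norm_triangle_ineq[of "of_real (1 - t) * x" "of_real t * y"]
      by (simp add: norm_mult del: of_real_diff)
    also have "\<dots> < e" using * by (intro convex_bound_lt) auto
    finally show "(of_real (1 - t) \<odot>\<^bsub>?K\<^esub> x) \<oplus>\<^bsub>?K\<^esub> (of_real t \<odot>\<^bsub>?K\<^esub> y) \<in> ball 0 e" by simp
  qed
  then show "\<exists>V. openin (topo ?K) V \<and> \<zero>\<^bsub>?K\<^esub> \<in> V \<and> V \<subseteq> U \<and> convex_in ?K V"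
    using e by (intro exI[of _ "ball 0 e"]) auto
qed (auto simp: mult_ac)

abbreviation real_algebra :: "(real, real) top_algebra" where "real_algebra \<equiv> scalar_algebra"

interpretation real_alg: lc_algebra real_algebra by (rule lc_algebra_scalar_algebra)

lemma has_curve_deriv_real: "has_curve_deriv real_algebra c d \<longleftrightarrow> (c has_real_derivative d) (at 0)"
  unfolding has_curve_deriv_def has_field_derivative_iff by simp

section \<open>Continuous linear and bilinear maps, and the Leibniz rule\<close>

definition cont_linear ::
  "('k::real_normed_field, 'a) top_algebra \<Rightarrow> ('l::real_normed_field, 'b) top_algebra \<Rightarrow> ('a \<Rightarrow> 'b) \<Rightarrow> bool" where
  "cont_linear E F L \<longleftrightarrow> continuous_map (topo E) (topo F) L \<and>
     (\<forall>x\<in>carrier E. \<forall>y\<in>carrier E. L (x \<oplus>\<^bsub>E\<^esub> y) = L x \<oplus>\<^bsub>F\<^esub> L y) \<and>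
     (\<forall>r. \<forall>x\<in>carrier E. L (of_real r \<odot>\<^bsub>E\<^esub> x) = of_real r \<odot>\<^bsub>F\<^esub> L x)"

text \<open>As in \<open>cont_linear\<close>, homogeneity refers to real scalars, so that the
  algebras may have different scalar fields: this is how real coefficient functions act on complex
  algebras.\<close>

definition cont_bilinear ::
  "('k::real_normed_field, 'a) top_algebra \<Rightarrow> ('l::real_normed_field, 'b) top_algebra \<Rightarrow>
   ('m::real_normed_field, 'c) top_algebra \<Rightarrow> ('a \<Rightarrow> 'b \<Rightarrow> 'c) \<Rightarrow> bool" where
  "cont_bilinear E F G B \<longleftrightarrow>
     continuous_map (prod_topology (topo E) (topo F)) (topo G) (\<lambda>(x, y). B x y) \<and>
     (\<forall>x\<in>carrier E. \<forall>x'\<in>carrier E. \<forall>y\<in>carrier F. B (x \<oplus>\<^bsub>E\<^esub> x') y = B x y \<oplus>\<^bsub>G\<^esub> B x' y) \<and>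
     (\<forall>x\<in>carrier E. \<forall>y\<in>carrier F. \<forall>y'\<in>carrier F. B x (y \<oplus>\<^bsub>F\<^esub> y') = B x y \<oplus>\<^bsub>G\<^esub> B x y') \<and>
     (\<forall>r. \<forall>x\<in>carrier E. \<forall>y\<in>carrier F. B (of_real r \<odot>\<^bsub>E\<^esub> x) y = of_real r \<odot>\<^bsub>G\<^esub> B x y) \<and>
     (\<forall>r. \<forall>x\<in>carrier E. \<forall>y\<in>carrier F. B x (of_real r \<odot>\<^bsub>F\<^esub> y) = of_real r \<odot>\<^bsub>G\<^esub> B x y)"

lemma (in lc_algebra) cont_bilinear_mult: "cont_bilinear A A A (\<lambda>x y. x \<otimes> y)"
  unfolding cont_bilinear_def
  using continuous_mult by (auto simp: l_distr r_distr smult_mult_left smult_mult_right)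

lemma (in lc_algebra) cont_bilinear_smult: "cont_bilinear scalar_algebra A A (\<lambda>c x. c \<odot> x)"
  unfolding cont_bilinear_def
  using continuous_smult by (auto simp: smult_add_left smult_add_right smult_smult mult_ac)

lemma (in lc_algebra) cont_bilinear_real_smult: "cont_bilinear real_algebra A A (\<lambda>r x. of_real r \<odot> x)"
  unfolding cont_bilinear_def
proof (intro conjI)
  let ?P = "prod_topology (topo real_algebra) (topo A)"
  have "continuous_map ?P euclideanreal fst" using continuous_map_fst[of "topo real_algebra" "topo A"] by simp
  then have "continuous_map ?P (euclidean :: 'k topology) (of_real \<circ> fst)"
    by (rule continuous_map_compose) (auto intro: continuous_intros)
  then show "continuous_map ?P (topo A) (\<lambda>(r, x). of_real r \<odot> x)"
    unfolding case_prod_unfold by (intro continuous_map_smult continuous_map_snd) (simp add: o_def)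
qed (auto simp: smult_add_left smult_add_right smult_smult mult_ac)

context
  fixes E :: "('k::real_normed_field, 'a) top_algebra"
    and F :: "('l::real_normed_field, 'b) top_algebra"
  assumes E: "lc_algebra E" and F: "lc_algebra F"
begin

interpretation E: lc_algebra E by (rule E)
interpretation F: lc_algebra F by (rule F)

lemma cont_linear_closed: "cont_linear E F L \<Longrightarrow> x \<in> carrier E \<Longrightarrow> L x \<in> carrier F"
  unfolding cont_linear_def using continuous_map_in_topspace E.topspace_topo F.topspace_topo by metis

lemma cont_linear_diff:
  assumes L: "cont_linear E F L" and x: "x \<in> carrier E" "y \<in> carrier E"
  shows "L (x \<ominus>\<^bsub>E\<^esub> y) = L x \<ominus>\<^bsub>F\<^esub> L y"
proof -
  have "L ((x \<ominus>\<^bsub>E\<^esub> y) \<oplus>\<^bsub>E\<^esub> y) = L (x \<ominus>\<^bsub>E\<^esub> y) \<oplus>\<^bsub>F\<^esub> L y"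
    using L x unfolding cont_linear_def by blast
  moreover have "(x \<ominus>\<^bsub>E\<^esub> y) \<oplus>\<^bsub>E\<^esub> y = x"
    using x by (simp add: a_minus_def E.a_assoc E.l_neg)
  ultimately have "L x = L (x \<ominus>\<^bsub>E\<^esub> y) \<oplus>\<^bsub>F\<^esub> L y" by simp
  then show ?thesis
    using cont_linear_closed[OF L] x by (simp add: a_minus_def F.a_assoc F.r_neg)
qed

lemma has_curve_deriv_linear:
  assumes L: "cont_linear E F L" and c: "has_curve_deriv E c d" "\<forall>\<^sub>F h in nhds 0. c h \<in> carrier E"
  shows "has_curve_deriv F (\<lambda>h. L (c h)) (L d)"
proof -
  have e: "\<forall>\<^sub>F h in at 0. c h \<in> carrier E" and 0: "c 0 \<in> carrier E"
    using c(2) by (auto simp: eventually_at_filter elim: eventually_mono dest: eventually_nhds_x_imp_x)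
  have "limitin (topo F) (L \<circ> (\<lambda>h. of_real (1 / h) \<odot>\<^bsub>E\<^esub> (c h \<ominus>\<^bsub>E\<^esub> c 0))) (L d) (at 0)"
    using L c(1) unfolding has_curve_deriv_def cont_linear_def by (blast intro: continuous_map_limit)
  moreover have "\<forall>\<^sub>F h in at 0. (L \<circ> (\<lambda>h. of_real (1 / h) \<odot>\<^bsub>E\<^esub> (c h \<ominus>\<^bsub>E\<^esub> c 0))) h = of_real (1 / h) \<odot>\<^bsub>F\<^esub> (L (c h) \<ominus>\<^bsub>F\<^esub> L (c 0))"
    using e
  proof eventually_elim
    case (elim h)
    have "L (of_real (1 / h) \<odot>\<^bsub>E\<^esub> (c h \<ominus>\<^bsub>E\<^esub> c 0)) = of_real (1 / h) \<odot>\<^bsub>F\<^esub> L (c h \<ominus>\<^bsub>E\<^esub> c 0)"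
      using L elim 0 E.minus_closed unfolding cont_linear_def by blast
    then show ?case using cont_linear_diff[OF L elim 0] by simp
  qed
  ultimately show ?thesis unfolding has_curve_deriv_def by (rule limitin_transform_eventually[rotated])
qed

lemma psmooth_linear:
  assumes V: "openin (Euclidean_space n) V" and L: "cont_linear E F L" and f: "psmooth Z n V E f"
  shows "psmooth Z n V F (\<lambda>z x. L (f z x))"
proof (rule psmooth_coinduct[OF F V, where \<F> = "\<lambda>g. \<exists>f. psmooth Z n V E f \<and> g = (\<lambda>z x. L (f z x))"])
  fix g assume "\<exists>f. psmooth Z n V E f \<and> g = (\<lambda>z x. L (f z x))"
  then obtain f where f: "psmooth Z n V E f" and g: "g = (\<lambda>z x. L (f z x))" by blast
  have "continuous_map (topo E) (topo F) L" using L unfolding cont_linear_def by blast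
  from continuous_map_compose[OF psmooth_continuous[OF f] this]
  show "continuous_map (prod_topology Z (subtopology (Euclidean_space n) V)) (topo F) (\<lambda>p. g (fst p) (snd p))"
    by (simp add: o_def g)
  fix i assume i: "i < n"
  show "\<exists>k. (\<exists>f. psmooth Z n V E f \<and> k = (\<lambda>z x. L (f z x))) \<and>
      (\<forall>z\<in>topspace Z. \<forall>x\<in>V. has_curve_deriv F (\<lambda>h. g z (x(i := x i + h))) (k z x))"
    using psmooth_partial[OF f i] unfolding g
    by (intro exI[of _ "\<lambda>z x. L (iter_partial E (f z) [i] x)"] conjI ballI exI[of _ "\<lambda>z. iter_partial E (f z) [i]"]
        has_curve_deriv_linear[OF L] psmooth_deriv[OF E f i] eventually_psmooth_closed[OF E f V _ _ i] refl)
qed (use f in blast)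

context
  fixes G :: "('m::real_normed_field, 'c) top_algebra"
  assumes G: "lc_algebra G"
begin

interpretation G: lc_algebra G by (rule G)

lemma cont_bilinear_closed:
  "cont_bilinear E F G B \<Longrightarrow> x \<in> carrier E \<Longrightarrow> y \<in> carrier F \<Longrightarrow> B x y \<in> carrier G"
  unfolding cont_bilinear_def
  using continuous_map_in_topspace[of "prod_topology (topo E) (topo F)" "topo G" "\<lambda>(x, y). B x y" "(x, y)"]
    E.topspace_topo F.topspace_topo G.topspace_topo by auto

lemma cont_bilinear_diff:
  assumes B: "cont_bilinear E F G B"
    and x: "x \<in> carrier E" "x' \<in> carrier E" and y: "y \<in> carrier F" "y' \<in> carrier F"
  shows "B x y \<ominus>\<^bsub>G\<^esub> B x' y' = B (x \<ominus>\<^bsub>E\<^esub> x') y \<oplus>\<^bsub>G\<^esub> B x' (y \<ominus>\<^bsub>F\<^esub> y')"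
proof -
  note cl = cont_bilinear_closed[OF B]
  have "(x \<ominus>\<^bsub>E\<^esub> x') \<oplus>\<^bsub>E\<^esub> x' = x" using x by (simp add: a_minus_def E.a_assoc E.l_neg)
  moreover have "B ((x \<ominus>\<^bsub>E\<^esub> x') \<oplus>\<^bsub>E\<^esub> x') y = B (x \<ominus>\<^bsub>E\<^esub> x') y \<oplus>\<^bsub>G\<^esub> B x' y"
    using B x y E.minus_closed unfolding cont_bilinear_def by blast
  ultimately have 1: "B x y = B (x \<ominus>\<^bsub>E\<^esub> x') y \<oplus>\<^bsub>G\<^esub> B x' y" by simp
  have "(y \<ominus>\<^bsub>F\<^esub> y') \<oplus>\<^bsub>F\<^esub> y' = y" using y by (simp add: a_minus_def F.a_assoc F.l_neg)
  moreover have "B x' ((y \<ominus>\<^bsub>F\<^esub> y') \<oplus>\<^bsub>F\<^esub> y') = B x' (y \<ominus>\<^bsub>F\<^esub> y') \<oplus>\<^bsub>G\<^esub> B x' y'"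
    using B x y F.minus_closed unfolding cont_bilinear_def by blast
  ultimately have 2: "B x' y = B x' (y \<ominus>\<^bsub>F\<^esub> y') \<oplus>\<^bsub>G\<^esub> B x' y'" by simp
  show ?thesis
    unfolding 1 2 using cl x y by (simp add: a_minus_def G.a_assoc G.r_neg)
qed

text \<open>The increment is split by changing first one argument, then the other. The first part
  still contains \<open>c' h\<close>, whence the appeal to continuity of \<open>c'\<close> at
  0.\<close>

lemma has_curve_deriv_bilinear:
  assumes B: "cont_bilinear E F G B"
    and c: "has_curve_deriv E c d" "\<forall>\<^sub>F h in nhds 0. c h \<in> carrier E"
    and c': "has_curve_deriv F c' d'" "\<forall>\<^sub>F h in nhds 0. c' h \<in> carrier F"
  shows "has_curve_deriv G (\<lambda>h. B (c h) (c' h)) (B d (c' 0) \<oplus>\<^bsub>G\<^esub> B (c 0) d')"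
proof -
  have e: "\<forall>\<^sub>F h in at 0. c h \<in> carrier E \<and> c' h \<in> carrier F" and 0: "c 0 \<in> carrier E" "c' 0 \<in> carrier F"
    using c(2) c'(2)
    by (auto simp: eventually_at_filter elim: eventually_elim2 dest: eventually_nhds_x_imp_x)
  note cont = B[unfolded cont_bilinear_def, THEN conjunct1]
  let ?q = "\<lambda>h. of_real (1 / h) \<odot>\<^bsub>E\<^esub> (c h \<ominus>\<^bsub>E\<^esub> c 0)" and ?q' = "\<lambda>h. of_real (1 / h) \<odot>\<^bsub>F\<^esub> (c' h \<ominus>\<^bsub>F\<^esub> c' 0)"
  have "limitin (topo G) ((\<lambda>(x, y). B x y) \<circ> (\<lambda>h. (?q h, c' h))) ((\<lambda>(x, y). B x y) (d, c' 0)) (at 0)"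
    using c(1) F.has_curve_deriv_imp_limitin[OF c']
    by (intro continuous_map_limit[OF cont]) (simp add: limitin_pairwise o_def has_curve_deriv_def)
  moreover have "limitin (topo G) ((\<lambda>(x, y). B x y) \<circ> (\<lambda>h. (c 0, ?q' h))) ((\<lambda>(x, y). B x y) (c 0, d')) (at 0)"
    using c'(1) 0 E.topspace_topo
    by (intro continuous_map_limit[OF cont]) (simp add: limitin_pairwise o_def has_curve_deriv_def)
  ultimately have "limitin (topo G) (\<lambda>h. B (?q h) (c' h) \<oplus>\<^bsub>G\<^esub> B (c 0) (?q' h)) (B d (c' 0) \<oplus>\<^bsub>G\<^esub> B (c 0) d') (at 0)"
    using G.limitin_add by (simp add: o_def)
  moreover have "\<forall>\<^sub>F h in at 0. B (?q h) (c' h) \<oplus>\<^bsub>G\<^esub> B (c 0) (?q' h) = of_real (1 / h) \<odot>\<^bsub>G\<^esub> (B (c h) (c' h) \<ominus>\<^bsub>G\<^esub> B (c 0) (c' 0))"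
    using e
  proof eventually_elim
    case (elim h)
    have "B (?q h) (c' h) = of_real (1 / h) \<odot>\<^bsub>G\<^esub> B (c h \<ominus>\<^bsub>E\<^esub> c 0) (c' h)"
      using B elim 0 E.minus_closed unfolding cont_bilinear_def by blast
    moreover have "B (c 0) (?q' h) = of_real (1 / h) \<odot>\<^bsub>G\<^esub> B (c 0) (c' h \<ominus>\<^bsub>F\<^esub> c' 0)"
      using B elim 0 F.minus_closed unfolding cont_bilinear_def by blast
    ultimately show ?case
      using elim 0 cont_bilinear_closed[OF B]
      by (simp add: cont_bilinear_diff[OF B] G.smult_add_right)
  qed
  ultimately show ?thesis unfolding has_curve_deriv_def by (rule limitin_transform_eventually[rotated])
qed

lemma continuous_map_bilinear:
  assumes B: "cont_bilinear E F G B" and "continuous_map X (topo E) f" "continuous_map X (topo F) g"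
  shows "continuous_map X (topo G) (\<lambda>x. B (f x) (g x))"
  using continuous_map_compose[OF continuous_map_pairedI[OF assms(2,3)] B[unfolded cont_bilinear_def, THEN conjunct1]]
  by (simp add: o_def)

lemma psmooth_bilinear:
  assumes V: "openin (Euclidean_space n) V" and B: "cont_bilinear E F G B"
    and "psmooth Z n V E f" "psmooth Z n V F g"
  shows "psmooth Z n V G (\<lambda>z x. B (f z x) (g z x))"
proof (rule psmooth_coinduct_sums[OF G V, where S = "{\<lambda>z x. B (f z x) (g z x) | f g. psmooth Z n V E f \<and> psmooth Z n V F g}"])
  let ?S = "{\<lambda>z x. B (f z x) (g z x) | f g. psmooth Z n V E f \<and> psmooth Z n V F g}"
  show "(\<lambda>z x. B (f z x) (g z x)) \<in> ?S" using assms by blast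
  fix k assume "k \<in> ?S"
  then obtain f g where fg: "psmooth Z n V E f" "psmooth Z n V F g" and k: "k = (\<lambda>z x. B (f z x) (g z x))" by blast
  show "continuous_map (prod_topology Z (subtopology (Euclidean_space n) V)) (topo G) (\<lambda>p. k (fst p) (snd p))"
    unfolding k using fg by (intro continuous_map_bilinear[OF B] psmooth_continuous)
  fix i assume i: "i < n"
  let ?f = "\<lambda>z. iter_partial E (f z) [i]" and ?g = "\<lambda>z. iter_partial F (g z) [i]"
  let ?k = "\<lambda>z x. B (?f z x) (g z x) \<oplus>\<^bsub>G\<^esub> B (f z x) (?g z x)"
  have mem: "(\<lambda>z x. B (a z x) (b z x)) \<in> ?S" if "psmooth Z n V E a" "psmooth Z n V F b" for a b
    using that by (intro CollectI exI[of _ a] exI[of _ b] conjI refl)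
  have "sum_closure G ?S ?k"
    by (intro sum_closure.add[OF G] sum_closure.base[OF G] mem fg psmooth_partial[OF fg(1) i] psmooth_partial[OF fg(2) i])
  moreover have "has_curve_deriv G (\<lambda>h. k z (x(i := x i + h))) (?k z x)" if zx: "z \<in> topspace Z" "x \<in> V" for z x
    using has_curve_deriv_bilinear[OF B psmooth_deriv[OF E fg(1) i zx] eventually_psmooth_closed[OF E fg(1) V zx i]
        psmooth_deriv[OF F fg(2) i zx] eventually_psmooth_closed[OF F fg(2) V zx i]]
    unfolding k by simp
  ultimately show "\<exists>g. sum_closure G ?S g \<and> (\<forall>z\<in>topspace Z. \<forall>x\<in>V. has_curve_deriv G (\<lambda>h. k z (x(i := x i + h))) (g z x))"
    by blast
qed

end
end

section \<open>Composition with real functions and the chain rule\<close>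

lemma psmooth_real_mult:
  assumes "openin (Euclidean_space n) V" "psmooth Z n V real_algebra f" "psmooth Z n V real_algebra g"
  shows "psmooth Z n V real_algebra (\<lambda>z x. f z x * g z x)"
  using psmooth_bilinear[OF lc_algebra_scalar_algebra lc_algebra_scalar_algebra lc_algebra_scalar_algebra assms(1)
      real_alg.cont_bilinear_mult assms(2,3)] by simp

text \<open>\<open>D\<close> lists the successive derivatives of the outer function on
  \<open>T\<close>. Terms \<open>r z x * D k (f z x)\<close> with a smooth coefficient
  \<open>r\<close> are closed under differentiation up to sums: the derivative falls on
  \<open>r\<close>, or it raises \<open>k\<close> and multiplies \<open>r\<close> by a derivative of
  \<open>f\<close>.\<close>

lemma psmooth_real_compose:
  assumes V: "openin (Euclidean_space n) V" and f: "psmooth Z n V real_algebra f"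
    and T: "\<And>z x. z \<in> topspace Z \<Longrightarrow> x \<in> V \<Longrightarrow> f z x \<in> T"
    and D: "\<And>k t. t \<in> T \<Longrightarrow> (D k has_real_derivative D (Suc k) t) (at t)"
  shows "psmooth Z n V real_algebra (\<lambda>z x. D (0::nat) (f z x))"
proof -
  let ?S = "{\<lambda>z x. r z x * D k (f z x) | r k. psmooth Z n V real_algebra r}"
  note lc = lc_algebra_scalar_algebra[where 'k = real]
  have one: "psmooth Z n V real_algebra (\<lambda>z x. 1)" by (rule psmooth_const[OF lc V]) simp
  show ?thesis
  proof (rule psmooth_coinduct_sums[OF lc V, where S = ?S])
    show "(\<lambda>z x. D 0 (f z x)) \<in> ?S" using one by (intro CollectI exI[of _ "\<lambda>z x. 1"] exI[of _ 0]) simp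
    fix g assume "g \<in> ?S"
    then obtain r k where r: "psmooth Z n V real_algebra r" and g: "g = (\<lambda>z x. r z x * D k (f z x))" by blast
    have "continuous_on T (D k)"
      by (intro continuous_at_imp_continuous_on ballI DERIV_isCont[OF D])
    then have "continuous_map (subtopology euclideanreal T) euclideanreal (D k)" by simp
    moreover have "continuous_map (prod_topology Z (subtopology (Euclidean_space n) V)) (subtopology euclideanreal T) (\<lambda>p. f (fst p) (snd p))"
      using psmooth_continuous[OF f] T by (auto simp: continuous_map_in_subtopology)
    ultimately have "continuous_map (prod_topology Z (subtopology (Euclidean_space n) V)) euclideanreal (D k \<circ> (\<lambda>p. f (fst p) (snd p)))"
      by (rule continuous_map_compose[rotated])
    then have "continuous_map (prod_topology Z (subtopology (Euclidean_space n) V)) euclideanreal (\<lambda>p. r (fst p) (snd p) * D k (f (fst p) (snd p)))"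
      using psmooth_continuous[OF r] by (intro continuous_map_real_mult) (simp_all add: o_def)
    then show "continuous_map (prod_topology Z (subtopology (Euclidean_space n) V)) (topo real_algebra) (\<lambda>p. g (fst p) (snd p))"
      unfolding g by simp
    fix i assume i: "i < n"
    let ?r = "\<lambda>z. iter_partial real_algebra (r z) [i]" and ?f = "\<lambda>z. iter_partial real_algebra (f z) [i]"
    let ?g = "\<lambda>z x. ?r z x * D k (f z x) + (r z x * ?f z x) * D (Suc k) (f z x)"
    have "sum_closure real_algebra ?S (\<lambda>z x. ?r z x * D k (f z x) \<oplus>\<^bsub>real_algebra\<^esub> (r z x * ?f z x) * D (Suc k) (f z x))"
    proof (intro sum_closure.add[OF lc] sum_closure.base[OF lc])
      have mem: "(\<lambda>z x. a z x * D k (f z x)) \<in> ?S" if "psmooth Z n V real_algebra a" for a k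
        using that by (intro CollectI exI[of _ a] exI[of _ k] conjI refl)
      show "(\<lambda>z x. ?r z x * D k (f z x)) \<in> ?S" by (rule mem[OF psmooth_partial[OF r i]])
      have "psmooth Z n V real_algebra (\<lambda>z x. r z x * ?f z x)"
        by (rule psmooth_real_mult[OF V r psmooth_partial[OF f i]])
      then show "(\<lambda>z x. (r z x * ?f z x) * D (Suc k) (f z x)) \<in> ?S" by (rule mem)
    qed
    moreover have "has_curve_deriv real_algebra (\<lambda>h. g z (x(i := x i + h))) (?g z x)" if zx: "z \<in> topspace Z" "x \<in> V" for z x
    proof -
      have 1: "((\<lambda>h. f z (x(i := x i + h))) has_real_derivative ?f z x) (at 0)"
        and 2: "((\<lambda>h. r z (x(i := x i + h))) has_real_derivative ?r z x) (at 0)"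
        using psmooth_deriv[OF lc f i zx] psmooth_deriv[OF lc r i zx] unfolding has_curve_deriv_real .
      have "(D k has_real_derivative D (Suc k) (f z x)) (at (f z (x(i := x i + 0))))"
        using D[OF T[OF zx]] by simp
      from DERIV_mult[OF 2 DERIV_chain2[OF this 1]]
      show ?thesis unfolding has_curve_deriv_real g by (simp add: algebra_simps)
    qed
    ultimately show "\<exists>h. sum_closure real_algebra ?S h \<and> (\<forall>z\<in>topspace Z. \<forall>x\<in>V. has_curve_deriv real_algebra (\<lambda>h. g z (x(i := x i + h))) (h z x))"
      by (intro exI[of _ ?g]) simp
  qed
qed

text \<open>The class consists of sums of \<open>of_real (r z x) \<odot> f z (s x)\<close>: a
  derivative falls on the real coefficient \<open>r\<close>, or it replaces \<open>f\<close> by one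
  of its partial derivatives and multiplies \<open>r\<close> by a derivative of a coordinate of
  \<open>s\<close>.\<close>

lemma psmooth_chain:
  fixes E :: "('k::real_normed_field, 'a) top_algebra"
  assumes E: "lc_algebra E" and V: "openin (Euclidean_space n) V" and W: "openin (Euclidean_space m) W"
    and f: "psmooth Z m W E f" and sW: "\<And>x. x \<in> V \<Longrightarrow> s x \<in> W"
    and s: "\<And>j. j < m \<Longrightarrow> smooth_on n V real_algebra (\<lambda>x. s x j)"
  shows "psmooth Z n V E (\<lambda>z x. f z (s x))"
proof -
  interpret lc_algebra E by (rule E)
  note lc = lc_algebra_scalar_algebra[where 'k = real]
  have s': "psmooth Z n V real_algebra (\<lambda>_ x. s x j)" if "j < m" for j
    using smooth_on_imp_psmooth[OF s[OF that]] .
  let ?S = "{\<lambda>z x. of_real (r z x) \<odot>\<^bsub>E\<^esub> f z (s x) | r f. psmooth Z n V real_algebra r \<and> psmooth Z m W E f}"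
  let ?PV = "prod_topology Z (subtopology (Euclidean_space n) V)"
  have one: "psmooth Z n V real_algebra (\<lambda>z x. 1)" by (rule psmooth_const[OF lc V]) simp
  have Ws: "W \<subseteq> topspace (Euclidean_space m)" using W openin_subset by blast
  have "continuous_map (subtopology (Euclidean_space n) V) (Euclidean_space m) s"
    unfolding continuous_map_to_Euclidean_space
  proof (intro conjI ballI allI impI)
    fix j assume "j < m"
    from s[OF this, unfolded smooth_on_def, rule_format, OF lists.Nil]
    show "continuous_map (subtopology (Euclidean_space n) V) euclideanreal (\<lambda>x. s x j)" by simp
  qed (use sW Ws in auto)
  then have "continuous_map (subtopology (Euclidean_space n) V) (subtopology (Euclidean_space m) W) s"
    using sW by (auto simp: continuous_map_in_subtopology)
  then have "continuous_map ?PV (subtopology (Euclidean_space m) W) (s \<circ> snd)"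
    by (rule continuous_map_compose[OF continuous_map_snd])
  then have cs: "continuous_map ?PV (prod_topology Z (subtopology (Euclidean_space m) W)) (\<lambda>p. (fst p, s (snd p)))"
    by (intro continuous_map_pairedI continuous_map_fst) (simp add: o_def)
  have cl: "g z (s x) \<in> carrier E" if "psmooth Z m W E g" "z \<in> topspace Z" "x \<in> V" for g z x
    using psmooth_closed[OF E that(1) W that(2) sW[OF that(3)]] .
  have mem: "(\<lambda>z x. of_real (a z x) \<odot>\<^bsub>E\<^esub> b z (s x)) \<in> ?S" if "psmooth Z n V real_algebra a" "psmooth Z m W E b" for a b
    using that by (intro CollectI exI[of _ a] exI[of _ b] conjI refl)
  \<comment> \<open>The coefficient 1 brings the composite into the shape of the class;
    \<open>psmooth_cong\<close> removes it at the end.\<close>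
  have fS: "(\<lambda>z x. of_real 1 \<odot>\<^bsub>E\<^esub> f z (s x)) \<in> ?S" by (rule mem[OF one f])
  have "psmooth Z n V E (\<lambda>z x. of_real 1 \<odot>\<^bsub>E\<^esub> f z (s x))"
    using V fS
  proof (rule psmooth_coinduct_sums[OF E])
    fix g assume "g \<in> ?S"
    then obtain r f where r: "psmooth Z n V real_algebra r" and f: "psmooth Z m W E f"
      and g: "g = (\<lambda>z x. of_real (r z x) \<odot>\<^bsub>E\<^esub> f z (s x))" by blast
    have "continuous_map ?PV (topo E) ((\<lambda>p. f (fst p) (snd p)) \<circ> (\<lambda>p. (fst p, s (snd p))))"
      by (rule continuous_map_compose[OF cs psmooth_continuous[OF f]])
    then have "continuous_map ?PV (topo E) (\<lambda>p. f (fst p) (s (snd p)))" by (simp add: o_def)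
    from continuous_map_bilinear[OF lc E E cont_bilinear_real_smult psmooth_continuous[OF r] this]
    show "continuous_map ?PV (topo E) (\<lambda>p. g (fst p) (snd p))" unfolding g .
    fix i assume i: "i < n"
    let ?r = "\<lambda>z. iter_partial real_algebra (r z) [i]"
    let ?s = "\<lambda>j. iter_partial real_algebra (\<lambda>x. s x j) [i]"
    let ?f = "\<lambda>j z. iter_partial E (f z) [j]"
    let ?g = "\<lambda>k z x. of_real (?r z x) \<odot>\<^bsub>E\<^esub> f z (s x) \<oplus>\<^bsub>E\<^esub>
        of_real (r z x) \<odot>\<^bsub>E\<^esub> finsum E (\<lambda>j. of_real (?s j x) \<odot>\<^bsub>E\<^esub> ?f j z (s x)) {..<k}"
    \<comment> \<open>\<open>sum_closure\<close> knows binary sums only, so the \<open>m\<close>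
      summands of the chain rule are collected by induction; \<open>?g k\<close> is the derivative
      with only the first \<open>k\<close> of them.\<close>
    have "\<exists>g. sum_closure E ?S g \<and> (\<forall>z\<in>topspace Z. \<forall>x\<in>V. g z x = ?g k z x)" if "k \<le> m" for k
      using that
    proof (induction k)
      case 0
      have "sum_closure E ?S (\<lambda>z x. of_real (?r z x) \<odot>\<^bsub>E\<^esub> f z (s x))"
        by (rule sum_closure.base[OF E mem[OF psmooth_partial[OF r i] f]])
      then show ?case using cl[OF f] by (intro exI[of _ "\<lambda>z x. of_real (?r z x) \<odot>\<^bsub>E\<^esub> f z (s x)"]) simp
    next
      case (Suc k)
      then obtain g where g: "sum_closure E ?S g" "\<forall>z\<in>topspace Z. \<forall>x\<in>V. g z x = ?g k z x" by auto
      have k: "k < m" using Suc by simp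
      have pr: "psmooth Z n V real_algebra (\<lambda>z x. r z x * ?s k x)"
        using psmooth_real_mult[OF V r psmooth_partial[OF s'[OF k] i]] .
      have pf: "psmooth Z m W E (?f j)" if "j < m" for j using psmooth_partial[OF f that] .
      let ?h = "\<lambda>z x. of_real (r z x * ?s k x) \<odot>\<^bsub>E\<^esub> ?f k z (s x)"
      have "sum_closure E ?S ?h" by (rule sum_closure.base[OF E mem[OF pr pf[OF k]]])
      then have "sum_closure E ?S (\<lambda>z x. g z x \<oplus>\<^bsub>E\<^esub> ?h z x)" by (rule sum_closure.add[OF E g(1)])
      moreover have "g z x \<oplus>\<^bsub>E\<^esub> ?h z x = ?g (Suc k) z x" if zx: "z \<in> topspace Z" "x \<in> V" for z x
      proof -
        have c: "f z (s x) \<in> carrier E" "\<And>j. j < m \<Longrightarrow> ?f j z (s x) \<in> carrier E"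
          using cl f pf zx by blast+
        have fs: "finsum E (\<lambda>j. of_real (?s j x) \<odot>\<^bsub>E\<^esub> ?f j z (s x)) {..<k} \<in> carrier E"
          using c k by (intro finsum_closed) auto
        have "finsum E (\<lambda>j. of_real (?s j x) \<odot>\<^bsub>E\<^esub> ?f j z (s x)) {..<Suc k} =
           of_real (?s k x) \<odot>\<^bsub>E\<^esub> ?f k z (s x) \<oplus>\<^bsub>E\<^esub> finsum E (\<lambda>j. of_real (?s j x) \<odot>\<^bsub>E\<^esub> ?f j z (s x)) {..<k}"
          unfolding lessThan_Suc using c k by (subst finsum_insert) auto
        then show ?thesis
          using g(2) zx c(1) c(2)[OF k] fs
          by (simp add: smult_add_right smult_smult a_assoc[symmetric] del: iter_partial.simps) (simp add: a_ac del: iter_partial.simps)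
      qed
      ultimately show ?case by blast
    qed
    from this[of m] obtain G where G: "sum_closure E ?S G" "\<forall>z\<in>topspace Z. \<forall>x\<in>V. G z x = ?g m z x" by blast
    have "has_curve_deriv E (\<lambda>h. g z (x(i := x i + h))) (?g m z x)" if zx: "z \<in> topspace Z" "x \<in> V" for z x
    proof -
      have ev: "\<forall>\<^sub>F h in nhds 0. s (x(i := x i + h)) \<in> W"
        using eventually_upd_in_openin[OF V zx(2) i] by eventually_elim (rule sW)
      have d: "has_curve_deriv E (\<lambda>h. f z (s (x(i := x i + h))))
          (finsum E (\<lambda>j. of_real (?s j x) \<odot>\<^bsub>E\<^esub> ?f j z (s (x(i := x i + 0)))) {..<m})"
      proof (rule has_curve_deriv_partials[OF W, where f = "f z" and D = "\<lambda>j. ?f j z" and e = "\<lambda>j. ?s j x"])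
        show "f z y \<in> carrier E" if "y \<in> W" for y using psmooth_closed[OF E f W zx(1) that] .
        show "has_curve_deriv E (\<lambda>h. f z (y(j := y j + h))) (?f j z y)" if "j < m" "y \<in> W" for j y
          using psmooth_deriv[OF E f that(1) zx(1) that(2)] .
        show "continuous_map (subtopology (Euclidean_space m) W) (topo E) (?f j z)" if "j < m" for j
          using psmooth_imp_smooth_on[OF psmooth_partial[OF f that] zx(1), unfolded smooth_on_def, rule_format, OF lists.Nil]
          by simp
        show "\<forall>\<^sub>F h in nhds 0. s (x(i := x i + h)) \<in> W" by (rule ev)
        show "((\<lambda>h. s (x(i := x i + h)) j) has_real_derivative ?s j x) (at 0)" if "j < m" for j
          using psmooth_deriv[OF lc s'[OF that] i zx] unfolding has_curve_deriv_real .
      qed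
      have "\<forall>\<^sub>F h in nhds 0. f z (s (x(i := x i + h))) \<in> carrier E"
        using ev by eventually_elim (rule psmooth_closed[OF E f W zx(1)])
      from has_curve_deriv_bilinear[OF lc E E cont_bilinear_real_smult psmooth_deriv[OF lc r i zx] eventually_psmooth_closed[OF lc r V zx i] d this]
      show ?thesis unfolding g by (simp del: iter_partial.simps)
    qed
    then show "\<exists>h. sum_closure E ?S h \<and> (\<forall>z\<in>topspace Z. \<forall>x\<in>V. has_curve_deriv E (\<lambda>h. g z (x(i := x i + h))) (h z x))"
      using G by (intro exI[of _ G]) simp
  qed
  then show ?thesis
    by (rule psmooth_cong[OF E V]) (use cl[OF f] in simp)
qed

section \<open>Algebras of smooth functions\<close>

text \<open>Compact neighbourhoods are what makes evaluation jointly continuous for a compact-open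
  topology.\<close>

lemma neighbourhood_base_of_compactin_Euclidean_space:
  "neighbourhood_base_of (compactin (Euclidean_space n)) (Euclidean_space n)"
proof -
  have "locally_compact_space (product_topology (\<lambda>i. euclideanreal) {..<n})"
    by (simp add: locally_compact_space_product_topology locally_compact_space_euclidean)
  then have "locally_compact_space (Euclidean_space n)"
    using homeomorphic_Euclidean_space_product_topology homeomorphic_locally_compact_space by blast
  then show ?thesis using Hausdorff_Euclidean_space locally_compact_space_neighbourhood_base by blast
qed

text \<open>What manifolds, their open submanifolds and \<open>real_line\<close> share: enough to
  test smoothness chart by chart.\<close>

definition euclidean_charts :: "'p manifold \<Rightarrow> bool" where
  "euclidean_charts X \<longleftrightarrow> (\<Union>(U, \<phi>)\<in>charts X. U) = points X \<and>
     (\<forall>(U, \<phi>)\<in>charts X. openin (Euclidean_space (mdim X)) (\<phi> ` U) \<and> inj_on \<phi> U)"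

lemma smooth_manifold_imp_euclidean_charts:
  assumes "smooth_manifold X"
  shows "euclidean_charts X"
proof -
  have "inj_on \<phi> U" if "(U, \<phi>) \<in> charts X" for U \<phi>
  proof -
    have "openin (mtop X) U" "homeomorphic_map (subtopology (mtop X) U) (subtopology (Euclidean_space (mdim X)) (\<phi> ` U)) \<phi>"
      using assms that unfolding smooth_manifold_def by auto
    then show ?thesis
      using homeomorphic_imp_injective_map openin_subset by (metis topspace_subtopology_subset)
  qed
  then show ?thesis using assms unfolding smooth_manifold_def euclidean_charts_def by auto
qed

lemma euclidean_charts_real_line: "euclidean_charts real_line"
proof -
  have "(\<lambda>t i. if i = 0 then t else 0) ` UNIV = topspace (Euclidean_space 1)"
  proof
    show "topspace (Euclidean_space 1) \<subseteq> (\<lambda>t i. if i = (0::nat) then t else 0) ` UNIV"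
    proof
      fix x assume "x \<in> topspace (Euclidean_space 1)"
      then have "x = (\<lambda>i. if i = 0 then x 0 else 0)" by (auto simp: topspace_Euclidean_space fun_eq_iff)
      then show "x \<in> (\<lambda>t i. if i = (0::nat) then t else 0) ` UNIV" by (rule image_eqI) simp
    qed
  qed (auto simp: topspace_Euclidean_space)
  moreover have "inj (\<lambda>t i. if i = (0::nat) then t else (0::real))"
    by (rule injI) (drule fun_cong[of _ _ 0], simp)
  ultimately show ?thesis by (simp add: euclidean_charts_def real_line_def)
qed

section \<open>The exponential law for functions on a manifold\<close>

definition psmooth_fun ::
  "'z topology \<Rightarrow> 'p manifold \<Rightarrow> ('k::real_normed_field, 'a) top_algebra \<Rightarrow> ('z \<Rightarrow> 'p \<Rightarrow> 'a) \<Rightarrow> bool" where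
  "psmooth_fun Z X E F \<longleftrightarrow>
     (\<forall>(U, \<phi>)\<in>charts X. psmooth Z (mdim X) (\<phi> ` U) E (\<lambda>z x. F z (inv_into U \<phi> x)))"

lemma psmooth_funD:
  "psmooth_fun Z X E F \<Longrightarrow> (U, \<phi>) \<in> charts X \<Longrightarrow> psmooth Z (mdim X) (\<phi> ` U) E (\<lambda>z x. F z (inv_into U \<phi> x))"
  unfolding psmooth_fun_def by auto

lemma psmooth_funI:
  "(\<And>U \<phi>. (U, \<phi>) \<in> charts X \<Longrightarrow> psmooth Z (mdim X) (\<phi> ` U) E (\<lambda>z x. F z (inv_into U \<phi> x))) \<Longrightarrow> psmooth_fun Z X E F"
  unfolding psmooth_fun_def by auto

lemma psmooth_fun_reparam:
  assumes "psmooth_fun Z X E F" "continuous_map Z' Z r"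
  shows "psmooth_fun Z' X E (\<lambda>z. F (r z))"
  by (rule psmooth_funI) (rule psmooth_reparam[OF psmooth_funD[OF assms(1)] assms(2)])

lemma smooth_functions_imp_psmooth_fun:
  assumes "f \<in> smooth_functions X E"
  shows "psmooth_fun Z X E (\<lambda>_. f)"
proof (rule psmooth_funI)
  fix U \<phi> assume "(U, \<phi>) \<in> charts X"
  then have "smooth_on (mdim X) (\<phi> ` U) E (\<lambda>x. f (inv_into U \<phi> x))"
    using assms unfolding smooth_functions_def o_def by auto
  then show "psmooth Z (mdim X) (\<phi> ` U) E (\<lambda>z x. f (inv_into U \<phi> x))"
    by (rule smooth_on_imp_psmooth)
qed

lemma smooth_functions_closed: "f \<in> smooth_functions X E \<Longrightarrow> p \<in> points X \<Longrightarrow> f p \<in> carrier E"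
  by (auto simp: smooth_functions_def)

lemma smooth_functions_ext:
  assumes "f \<in> smooth_functions X E" "g \<in> smooth_functions X E" "\<And>p. p \<in> points X \<Longrightarrow> f p = g p"
  shows "f = g"
  using assms by (intro extensionalityI[of f "points X" g]) (auto simp: smooth_functions_def PiE_iff)

lemma restrict_eq_smooth_function:
  assumes "f \<in> smooth_functions X E" "\<And>p. p \<in> points X \<Longrightarrow> g p = f p"
  shows "restrict g (points X) = f"
  using assms by (auto simp: fun_eq_iff smooth_functions_def PiE_iff extensional_def)

lemma topspace_smooth_compact_open: "topspace (smooth_compact_open X E) = smooth_functions X E"
  unfolding smooth_compact_open_def topology_generated_by_topspace by auto

context
  fixes X :: "'p manifold"
  assumes X: "euclidean_charts X"
begin

lemma chart_openin: "(U, \<phi>) \<in> charts X \<Longrightarrow> openin (Euclidean_space (mdim X)) (\<phi> ` U)"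
  and chart_inj: "(U, \<phi>) \<in> charts X \<Longrightarrow> inj_on \<phi> U"
  and chart_subset: "(U, \<phi>) \<in> charts X \<Longrightarrow> U \<subseteq> points X"
  using X unfolding euclidean_charts_def by auto

lemma chart_cover:
  assumes "p \<in> points X"
  obtains U \<phi> where "(U, \<phi>) \<in> charts X" "p \<in> U"
  using assms X unfolding euclidean_charts_def by blast

lemma inv_chart_in: "(U, \<phi>) \<in> charts X \<Longrightarrow> x \<in> \<phi> ` U \<Longrightarrow> inv_into U \<phi> x \<in> points X"
  using inv_into_into[of x \<phi> U] chart_subset[of U \<phi>] by auto

context
  fixes E :: "('k::real_normed_field, 'a) top_algebra"
  assumes E: "lc_algebra E"
begin

interpretation E: lc_algebra E by (rule E)

lemma psmooth_fun_cong:
  assumes "psmooth_fun Z X E F" "\<And>z p. z \<in> topspace Z \<Longrightarrow> p \<in> points X \<Longrightarrow> F z p = G z p"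
  shows "psmooth_fun Z X E G"
  unfolding psmooth_fun_def
proof safe
  fix U \<phi> assume c: "(U, \<phi>) \<in> charts X"
  have "psmooth Z (mdim X) (\<phi> ` U) E (\<lambda>z x. F z (inv_into U \<phi> x))"
    using assms(1) c unfolding psmooth_fun_def by auto
  then show "psmooth Z (mdim X) (\<phi> ` U) E (\<lambda>z x. G z (inv_into U \<phi> x))"
    by (rule psmooth_cong[OF E chart_openin[OF c]]) (use assms(2) inv_chart_in[OF c] in auto)
qed

lemma psmooth_fun_closed:
  assumes "psmooth_fun Z X E F" "z \<in> topspace Z" "p \<in> points X"
  shows "F z p \<in> carrier E"
proof -
  obtain U \<phi> where c: "(U, \<phi>) \<in> charts X" "p \<in> U" using chart_cover assms(3) by metis
  have "psmooth Z (mdim X) (\<phi> ` U) E (\<lambda>z x. F z (inv_into U \<phi> x))"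
    using assms(1) c unfolding psmooth_fun_def by auto
  from psmooth_closed[OF E this chart_openin[OF c(1)] assms(2), of "\<phi> p"] c
  show ?thesis using chart_inj[OF c(1)] by simp
qed

lemma psmooth_fun_imp_smooth_functions:
  assumes F: "psmooth_fun Z X E F" and z: "z \<in> topspace Z" and ext: "F z \<in> extensional (points X)"
  shows "F z \<in> smooth_functions X E"
proof -
  have "smooth_on (mdim X) (\<phi> ` U) E (F z \<circ> inv_into U \<phi>)" if "(U, \<phi>) \<in> charts X" for U \<phi>
    using psmooth_imp_smooth_on[of Z "mdim X" "\<phi> ` U" E "\<lambda>z x. F z (inv_into U \<phi> x)" z] F z that
    unfolding psmooth_fun_def by (auto simp: o_def)
  then show ?thesis
    using psmooth_fun_closed[OF F z] ext unfolding smooth_functions_def by (auto simp: PiE_iff)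
qed

text \<open>Elements of \<open>smooth_functions\<close> are extensional while pointwise formulas are
  not; restriction mediates between the two.\<close>

lemma restrict_psmooth_fun:
  assumes F: "psmooth_fun Z X E F"
  shows "psmooth_fun Z X E (\<lambda>z. restrict (F z) (points X))"
    and "z \<in> topspace Z \<Longrightarrow> restrict (F z) (points X) \<in> smooth_functions X E"
proof -
  show *: "psmooth_fun Z X E (\<lambda>z. restrict (F z) (points X))"
    by (rule psmooth_fun_cong[OF F]) simp
  show "restrict (F z) (points X) \<in> smooth_functions X E" if "z \<in> topspace Z"
    using psmooth_fun_imp_smooth_functions[OF * that] by simp
qed

text \<open>Evaluation half of the exponential law, the parameter being the function itself. For one
  function, a compact neighbourhood \<open>K\<close> of the point is mapped into \<open>W\<close>;
  mapping \<open>K\<close> into \<open>W\<close> is then an open condition on all functions.\<close>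

lemma psmooth_fun_smooth_compact_open: "psmooth_fun (smooth_compact_open X E) X E (\<lambda>f. f)"
  unfolding psmooth_fun_def
proof safe
  fix U \<phi> assume c: "(U, \<phi>) \<in> charts X"
  let ?T = "smooth_compact_open X E" and ?n = "mdim X" and ?S = "subtopology (Euclidean_space (mdim X)) (\<phi> ` U)"
  note V = chart_openin[OF c]
  show "psmooth ?T ?n (\<phi> ` U) E (\<lambda>f x. f (inv_into U \<phi> x))"
    unfolding psmooth_def
  proof (intro ballI conjI)
    fix js assume js: "js \<in> lists {..<?n}"
    let ?D = "\<lambda>f. iter_partial E (f \<circ> inv_into U \<phi>) js"
    have D: "continuous_map ?S (topo E) (?D f)" if "f \<in> smooth_functions X E" for f
      using that c js unfolding smooth_functions_def smooth_on_def by blast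
    have "continuous_map (prod_topology ?T ?S) (topo E) (\<lambda>p. ?D (fst p) (snd p))"
      unfolding continuous_map_def
    proof (intro conjI allI impI)
      show "(\<lambda>p. ?D (fst p) (snd p)) \<in> topspace (prod_topology ?T ?S) \<rightarrow> topspace (topo E)"
      proof
        fix p assume p: "p \<in> topspace (prod_topology ?T ?S)"
        then have "fst p \<in> smooth_functions X E" "snd p \<in> topspace ?S"
          by (auto simp: topspace_smooth_compact_open)
        then show "?D (fst p) (snd p) \<in> topspace (topo E)" by (rule continuous_map_in_topspace[OF D])
      qed
      fix W assume W: "openin (topo E) W"
      let ?P = "{p \<in> topspace (prod_topology ?T ?S). ?D (fst p) (snd p) \<in> W}"
      show "openin (prod_topology ?T ?S) ?P"
        unfolding openin_prod_topology_alt
      proof (intro allI impI)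
        fix f x assume "(f, x) \<in> ?P"
        then have f: "f \<in> smooth_functions X E" and x: "x \<in> \<phi> ` U" "x \<in> topspace ?S" "?D f x \<in> W"
          by (auto simp: topspace_smooth_compact_open)
        let ?O = "{x \<in> topspace ?S. ?D f x \<in> W}"
        have "openin ?S ?O" using D[OF f] W by (rule openin_continuous_map_preimage)
        then have "openin (Euclidean_space ?n) ?O" using V openin_open_subtopology by blast
        moreover have "x \<in> ?O" using x by simp
        ultimately obtain N K where NK: "openin (Euclidean_space ?n) N" "compactin (Euclidean_space ?n) K" "x \<in> N" "N \<subseteq> K" "K \<subseteq> ?O"
          using neighbourhood_base_of_compactin_Euclidean_space[of ?n] unfolding neighbourhood_base_of by meson
        have KU: "K \<subseteq> \<phi> ` U" using NK(5) by auto
        let ?B = "{f \<in> smooth_functions X E. ?D f ` K \<subseteq> W}"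
        have "openin ?T ?B"
          unfolding smooth_compact_open_def
          by (rule topology_generated_by_Basis) (use c js NK(2) KU W in blast)
        moreover have "openin ?S N" using NK KU V by (metis openin_open_subtopology order_trans)
        moreover have "?B \<times> N \<subseteq> ?P"
        proof
          fix p assume "p \<in> ?B \<times> N"
          then obtain g y where p: "p = (g, y)" "g \<in> smooth_functions X E" "?D g ` K \<subseteq> W" "y \<in> N" by blast
          then have "y \<in> K" "y \<in> topspace ?S" "?D g y \<in> W" using NK by auto
          then show "p \<in> ?P" using p by (auto simp: topspace_smooth_compact_open)
        qed
        moreover have "f \<in> ?B" using f NK(5) by auto
        ultimately show "\<exists>U V. openin ?T U \<and> openin ?S V \<and> f \<in> U \<and> x \<in> V \<and> U \<times> V \<subseteq> ?P"
          using NK(3) by blast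
      qed
    qed
    then show "continuous_map (prod_topology ?T ?S) (topo E)
      (\<lambda>p. iter_partial E (\<lambda>x. (fst p) (inv_into U \<phi> x)) js (snd p))"
      by (simp add: o_def)
  next
    fix js f x assume "js \<in> lists {..<?n}" "f \<in> topspace ?T" "x \<in> \<phi> ` U"
    then show "\<forall>i<?n. \<exists>d. has_curve_deriv E (\<lambda>h. iter_partial E (\<lambda>x. f (inv_into U \<phi> x)) js (x(i := x i + h))) d"
      using c unfolding topspace_smooth_compact_open smooth_functions_def smooth_on_def o_def by blast
  qed
qed

text \<open>Converse half of the exponential law. It suffices to look at subbasic sets; there the
  tube lemma turns joint continuity into a neighbourhood of the parameter that is uniform over the
  compact set \<open>K\<close>.\<close>

lemma continuous_map_smooth_compact_open:
  assumes F: "psmooth_fun Z X E F" and ext: "\<And>z. z \<in> topspace Z \<Longrightarrow> F z \<in> extensional (points X)"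
  shows "continuous_map Z (smooth_compact_open X E) F"
proof -
  have SF: "F z \<in> smooth_functions X E" if "z \<in> topspace Z" for z
    using psmooth_fun_imp_smooth_functions[OF F that ext[OF that]] .
  have gen: "openin Z (F -` {f \<in> smooth_functions X E. iter_partial E (f \<circ> inv_into U \<phi>) js ` K \<subseteq> W} \<inter> topspace Z)"
    if c: "(U, \<phi>) \<in> charts X" and js: "js \<in> lists {..<mdim X}" and K: "compactin (Euclidean_space (mdim X)) K" "K \<subseteq> \<phi> ` U"
      and W: "openin (topo E) W" for U \<phi> js K W
  proof -
    let ?S = "subtopology (Euclidean_space (mdim X)) (\<phi> ` U)"
    let ?D = "\<lambda>z. iter_partial E (F z \<circ> inv_into U \<phi>) js"
    have "continuous_map (prod_topology Z ?S) (topo E) (\<lambda>p. ?D (fst p) (snd p))"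
      using F c js unfolding psmooth_fun_def psmooth_def o_def by blast
    then have op: "openin (prod_topology Z ?S) {p \<in> topspace (prod_topology Z ?S). ?D (fst p) (snd p) \<in> W}" (is "openin _ ?Q")
      using W by (rule openin_continuous_map_preimage)
    have KS: "compactin ?S K" using K by (simp add: compactin_subtopology)
    show ?thesis
    proof (subst openin_subopen, safe)
      fix z assume z: "z \<in> topspace Z" and im: "?D z ` K \<subseteq> W"
      have "{z} \<times> K \<subseteq> ?Q" using z im compactin_subset_topspace[OF KS] by auto
      from tube_lemma_right[OF op KS z this] obtain N V where N: "openin Z N" "z \<in> N" "K \<subseteq> V" "N \<times> V \<subseteq> ?Q" by blast
      have "N \<subseteq> F -` {f \<in> smooth_functions X E. iter_partial E (f \<circ> inv_into U \<phi>) js ` K \<subseteq> W} \<inter> topspace Z"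
      proof
        fix z' assume z': "z' \<in> N"
        then have zt: "z' \<in> topspace Z" using N(1) openin_subset by blast
        have "?D z' x \<in> W" if "x \<in> K" for x
        proof -
          have "(z', x) \<in> ?Q" using N(3,4) z' that by blast
          then show ?thesis by simp
        qed
        then show "z' \<in> F -` {f \<in> smooth_functions X E. iter_partial E (f \<circ> inv_into U \<phi>) js ` K \<subseteq> W} \<inter> topspace Z"
          using SF[OF zt] zt by auto
      qed
      then show "\<exists>T. openin Z T \<and> z \<in> T \<and> T \<subseteq> F -` {f \<in> smooth_functions X E. iter_partial E (f \<circ> inv_into U \<phi>) js ` K \<subseteq> W} \<inter> topspace Z"
        using N by blast
    qed
  qed
  have whole: "F -` smooth_functions X E \<inter> topspace Z = topspace Z" using SF by auto
  show ?thesis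
    unfolding smooth_compact_open_def
  proof (rule continuous_on_generated_topo)
    fix B assume "B \<in> insert (smooth_functions X E)
       {{f \<in> smooth_functions X E. iter_partial E (f \<circ> inv_into U \<phi>) js ` K \<subseteq> W} | U \<phi> js K W.
          (U, \<phi>) \<in> charts X \<and> js \<in> lists {..<mdim X} \<and>
          compactin (Euclidean_space (mdim X)) K \<and> K \<subseteq> \<phi> ` U \<and> openin (topo E) W}"
    then consider "B = smooth_functions X E" | U \<phi> js K W where "B = {f \<in> smooth_functions X E. iter_partial E (f \<circ> inv_into U \<phi>) js ` K \<subseteq> W}"
        "(U, \<phi>) \<in> charts X" "js \<in> lists {..<mdim X}" "compactin (Euclidean_space (mdim X)) K" "K \<subseteq> \<phi> ` U" "openin (topo E) W" by blast
    then show "openin Z (F -` B \<inter> topspace Z)"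
      by cases (simp_all only: gen whole openin_topspace)
  qed (use SF in auto)
qed

lemma psmooth_fun_add:
  assumes "psmooth_fun Z X E F" "psmooth_fun Z X E G"
  shows "psmooth_fun Z X E (\<lambda>z p. F z p \<oplus>\<^bsub>E\<^esub> G z p)"
  by (rule psmooth_funI) (rule psmooth_add[OF E chart_openin psmooth_funD[OF assms(1)] psmooth_funD[OF assms(2)]])

lemma psmooth_fun_param:
  "continuous_map Z (topo E) e \<Longrightarrow> psmooth_fun Z X E (\<lambda>z p. e z)"
  by (rule psmooth_funI) (rule psmooth_param[OF E chart_openin])

lemma psmooth_fun_const: "a \<in> carrier E \<Longrightarrow> psmooth_fun Z X E (\<lambda>z p. a)"
  by (intro psmooth_fun_param E.continuous_map_const_A)

end

lemma psmooth_fun_linear: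
  assumes "lc_algebra E" "lc_algebra F" "cont_linear E F L" "psmooth_fun Z X E f"
  shows "psmooth_fun Z X F (\<lambda>z p. L (f z p))"
  by (rule psmooth_funI) (rule psmooth_linear[OF assms(1,2) chart_openin assms(3) psmooth_funD[OF assms(4)]])

lemma psmooth_fun_bilinear:
  assumes "lc_algebra E" "lc_algebra F" "lc_algebra G" "cont_bilinear E F G B"
    "psmooth_fun Z X E f" "psmooth_fun Z X F g"
  shows "psmooth_fun Z X G (\<lambda>z p. B (f z p) (g z p))"
  by (rule psmooth_funI) (rule psmooth_bilinear[OF assms(1-3) chart_openin assms(4) psmooth_funD[OF assms(5)] psmooth_funD[OF assms(6)]])

end

section \<open>Smooth functions form a locally convex algebra\<close>

lemma smooth_algebra_simps [simp]:
  "carrier (smooth_algebra X E) = smooth_functions X E"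
  "f \<otimes>\<^bsub>smooth_algebra X E\<^esub> g = (\<lambda>p\<in>points X. f p \<otimes>\<^bsub>E\<^esub> g p)"
  "\<one>\<^bsub>smooth_algebra X E\<^esub> = (\<lambda>p\<in>points X. \<one>\<^bsub>E\<^esub>)"
  "\<zero>\<^bsub>smooth_algebra X E\<^esub> = (\<lambda>p\<in>points X. \<zero>\<^bsub>E\<^esub>)"
  "f \<oplus>\<^bsub>smooth_algebra X E\<^esub> g = (\<lambda>p\<in>points X. f p \<oplus>\<^bsub>E\<^esub> g p)"
  "c \<odot>\<^bsub>smooth_algebra X E\<^esub> f = (\<lambda>p\<in>points X. c \<odot>\<^bsub>E\<^esub> f p)"
  "topo (smooth_algebra X E) = smooth_compact_open X E"
  by (simp_all add: smooth_algebra_def)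

context
  fixes E :: "('k::real_normed_field, 'a) top_algebra" (structure)
  assumes E: "lc_algebra E"
begin

interpretation lc_algebra E by (rule E)

text \<open>Prepares the convexity of subbasic neighbourhoods in the function algebra, where
  combinations with real coefficients occur.\<close>

lemma iter_partial_lincomb:
  assumes V: "openin (Euclidean_space n) V" and f: "smooth_on n V E f" and g: "smooth_on n V E g"
    and js: "js \<in> lists {..<n}" and x: "x \<in> V"
    and k: "\<And>x. x \<in> V \<Longrightarrow> k x = of_real a \<odot> f x \<oplus> of_real b \<odot> g x"
  shows "iter_partial E k js x = of_real a \<odot> iter_partial E f js x \<oplus> of_real b \<odot> iter_partial E g js x"
  using js x
proof (induction js arbitrary: x rule: list.induct)
  case Nil
  then show ?case using k by simp
next
  case (Cons i js)
  then have i: "i < n" and js: "js \<in> lists {..<n}" by auto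
  have cl: "iter_partial E f js x \<in> carrier E" if "smooth_on n V E f" "x \<in> V" for f x
  proof -
    have "continuous_map (subtopology (Euclidean_space n) V) (topo E) (iter_partial E f js)"
      using that js unfolding smooth_on_def by blast
    moreover have "x \<in> topspace (subtopology (Euclidean_space n) V)" using that V openin_subset by fastforce
    ultimately show ?thesis using continuous_map_in_topspace topspace_topo by metis
  qed
  have lin: "cont_linear E E (\<lambda>x. of_real c \<odot> x)" for c
    unfolding cont_linear_def
    by (auto intro!: continuous_map_smult simp: smult_add_right smult_smult mult_ac)
  have ev: "\<forall>\<^sub>F h in nhds 0. x(i := x i + h) \<in> V" using eventually_upd_in_openin[OF V Cons.prems(2) i] .
  have d: "has_curve_deriv E (\<lambda>h. iter_partial E f js (x(i := x i + h))) (iter_partial E f (i # js) x)"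
    if f: "smooth_on n V E f" for f
  proof -
    obtain d where "has_curve_deriv E (\<lambda>h. iter_partial E f js (x(i := x i + h))) d"
      using f js i Cons.prems(2) unfolding smooth_on_def by blast
    then show ?thesis using curve_deriv_eq by simp
  qed
  have evc: "\<forall>\<^sub>F h in nhds 0. iter_partial E f js (x(i := x i + h)) \<in> carrier E" if "smooth_on n V E f" for f
    using ev by eventually_elim (rule cl[OF that])
  have evc': "\<forall>\<^sub>F h in nhds 0. of_real c \<odot> iter_partial E f js (x(i := x i + h)) \<in> carrier E" if "smooth_on n V E f" for f c
    using evc[OF that] by eventually_elim simp
  have "has_curve_deriv E (\<lambda>h. of_real a \<odot> iter_partial E f js (x(i := x i + h)) \<oplus> of_real b \<odot> iter_partial E g js (x(i := x i + h)))
     (of_real a \<odot> iter_partial E f (i # js) x \<oplus> of_real b \<odot> iter_partial E g (i # js) x)"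
    by (intro has_curve_deriv_add has_curve_deriv_linear[OF E E lin] d evc evc' f g)
  moreover have "\<forall>\<^sub>F h in nhds 0. of_real a \<odot> iter_partial E f js (x(i := x i + h)) \<oplus> of_real b \<odot> iter_partial E g js (x(i := x i + h)) = iter_partial E k js (x(i := x i + h))"
    using ev by eventually_elim (use Cons.IH js in auto)
  ultimately have "has_curve_deriv E (\<lambda>h. iter_partial E k js (x(i := x i + h)))
     (of_real a \<odot> iter_partial E f (i # js) x \<oplus> of_real b \<odot> iter_partial E g (i # js) x)"
    by (rule has_curve_deriv_cong[rotated])
  from curve_deriv_eq[OF this] show ?case by simp
qed

text \<open>Closure under the operations is the case of a one-point parameter space, their
  continuity the case of the arguments as parameters. The Hausdorff property comes from evaluations
  at points, local convexity from an induction over the generated topology.\<close>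

lemma lc_algebra_smooth_algebra:
  assumes X: "euclidean_charts X"
  shows "lc_algebra (smooth_algebra X E)"
proof (rule lc_algebra.intro)
  let ?B = "smooth_algebra X E" and ?SF = "smooth_functions X E" and ?T = "smooth_compact_open X E"
  let ?one = "discrete_topology {()}"
  note sf = smooth_functions_imp_psmooth_fun[where Z = "?one"]
  note rs = restrict_psmooth_fun(2)[OF X E, where Z = "?one" and z = "()"]
  note ext = smooth_functions_ext
  note cl = smooth_functions_closed[where X = X and E = E]
  note lcs = lc_algebra_scalar_algebra
  have add: "(\<lambda>p\<in>points X. f p \<oplus> g p) \<in> ?SF" if "f \<in> ?SF" "g \<in> ?SF" for f g
    using rs[OF psmooth_fun_add[OF X E sf sf]] that by simp
  have mult: "(\<lambda>p\<in>points X. f p \<otimes> g p) \<in> ?SF" if "f \<in> ?SF" "g \<in> ?SF" for f g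
    using rs[OF psmooth_fun_bilinear[OF X E E E cont_bilinear_mult sf sf]] that by simp
  have const: "(\<lambda>p\<in>points X. a) \<in> ?SF" if "a \<in> carrier E" for a
    using rs[OF psmooth_fun_const[OF X E that]] by simp
  have smult: "(\<lambda>p\<in>points X. c \<odot> f p) \<in> ?SF" if "f \<in> ?SF" for c f
    using rs[OF psmooth_fun_bilinear[OF X lcs E E cont_bilinear_smult psmooth_fun_const[OF X lcs] sf]] that by simp
  have abel: "abelian_group ?B"
  proof (rule abelian_groupI)
    show "\<exists>g\<in>carrier ?B. g \<oplus>\<^bsub>?B\<^esub> f = \<zero>\<^bsub>?B\<^esub>" if f: "f \<in> carrier ?B" for f
    proof (rule bexI[of _ "\<lambda>p\<in>points X. (- 1) \<odot> f p"])
      show "(\<lambda>p\<in>points X. (- 1) \<odot> f p) \<in> carrier ?B" using f smult by simp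
      show "(\<lambda>p\<in>points X. (- 1) \<odot> f p) \<oplus>\<^bsub>?B\<^esub> f = \<zero>\<^bsub>?B\<^esub>"
        using f by (auto intro!: restrict_ext simp: smult_minus_1 l_neg cl)
    qed
    show "\<zero>\<^bsub>?B\<^esub> \<oplus>\<^bsub>?B\<^esub> f = f" if "f \<in> carrier ?B" for f
      unfolding smooth_algebra_simps scalar_algebra_simps
      by (rule restrict_eq_smooth_function) (use that in \<open>auto simp: cl\<close>)
  qed (auto intro!: add const restrict_ext simp: a_ac cl)
  have mon: "monoid ?B"
  proof (rule monoidI)
    fix f assume f: "f \<in> carrier ?B"
    show "\<one>\<^bsub>?B\<^esub> \<otimes>\<^bsub>?B\<^esub> f = f"
      unfolding smooth_algebra_simps by (rule restrict_eq_smooth_function) (use f in \<open>auto simp: cl\<close>)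
    show "f \<otimes>\<^bsub>?B\<^esub> \<one>\<^bsub>?B\<^esub> = f"
      unfolding smooth_algebra_simps by (rule restrict_eq_smooth_function) (use f in \<open>auto simp: cl\<close>)
  qed (auto intro!: mult const restrict_ext simp: m_assoc cl)
  show "ring ?B"
    by (rule ringI[OF abel mon]) (auto intro!: restrict_ext simp: l_distr r_distr cl)
  show "module (scalar_algebra :: ('k, 'k) top_algebra) ?B"
  proof (rule moduleI[OF cring_scalar_algebra abel])
    show "\<one>\<^bsub>(scalar_algebra :: ('k, 'k) top_algebra)\<^esub> \<odot>\<^bsub>?B\<^esub> f = f" if "f \<in> carrier ?B" for f
      unfolding smooth_algebra_simps scalar_algebra_simps
      by (rule restrict_eq_smooth_function) (use that in \<open>auto simp: cl\<close>)
  qed (auto intro!: smult restrict_ext simp: smult_add_left smult_add_right smult_smult cl)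
  show "(c \<odot>\<^bsub>?B\<^esub> f) \<otimes>\<^bsub>?B\<^esub> g = c \<odot>\<^bsub>?B\<^esub> (f \<otimes>\<^bsub>?B\<^esub> g)" if "f \<in> carrier ?B" "g \<in> carrier ?B" for c f g
    using that by (auto intro!: restrict_ext simp: smult_mult_left cl)
  show "f \<otimes>\<^bsub>?B\<^esub> (c \<odot>\<^bsub>?B\<^esub> g) = c \<odot>\<^bsub>?B\<^esub> (f \<otimes>\<^bsub>?B\<^esub> g)" if "f \<in> carrier ?B" "g \<in> carrier ?B" for c f g
    using that by (auto intro!: restrict_ext simp: smult_mult_right cl)
  show "topspace (topo ?B) = carrier ?B" by (simp add: topspace_smooth_compact_open)
  note ev = psmooth_fun_smooth_compact_open[OF X E]
  note evf = psmooth_fun_reparam[OF ev continuous_map_fst[of ?T ?T]] and evs = psmooth_fun_reparam[OF ev continuous_map_snd[of ?T ?T]]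
  show "continuous_map (prod_topology (topo ?B) (topo ?B)) (topo ?B) (\<lambda>(f, g). f \<oplus>\<^bsub>?B\<^esub> g)"
    unfolding case_prod_unfold smooth_algebra_simps
    by (rule continuous_map_smooth_compact_open[OF X E restrict_psmooth_fun(1)[OF X E psmooth_fun_add[OF X E evf evs]]]) simp
  show "continuous_map (prod_topology (topo ?B) (topo ?B)) (topo ?B) (\<lambda>(f, g). f \<otimes>\<^bsub>?B\<^esub> g)"
    unfolding case_prod_unfold smooth_algebra_simps
    by (rule continuous_map_smooth_compact_open[OF X E restrict_psmooth_fun(1)[OF X E psmooth_fun_bilinear[OF X E E E cont_bilinear_mult evf evs]]]) simp
  have pc: "psmooth_fun (prod_topology (euclidean :: 'k topology) ?T) X scalar_algebra (\<lambda>z p. fst z)"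
    by (rule psmooth_fun_param[OF X lcs]) (use continuous_map_fst in simp)
  show "continuous_map (prod_topology euclidean (topo ?B)) (topo ?B) (\<lambda>(c, f). c \<odot>\<^bsub>?B\<^esub> f)"
    unfolding case_prod_unfold smooth_algebra_simps
    by (rule continuous_map_smooth_compact_open[OF X E restrict_psmooth_fun(1)[OF X E
          psmooth_fun_bilinear[OF X lcs E E cont_bilinear_smult pc psmooth_fun_reparam[OF ev continuous_map_snd]]]]) simp
  \<comment> \<open>The case of no derivatives in the evaluation law, with the chart coordinates of
    \<open>p\<close> held fixed.\<close>
  have eval: "continuous_map ?T (topo E) (\<lambda>f. f p)" if pX: "p \<in> points X" for p
  proof -
    obtain U \<phi> where c: "(U, \<phi>) \<in> charts X" "p \<in> U" by (rule chart_cover[OF X pX])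
    let ?S = "subtopology (Euclidean_space (mdim X)) (\<phi> ` U)"
    have ps: "psmooth ?T (mdim X) (\<phi> ` U) E (\<lambda>f x. f (inv_into U \<phi> x))"
      using ev c(1) unfolding psmooth_fun_def by auto
    have "\<phi> p \<in> topspace ?S" using c openin_subset[OF chart_openin[OF X c(1)]] by auto
    then have "continuous_map ?T (prod_topology ?T ?S) (\<lambda>f. (f, \<phi> p))"
      by (intro continuous_map_pairedI) auto
    from continuous_map_compose[OF this psmooth_continuous[OF ps]]
    show ?thesis using c chart_inj[OF X c(1)] by (simp add: o_def)
  qed
  show "Hausdorff_space (topo ?B)"
    unfolding Hausdorff_space_def
  proof (intro allI impI)
    fix f g assume fg: "f \<in> topspace (topo ?B) \<and> g \<in> topspace (topo ?B) \<and> f \<noteq> g"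
    then obtain p where p: "p \<in> points X" "f p \<noteq> g p"
      using ext[of f X E g] by (auto simp: topspace_smooth_compact_open)
    have "f p \<in> topspace (topo E)" "g p \<in> topspace (topo E)"
      using fg p cl topspace_topo by (auto simp: topspace_smooth_compact_open)
    then obtain U V where UV: "openin (topo E) U" "openin (topo E) V" "f p \<in> U" "g p \<in> V" "disjnt U V"
      using hausdorff p(2) unfolding Hausdorff_space_def by blast
    show "\<exists>U V. openin (topo ?B) U \<and> openin (topo ?B) V \<and> f \<in> U \<and> g \<in> V \<and> disjnt U V"
      using openin_continuous_map_preimage[OF eval[OF p(1)] UV(1)] openin_continuous_map_preimage[OF eval[OF p(1)] UV(2)] UV(3-5) fg
      by (intro exI[of _ "{f \<in> topspace ?T. f p \<in> U}"] exI[of _ "{f \<in> topspace ?T. f p \<in> V}"]) (auto simp: disjnt_def)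
  qed
  have conv: "convex_in ?B ?SF" unfolding convex_in_def smooth_algebra_simps by (intro ballI allI impI add smult)
  have opSF: "openin ?T ?SF" using openin_topspace[of ?T] by (simp add: topspace_smooth_compact_open)
  have z: "(\<lambda>p\<in>points X. \<zero>) \<in> ?SF" using const by simp
  fix U assume U: "openin (topo ?B) U" and 0: "\<zero>\<^bsub>?B\<^esub> \<in> U"
  let ?G = "insert ?SF {{f \<in> ?SF. iter_partial E (f \<circ> inv_into U \<phi>) js ` K \<subseteq> W} | U \<phi> js K W.
          (U, \<phi>) \<in> charts X \<and> js \<in> lists {..<mdim X} \<and>
          compactin (Euclidean_space (mdim X)) K \<and> K \<subseteq> \<phi> ` U \<and> openin (topo E) W}"
  have "openin ?T U" using U by simp
  then have "generate_topology_on ?G U"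
    unfolding smooth_compact_open_def by (rule openin_topology_generated_by)
  \<comment> \<open>Stated as an implication, because the sets met in the induction over the
    generated topology need not contain zero.\<close>
  then have "\<zero>\<^bsub>?B\<^esub> \<in> U \<longrightarrow> (\<exists>V. openin ?T V \<and> \<zero>\<^bsub>?B\<^esub> \<in> V \<and> V \<subseteq> U \<and> convex_in ?B V)"
  proof induction
    case Empty then show ?case by simp
  next
    case (Int a b)
    show ?case
    proof
      assume "\<zero>\<^bsub>?B\<^esub> \<in> a \<inter> b"
      then obtain V V' where V: "openin ?T V" "\<zero>\<^bsub>?B\<^esub> \<in> V" "V \<subseteq> a" "convex_in ?B V"
        "openin ?T V'" "\<zero>\<^bsub>?B\<^esub> \<in> V'" "V' \<subseteq> b" "convex_in ?B V'" using Int by blast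
      then have "convex_in ?B (V \<inter> V')" unfolding convex_in_def by blast
      then show "\<exists>V. openin ?T V \<and> \<zero>\<^bsub>?B\<^esub> \<in> V \<and> V \<subseteq> a \<inter> b \<and> convex_in ?B V"
        using V by (intro exI[of _ "V \<inter> V'"] conjI openin_Int) blast+
    qed
  next
    case (UN K)
    show ?case
    proof
      assume "\<zero>\<^bsub>?B\<^esub> \<in> \<Union>K"
      then obtain k where k: "k \<in> K" "\<zero>\<^bsub>?B\<^esub> \<in> k" by auto
      then obtain V where "openin ?T V" "\<zero>\<^bsub>?B\<^esub> \<in> V" "V \<subseteq> k" "convex_in ?B V" using UN.IH[OF k(1)] k(2) by blast
      then show "\<exists>V. openin ?T V \<and> \<zero>\<^bsub>?B\<^esub> \<in> V \<and> V \<subseteq> \<Union>K \<and> convex_in ?B V"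
        using k(1) by (intro exI[of _ V] conjI) blast+
    qed
  next
    case (Basis s)
    show ?case
    proof
      assume 0: "\<zero>\<^bsub>?B\<^esub> \<in> s"
      from Basis consider "s = ?SF" | U \<phi> js K W where "s = {f \<in> ?SF. iter_partial E (f \<circ> inv_into U \<phi>) js ` K \<subseteq> W}"
          "(U, \<phi>) \<in> charts X" "js \<in> lists {..<mdim X}" "compactin (Euclidean_space (mdim X)) K" "K \<subseteq> \<phi> ` U" "openin (topo E) W" by blast
      then show "\<exists>V. openin ?T V \<and> \<zero>\<^bsub>?B\<^esub> \<in> V \<and> V \<subseteq> s \<and> convex_in ?B V"
      proof cases
        case 1
        then show ?thesis using opSF conv z by (intro exI[of _ ?SF]) simp
      next
        case (2 U \<phi> js K W)
        let ?D = "\<lambda>f. iter_partial E (f \<circ> inv_into U \<phi>) js"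
        have so: "smooth_on (mdim X) (\<phi> ` U) E (f \<circ> inv_into U \<phi>)" if "f \<in> ?SF" for f
          using that 2(2) unfolding smooth_functions_def by blast
        note V = chart_openin[OF X 2(2)]
        have Dcl: "?D f x \<in> carrier E" if "f \<in> ?SF" "x \<in> \<phi> ` U" for f x
        proof -
          have "continuous_map (subtopology (Euclidean_space (mdim X)) (\<phi> ` U)) (topo E) (?D f)"
            using so[OF that(1)] 2(3) unfolding smooth_on_def by blast
          moreover have "x \<in> topspace (subtopology (Euclidean_space (mdim X)) (\<phi> ` U))" using that V openin_subset by fastforce
          ultimately show ?thesis using continuous_map_in_topspace topspace_topo by metis
        qed
        have lin: "?D (\<lambda>p\<in>points X. of_real a \<odot> f p \<oplus> of_real b \<odot> g p) x = of_real a \<odot> ?D f x \<oplus> of_real b \<odot> ?D g x"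
          if "f \<in> ?SF" "g \<in> ?SF" "x \<in> \<phi> ` U" for f g a b x
          by (rule iter_partial_lincomb[OF V so[OF that(1)] so[OF that(2)] 2(3) that(3)])
             (use inv_chart_in[OF X 2(2)] in auto)
        have D0: "?D (\<lambda>p\<in>points X. \<zero>) x = \<zero>" if "x \<in> \<phi> ` U" for x
        proof -
          \<comment> \<open>The zero function is a combination of itself with both coefficients 0,
            so linearity gives its derivatives.\<close>
          have "(\<lambda>p\<in>points X. of_real 0 \<odot> (\<lambda>p\<in>points X. \<zero>) p \<oplus> of_real 0 \<odot> (\<lambda>p\<in>points X. \<zero>) p) = (\<lambda>p\<in>points X. \<zero>)"
            by (rule restrict_ext) simp
          then show ?thesis using lin[OF z z that, of 0 0] Dcl[OF z that] by simp
        qed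
        \<comment> \<open>For empty \<open>K\<close> the basic set imposes nothing and
          \<open>W\<close> need not contain zero; the whole carrier is taken then.\<close>
        have "\<exists>W'. openin (topo E) W' \<and> W' \<subseteq> carrier E \<and> convex_in E W' \<and> \<zero> \<in> W' \<and> (K = {} \<or> W' \<subseteq> W)"
        proof (cases "K = {}")
          case True
          have "openin (topo E) (carrier E)" using openin_topspace[of "topo E"] topspace_topo by simp
          moreover have "convex_in E (carrier E)" unfolding convex_in_def by auto
          ultimately show ?thesis using True by blast
        next
          case False
          then obtain x where x: "x \<in> K" by blast
          then have "?D (\<lambda>p\<in>points X. \<zero>) x \<in> W" using 0 2(1) by auto
          then have "\<zero> \<in> W" using D0[of x] x 2(5) by auto
          then obtain W' where W': "openin (topo E) W'" "\<zero> \<in> W'" "W' \<subseteq> W" "convex_in E W'"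
            using locally_convex[OF 2(6)] by blast
          moreover have "W' \<subseteq> carrier E" using W'(1) openin_subset topspace_topo by blast
          ultimately show ?thesis by blast
        qed
        then obtain W' where W': "openin (topo E) W'" "W' \<subseteq> carrier E" "convex_in E W'" "\<zero> \<in> W'" "K = {} \<or> W' \<subseteq> W" by blast
        let ?V = "{f \<in> ?SF. ?D f ` K \<subseteq> W'}"
        have "openin ?T ?V"
          unfolding smooth_compact_open_def
          by (rule topology_generated_by_Basis) (use 2 W' in blast)
        moreover have "\<zero>\<^bsub>?B\<^esub> \<in> ?V" using z D0 2(5) W'(4) by auto
        moreover have "?V \<subseteq> s" using W'(5) unfolding 2(1) by auto
        moreover have "convex_in ?B ?V"
          unfolding convex_in_def
        proof (intro ballI allI impI)
          fix f g t assume f: "f \<in> ?V" and g: "g \<in> ?V" and t: "0 \<le> (t::real) \<and> t \<le> 1"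
          have fg: "f \<in> ?SF" "g \<in> ?SF" using f g by auto
          let ?c = "of_real (1 - t) \<odot>\<^bsub>?B\<^esub> f \<oplus>\<^bsub>?B\<^esub> of_real t \<odot>\<^bsub>?B\<^esub> g"
          have c: "?c = (\<lambda>p\<in>points X. of_real (1 - t) \<odot> f p \<oplus> of_real t \<odot> g p)"
            unfolding smooth_algebra_simps by (rule restrict_ext) simp
          have "?c \<in> ?SF" using fg unfolding smooth_algebra_simps by (intro add smult)
          moreover have "?D ?c x \<in> W'" if x: "x \<in> K" for x
          proof -
            have "?D f x \<in> W'" "?D g x \<in> W'" using f g x by auto
            then have "of_real (1 - t) \<odot> ?D f x \<oplus> of_real t \<odot> ?D g x \<in> W'"
              using W'(3) t unfolding convex_in_def by blast
            then show ?thesis unfolding c lin[OF fg subsetD[OF 2(5) x]] .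
          qed
          ultimately show "?c \<in> ?V" unfolding mem_Collect_eq image_subset_iff by (intro conjI ballI)
        qed
        ultimately show ?thesis by blast
      qed
    qed
  qed
  from this[THEN mp, OF 0] show "\<exists>V. openin (topo ?B) V \<and> \<zero>\<^bsub>?B\<^esub> \<in> V \<and> V \<subseteq> U \<and> convex_in ?B V"
    unfolding smooth_algebra_simps .
qed

end

section \<open>Quotients by closed ideals\<close>

text \<open>Products of quotient maps need not be quotient maps, but open surjections allow boxes to
  be pushed forward. This is how the binary operations of a quotient algebra become
  continuous.\<close>

lemma continuous_map_prod_open_surj:
  assumes p1: "open_map X1 Y1 p1" "p1 ` topspace X1 = topspace Y1"
    and p2: "open_map X2 Y2 p2" "p2 ` topspace X2 = topspace Y2"
    and h: "continuous_map (prod_topology X1 X2) T (\<lambda>z. g (p1 (fst z)) (p2 (snd z)))"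
  shows "continuous_map (prod_topology Y1 Y2) T (\<lambda>(a, b). g a b)"
  unfolding continuous_map_def
proof (intro conjI allI impI)
  show "(\<lambda>(a, b). g a b) \<in> topspace (prod_topology Y1 Y2) \<rightarrow> topspace T"
  proof
    fix z assume "z \<in> topspace (prod_topology Y1 Y2)"
    then have "fst z \<in> p1 ` topspace X1" "snd z \<in> p2 ` topspace X2" unfolding p1(2) p2(2) by auto
    then obtain x1 x2 where "x1 \<in> topspace X1" "x2 \<in> topspace X2" "z = (p1 x1, p2 x2)"
      by (auto simp: prod_eq_iff)
    then show "(\<lambda>(a, b). g a b) z \<in> topspace T" using continuous_map_in_topspace[OF h, of "(x1, x2)"] by simp
  qed
  fix W assume W: "openin T W"
  let ?S = "{z \<in> topspace (prod_topology Y1 Y2). (\<lambda>(a, b). g a b) z \<in> W}"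
  show "openin (prod_topology Y1 Y2) ?S"
    unfolding openin_prod_topology_alt
  proof (intro allI impI)
    fix a b assume ab: "(a, b) \<in> ?S"
    then have "a \<in> p1 ` topspace X1" "b \<in> p2 ` topspace X2" using p1(2) p2(2) by auto
    then obtain x1 x2 where x: "x1 \<in> topspace X1" "x2 \<in> topspace X2" "a = p1 x1" "b = p2 x2" by blast
    let ?R = "{z \<in> topspace (prod_topology X1 X2). g (p1 (fst z)) (p2 (snd z)) \<in> W}"
    have "openin (prod_topology X1 X2) ?R" using h W by (rule openin_continuous_map_preimage)
    moreover have "(x1, x2) \<in> ?R" using x ab by simp
    ultimately obtain U V where UV: "openin X1 U" "openin X2 V" "x1 \<in> U" "x2 \<in> V" "U \<times> V \<subseteq> ?R"
      by (rule openin_prod_topologyE)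
    have "openin Y1 (p1 ` U)" "openin Y2 (p2 ` V)" using p1(1) p2(1) UV(1,2) unfolding open_map_def by auto
    moreover have "p1 ` U \<times> p2 ` V \<subseteq> ?S"
    proof
      fix z assume "z \<in> p1 ` U \<times> p2 ` V"
      then obtain u v where uv: "u \<in> U" "v \<in> V" "z = (p1 u, p2 v)" by blast
      then have "(u, v) \<in> ?R" using UV(5) by blast
      then show "z \<in> ?S" using uv p1(2) p2(2) by auto
    qed
    ultimately show "\<exists>U V. openin Y1 U \<and> openin Y2 V \<and> a \<in> U \<and> b \<in> V \<and> U \<times> V \<subseteq> ?S"
      using x UV(3,4) by blast
  qed
qed

text \<open>Each ring operation is continuous and maps \<open>J\<close> into itself, hence also its
  closure; for sums of two limit points the closure of \<open>J \<times> J\<close> is used.\<close>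

lemma (in lc_algebra) ideal_closure_of:
  assumes "ideal J A"
  shows "ideal (topo A closure_of J) A"
proof -
  interpret J: ideal J A by (rule assms)
  let ?C = "topo A closure_of J"
  have JC: "J \<subseteq> ?C" by (rule closure_of_subset) (use J.a_subset topspace_topo in simp)
  have un: "f x \<in> ?C" if "continuous_map (topo A) (topo A) f" "\<And>y. y \<in> J \<Longrightarrow> f y \<in> J" "x \<in> ?C" for f x
  proof -
    have "f x \<in> topo A closure_of f ` J" using continuous_map_image_closure_subset[OF that(1)] that(3) by blast
    moreover have "f ` J \<subseteq> J" using that(2) by auto
    ultimately show ?thesis using closure_of_mono by blast
  qed
  have add: "x \<oplus> y \<in> ?C" if "x \<in> ?C" "y \<in> ?C" for x y
  proof -
    have "(\<lambda>(a, b). a \<oplus> b) ` (prod_topology (topo A) (topo A) closure_of (J \<times> J)) \<subseteq> topo A closure_of (\<lambda>(a, b). a \<oplus> b) ` (J \<times> J)"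
      by (rule continuous_map_image_closure_subset[OF continuous_add])
    then have "x \<oplus> y \<in> topo A closure_of (\<lambda>(a, b). a \<oplus> b) ` (J \<times> J)"
      using that unfolding closure_of_Times by (auto simp: image_subset_iff)
    moreover have "(\<lambda>(a, b). a \<oplus> b) ` (J \<times> J) \<subseteq> J" by auto
    ultimately show ?thesis using closure_of_mono by blast
  qed
  show ?thesis
  proof (rule idealI[OF ring])
    show "subgroup ?C (add_monoid A)"
    proof (rule add.subgroupI)
      show "?C \<subseteq> carrier A" using closure_of_subset_topspace topspace_topo by metis
      show "?C \<noteq> {}" using JC J.zero_closed by blast
      show "\<ominus> x \<in> ?C" if "x \<in> ?C" for x
        by (rule un[OF continuous_map_minus _ that]) auto
    qed (use add in simp)
    show "a \<otimes> x \<in> ?C" if "x \<in> ?C" "a \<in> carrier A" for a x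
      by (rule un[OF continuous_map_mult[OF continuous_map_const_A] _ that(1)]) (use that J.I_l_closed in auto)
    show "x \<otimes> a \<in> ?C" if "x \<in> ?C" "a \<in> carrier A" for a x
      by (rule un[OF continuous_map_mult[OF _ continuous_map_const_A] _ that(1)]) (use that J.I_r_closed in auto)
  qed
qed

locale lc_closed_ideal = lc_algebra A + ideal I A
  for A :: "('k::real_normed_field, 'a) top_algebra" (structure) and I +
  assumes closed: "closedin (topo A) I"
begin

abbreviation Q where "Q \<equiv> quotient_algebra A I"

lemma carrier_Q: "carrier Q = (\<lambda>x. I +> x) ` carrier A"
  by (auto simp: quotient_algebra_def FactRing_def A_RCOSETS_def')

lemma add_Q: "x \<in> carrier A \<Longrightarrow> y \<in> carrier A \<Longrightarrow> (I +> x) \<oplus>\<^bsub>Q\<^esub> (I +> y) = I +> (x \<oplus> y)"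
  by (simp add: quotient_algebra_def FactRing_def a_rcos_sum)

lemma mult_Q: "x \<in> carrier A \<Longrightarrow> y \<in> carrier A \<Longrightarrow> (I +> x) \<otimes>\<^bsub>Q\<^esub> (I +> y) = I +> (x \<otimes> y)"
  by (simp add: quotient_algebra_def FactRing_def rcoset_mult_add)

lemma one_Q: "\<one>\<^bsub>Q\<^esub> = I +> \<one>"
  by (simp add: quotient_algebra_def FactRing_def)

lemma coset_eq_iff: "x \<in> carrier A \<Longrightarrow> y \<in> carrier A \<Longrightarrow> I +> x = I +> y \<longleftrightarrow> x \<ominus> y \<in> I"
  using quotient_eq_iff_same_a_r_cos[OF is_ideal] by simp

lemma zero_Q: "\<zero>\<^bsub>Q\<^esub> = I +> \<zero>"
proof -
  have "I = I +> \<zero>" using a_rcos_zero[OF is_ideal zero_closed] by simp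
  then show ?thesis by (simp add: quotient_algebra_def FactRing_def)
qed

text \<open>The scalar multiplication of the quotient and the localized action are defined as unions
  over representatives; compatibility of \<open>f\<close> with \<open>I\<close> makes all cosets in
  the union equal.\<close>

lemma coset_UN:
  assumes x: "x \<in> carrier A" and f: "\<And>y. y \<in> carrier A \<Longrightarrow> f y \<in> carrier A"
    and I: "\<And>y. y \<in> carrier A \<Longrightarrow> y \<ominus> x \<in> I \<Longrightarrow> f y \<ominus> f x \<in> I"
  shows "(\<Union>y\<in>I +> x. I +> f y) = I +> f x"
proof -
  have "I +> f y = I +> f x" if "y \<in> I +> x" for y
  proof -
    have y: "y \<in> carrier A" using that x a_subset a_r_coset_subset_G by blast
    have "I +> y = I +> x" using a_repr_independence[OF that x a_subgroup] by simp
    then have "y \<ominus> x \<in> I" using coset_eq_iff x y by blast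
    then show ?thesis using coset_eq_iff f x y I by blast
  qed
  moreover have "x \<in> I +> x" using x by (rule a_rcos_self)
  ultimately show ?thesis by blast
qed

text \<open>\<open>ideal\<close> is a notion for rings, but a scalar \<open>c\<close> acts as
  multiplication by \<open>c \<odot> \<one>\<close>.\<close>

lemma smult_in_I: "i \<in> I \<Longrightarrow> c \<odot> i \<in> I"
proof -
  assume i: "i \<in> I"
  then have ic: "i \<in> carrier A" by (rule Icarr)
  have "(c \<odot> \<one>) \<otimes> i \<in> I" using i by (intro I_l_closed) auto
  then show ?thesis using ic by (simp add: smult_mult_left)
qed

lemma smult_Q: "x \<in> carrier A \<Longrightarrow> c \<odot>\<^bsub>Q\<^esub> (I +> x) = I +> (c \<odot> x)"
  unfolding quotient_algebra_def
  by simp (rule coset_UN, auto simp: smult_diff_right[symmetric] intro: smult_in_I)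

text \<open>The definition through \<open>topology\<close> can be unfolded only once its predicate
  is shown to satisfy \<open>istopology\<close>.\<close>

lemma openin_Q: "openin (topo Q) W \<longleftrightarrow> W \<subseteq> carrier Q \<and> openin (topo A) {x \<in> carrier A. I +> x \<in> W}"
proof -
  have cQ: "carrier Q = carrier (A Quot I)" by (simp add: quotient_algebra_def)
  have "istopology (\<lambda>W. W \<subseteq> carrier (A Quot I) \<and> openin (topo A) {x \<in> carrier A. I +> x \<in> W})"
    unfolding istopology_def
  proof (intro conjI allI impI)
    fix S T assume "S \<subseteq> carrier (A Quot I) \<and> openin (topo A) {x \<in> carrier A. I +> x \<in> S}"
      "T \<subseteq> carrier (A Quot I) \<and> openin (topo A) {x \<in> carrier A. I +> x \<in> T}"
    moreover have "{x \<in> carrier A. I +> x \<in> S \<inter> T} = {x \<in> carrier A. I +> x \<in> S} \<inter> {x \<in> carrier A. I +> x \<in> T}" by auto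
    ultimately show "S \<inter> T \<subseteq> carrier (A Quot I)" "openin (topo A) {x \<in> carrier A. I +> x \<in> S \<inter> T}" by auto
  next
    fix \<K> assume K: "\<forall>K\<in>\<K>. K \<subseteq> carrier (A Quot I) \<and> openin (topo A) {x \<in> carrier A. I +> x \<in> K}"
    then show "\<Union>\<K> \<subseteq> carrier (A Quot I)" by blast
    have "{x \<in> carrier A. I +> x \<in> \<Union>\<K>} = (\<Union>K\<in>\<K>. {x \<in> carrier A. I +> x \<in> K})" by auto
    then show "openin (topo A) {x \<in> carrier A. I +> x \<in> \<Union>\<K>}" using K by auto
  qed
  then show ?thesis unfolding cQ by (simp add: quotient_algebra_def)
qed

lemma topspace_Q: "topspace (topo Q) = carrier Q"
proof -
  have "{x \<in> carrier A. I +> x \<in> carrier Q} = topspace (topo A)" unfolding carrier_Q topspace_topo by auto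
  then have "openin (topo Q) (carrier Q)" unfolding openin_Q by simp
  then show ?thesis using openin_subset openin_topspace openin_Q by (metis subset_antisym)
qed

lemma continuous_map_coset: "continuous_map (topo A) (topo Q) (\<lambda>x. I +> x)"
  unfolding continuous_map_def topspace_Q carrier_Q topspace_topo
  by (auto simp: openin_Q)

text \<open>The preimage of the image of an open set is the union of its translates by elements of
  \<open>I\<close>.\<close>

lemma open_map_coset: "open_map (topo A) (topo Q) (\<lambda>x. I +> x)"
  unfolding open_map_def
proof (intro allI impI)
  fix U assume U: "openin (topo A) U"
  then have Uc: "U \<subseteq> carrier A" using openin_subset topspace_topo by blast
  have eq: "{x \<in> carrier A. I +> x \<in> (\<lambda>x. I +> x) ` U} = (\<Union>i\<in>I. {x \<in> topspace (topo A). i \<oplus> x \<in> U})"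
  proof safe
    fix x u assume x: "x \<in> carrier A" and u: "u \<in> U" and eq: "I +> x = I +> u"
    have uc: "u \<in> carrier A" using u Uc by blast
    have "u \<ominus> x \<in> I" using coset_eq_iff[OF uc x] eq by simp
    moreover have "(u \<ominus> x) \<oplus> x = u" using x uc by (simp add: a_minus_def a_assoc l_neg)
    ultimately show "x \<in> (\<Union>i\<in>I. {x \<in> topspace (topo A). i \<oplus> x \<in> U})" using x u topspace_topo by (intro UN_I[of "u \<ominus> x"]) auto
  next
    fix i x assume i: "i \<in> I" and x: "x \<in> topspace (topo A)" and u: "i \<oplus> x \<in> U"
    show xc: "x \<in> carrier A" using x topspace_topo by simp
    have ic: "i \<in> carrier A" using i by (rule Icarr)
    have "(i \<oplus> x) \<ominus> x = i" using xc ic by (simp add: a_minus_def a_assoc r_neg)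
    then have "I +> (i \<oplus> x) = I +> x" using coset_eq_iff[of "i \<oplus> x" x] xc ic i by simp
    then show "I +> x \<in> (\<lambda>x. I +> x) ` U" using u by (intro image_eqI[of _ _ "i \<oplus> x"]) auto
  qed
  have "openin (topo A) {x \<in> topspace (topo A). i \<oplus> x \<in> U}" if "i \<in> I" for i
    by (rule openin_continuous_map_preimage[OF continuous_map_add[OF continuous_map_const_A] U]) (use Icarr that in auto)
  then have "openin (topo A) {x \<in> carrier A. I +> x \<in> (\<lambda>x. I +> x) ` U}" unfolding eq by blast
  then show "openin (topo Q) ((\<lambda>x. I +> x) ` U)" unfolding openin_Q carrier_Q using Uc by blast
qed

lemma lc_algebra_quotient: "lc_algebra Q"
proof (rule lc_algebra.intro)
  have surj: "(\<lambda>x. I +> x) ` topspace (topo A) = topspace (topo Q)" unfolding topspace_Q carrier_Q topspace_topo ..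
  have abel: "abelian_group Q"
  proof (rule abelian_groupI)
    fix X assume "X \<in> carrier Q"
    then obtain x where x: "X = I +> x" "x \<in> carrier A" by (auto simp: carrier_Q)
    show "\<exists>Y\<in>carrier Q. Y \<oplus>\<^bsub>Q\<^esub> X = \<zero>\<^bsub>Q\<^esub>"
      using x by (intro bexI[of _ "I +> (\<ominus> x)"]) (auto simp: carrier_Q add_Q zero_Q l_neg)
  qed (auto simp: carrier_Q add_Q zero_Q a_ac)
  have mon: "monoid Q"
    by (rule monoidI) (auto simp: carrier_Q mult_Q one_Q m_assoc)
  show "ring Q"
    by (rule ringI[OF abel mon]) (auto simp: carrier_Q add_Q mult_Q l_distr r_distr)
  show "module (scalar_algebra :: ('k, 'k) top_algebra) Q"
    by (rule moduleI[OF cring_scalar_algebra abel])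
       (auto simp: carrier_Q add_Q smult_Q smult_add_left smult_add_right smult_smult)
  show "(c \<odot>\<^bsub>Q\<^esub> X) \<otimes>\<^bsub>Q\<^esub> Y = c \<odot>\<^bsub>Q\<^esub> (X \<otimes>\<^bsub>Q\<^esub> Y)" if "X \<in> carrier Q" "Y \<in> carrier Q" for c X Y
    using that by (auto simp: carrier_Q mult_Q smult_Q smult_mult_left)
  show "X \<otimes>\<^bsub>Q\<^esub> (c \<odot>\<^bsub>Q\<^esub> Y) = c \<odot>\<^bsub>Q\<^esub> (X \<otimes>\<^bsub>Q\<^esub> Y)" if "X \<in> carrier Q" "Y \<in> carrier Q" for c X Y
    using that by (auto simp: carrier_Q mult_Q smult_Q smult_mult_right)
  show "topspace (topo Q) = carrier Q" by (rule topspace_Q)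
  have cc: "continuous_map X (topo Q) (\<lambda>z. I +> f z)" if "continuous_map X (topo A) f" for X and f :: "'z \<Rightarrow> 'a"
    using continuous_map_compose[OF that continuous_map_coset] by (simp add: o_def)
  show "continuous_map (prod_topology (topo Q) (topo Q)) (topo Q) (\<lambda>(X, Y). X \<oplus>\<^bsub>Q\<^esub> Y)"
  proof (rule continuous_map_prod_open_surj[OF open_map_coset surj open_map_coset surj])
    show "continuous_map (prod_topology (topo A) (topo A)) (topo Q) (\<lambda>z. (I +> fst z) \<oplus>\<^bsub>Q\<^esub> (I +> snd z))"
      by (rule continuous_map_eq[OF cc[OF continuous_map_add[OF continuous_map_fst continuous_map_snd]]])
         (auto simp: add_Q topspace_topo)
  qed
  show "continuous_map (prod_topology (topo Q) (topo Q)) (topo Q) (\<lambda>(X, Y). X \<otimes>\<^bsub>Q\<^esub> Y)"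
  proof (rule continuous_map_prod_open_surj[OF open_map_coset surj open_map_coset surj])
    show "continuous_map (prod_topology (topo A) (topo A)) (topo Q) (\<lambda>z. (I +> fst z) \<otimes>\<^bsub>Q\<^esub> (I +> snd z))"
      by (rule continuous_map_eq[OF cc[OF continuous_map_mult[OF continuous_map_fst continuous_map_snd]]])
         (auto simp: mult_Q topspace_topo)
  qed
  show "continuous_map (prod_topology euclidean (topo Q)) (topo Q) (\<lambda>(c, Y). c \<odot>\<^bsub>Q\<^esub> Y)"
  proof (rule continuous_map_prod_open_surj[OF _ _ open_map_coset surj])
    show "open_map euclidean euclidean (\<lambda>c. c)" by (simp add: open_map_def)
    show "continuous_map (prod_topology euclidean (topo A)) (topo Q) (\<lambda>z. fst z \<odot>\<^bsub>Q\<^esub> (I +> snd z))"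
      by (rule continuous_map_eq[OF cc[OF continuous_map_smult[OF continuous_map_fst continuous_map_snd]]])
         (auto simp: smult_Q topspace_topo)
  qed simp
  show "Hausdorff_space (topo Q)"
    unfolding Hausdorff_space_def topspace_Q
  proof (intro allI impI)
    fix X Y assume XY: "X \<in> carrier Q \<and> Y \<in> carrier Q \<and> X \<noteq> Y"
    then obtain x y where x: "X = I +> x" "x \<in> carrier A" and y: "Y = I +> y" "y \<in> carrier A"
      unfolding carrier_Q by blast
    then have nI: "x \<ominus> y \<notin> I" using coset_eq_iff XY by blast
    \<comment> \<open>Open because \<open>I\<close> is closed; a box inside it has factors with
      disjoint images in the quotient.\<close>
    let ?D = "{z \<in> topspace (prod_topology (topo A) (topo A)). fst z \<ominus> snd z \<in> topspace (topo A) - I}"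
    have "openin (prod_topology (topo A) (topo A)) ?D"
      by (rule openin_continuous_map_preimage[OF continuous_map_diff[OF continuous_map_fst continuous_map_snd]])
         (use closed in \<open>simp add: openin_diff\<close>)
    moreover have "(x, y) \<in> ?D" using x y nI by (simp add: topspace_topo)
    ultimately obtain U V where UV: "openin (topo A) U" "openin (topo A) V" "x \<in> U" "y \<in> V" "U \<times> V \<subseteq> ?D"
      by (rule openin_prod_topologyE)
    have "disjnt ((\<lambda>x. I +> x) ` U) ((\<lambda>x. I +> x) ` V)"
      unfolding disjnt_iff
    proof safe
      fix u v assume u: "u \<in> U" and v: "v \<in> V" and eq: "I +> u = I +> v"
      have "(u, v) \<in> ?D" using UV(5) u v by blast
      then have "u \<in> carrier A" "v \<in> carrier A" "u \<ominus> v \<notin> I" by (auto simp: topspace_topo)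
      then show False using coset_eq_iff eq by blast
    qed
    then show "\<exists>U V. openin (topo Q) U \<and> openin (topo Q) V \<and> X \<in> U \<and> Y \<in> V \<and> disjnt U V"
      using open_map_coset UV(1-4) x(1) y(1) unfolding open_map_def by blast
  qed
  fix W assume W: "openin (topo Q) W" and 0: "\<zero>\<^bsub>Q\<^esub> \<in> W"
  let ?P = "{x \<in> topspace (topo A). I +> x \<in> W}"
  have "openin (topo A) ?P" by (rule openin_continuous_map_preimage[OF continuous_map_coset W])
  moreover have "\<zero> \<in> ?P" using 0 by (simp add: zero_Q topspace_topo)
  ultimately obtain V where V: "openin (topo A) V" "\<zero> \<in> V" "V \<subseteq> ?P" "convex_in A V" using locally_convex by blast
  have Vc: "V \<subseteq> carrier A" using V(1) openin_subset topspace_topo by blast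
  have "convex_in Q ((\<lambda>x. I +> x) ` V)"
    unfolding convex_in_def
  proof (intro ballI allI impI)
    fix X Y t assume "X \<in> (\<lambda>x. I +> x) ` V" "Y \<in> (\<lambda>x. I +> x) ` V" and t: "0 \<le> (t::real) \<and> t \<le> 1"
    then obtain x y where x: "X = I +> x" "x \<in> V" and y: "Y = I +> y" "y \<in> V" by blast
    have xc: "x \<in> carrier A" and yc: "y \<in> carrier A" using x(2) y(2) Vc by auto
    have "of_real (1 - t) \<odot> x \<oplus> of_real t \<odot> y \<in> V" using V(4) x(2) y(2) t unfolding convex_in_def by blast
    moreover have "(of_real (1 - t) \<odot>\<^bsub>Q\<^esub> X) \<oplus>\<^bsub>Q\<^esub> (of_real t \<odot>\<^bsub>Q\<^esub> Y) = I +> (of_real (1 - t) \<odot> x \<oplus> of_real t \<odot> y)"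
      using xc yc x(1) y(1) by (simp add: smult_Q add_Q)
    ultimately show "(of_real (1 - t) \<odot>\<^bsub>Q\<^esub> X) \<oplus>\<^bsub>Q\<^esub> (of_real t \<odot>\<^bsub>Q\<^esub> Y) \<in> (\<lambda>x. I +> x) ` V" by (rule image_eqI[rotated])
  qed
  moreover have "openin (topo Q) ((\<lambda>x. I +> x) ` V)" using open_map_coset V(1) unfolding open_map_def by blast
  moreover have "\<zero>\<^bsub>Q\<^esub> \<in> (\<lambda>x. I +> x) ` V" using V(2) unfolding zero_Q by (rule imageI)
  moreover have "(\<lambda>x. I +> x) ` V \<subseteq> W" using V(3) by blast
  ultimately show "\<exists>V. openin (topo Q) V \<and> \<zero>\<^bsub>Q\<^esub> \<in> V \<and> V \<subseteq> W \<and> convex_in Q V" by blast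
qed

lemma continuous_map_from_Q:
  assumes "continuous_map (topo A) T (\<lambda>x. g (I +> x))"
  shows "continuous_map (topo Q) T g"
  unfolding continuous_map_def
proof (intro conjI allI impI)
  show "g \<in> topspace (topo Q) \<rightarrow> topspace T"
    using continuous_map_in_topspace[OF assms] unfolding topspace_Q carrier_Q topspace_topo by auto
  fix W assume "openin T W"
  then have "openin (topo A) {x \<in> topspace (topo A). g (I +> x) \<in> W}"
    by (rule openin_continuous_map_preimage[OF assms])
  moreover have "{x \<in> carrier A. I +> x \<in> {X \<in> carrier Q. g X \<in> W}} = {x \<in> topspace (topo A). g (I +> x) \<in> W}"
    unfolding topspace_topo carrier_Q by auto
  ultimately show "openin (topo Q) {x \<in> topspace (topo Q). g x \<in> W}"
    unfolding topspace_Q openin_Q by auto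
qed

end

section \<open>Smooth localization\<close>

lemma continuous_map_prod_discrete:
  assumes "\<And>g. g \<in> S \<Longrightarrow> continuous_map X Y (f g)"
  shows "continuous_map (prod_topology (discrete_topology S) X) Y (\<lambda>(g, x). f g x)"
  unfolding continuous_map_def
proof (intro conjI allI impI)
  show "(\<lambda>(g, x). f g x) \<in> topspace (prod_topology (discrete_topology S) X) \<rightarrow> topspace Y"
    using continuous_map_in_topspace[OF assms] by auto
  fix W assume W: "openin Y W"
  have eq: "{p \<in> topspace (prod_topology (discrete_topology S) X). (\<lambda>(g, x). f g x) p \<in> W}
      = (\<Union>g\<in>S. {g} \<times> {x \<in> topspace X. f g x \<in> W})" by auto
  have "openin (prod_topology (discrete_topology S) X) ({g} \<times> {x \<in> topspace X. f g x \<in> W})" if "g \<in> S" for g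
    using that openin_continuous_map_preimage[OF assms[OF that] W] by (simp add: openin_prod_Times_iff)
  then show "openin (prod_topology (discrete_topology S) X) {p \<in> topspace (prod_topology (discrete_topology S) X). (\<lambda>(g, x). f g x) p \<in> W}"
    unfolding eq by blast
qed

text \<open>Constants join the class because they are the derivatives of a coordinate.\<close>

lemma psmooth_coordinate:
  assumes V: "openin (Euclidean_space n) V"
  shows "psmooth Z n V real_algebra (\<lambda>z x. x i)"
proof (rule psmooth_coinduct[OF lc_algebra_scalar_algebra V, where \<F> = "\<lambda>f. f = (\<lambda>z x. x i) \<or> (\<exists>c. f = (\<lambda>z x. c))"])
  fix f :: "'a \<Rightarrow> (nat \<Rightarrow> real) \<Rightarrow> real"
  assume f: "f = (\<lambda>z x. x i) \<or> (\<exists>c. f = (\<lambda>z x. c))"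
  have "continuous_map (prod_topology Z (subtopology (Euclidean_space n) V)) euclideanreal ((\<lambda>x. x i) \<circ> snd)"
    by (rule continuous_map_compose[OF continuous_map_snd])
       (intro continuous_map_from_subtopology continuous_map_Euclidean_coordinate)
  then show "continuous_map (prod_topology Z (subtopology (Euclidean_space n) V)) (topo real_algebra) (\<lambda>p. f (fst p) (snd p))"
    using f by (auto simp: o_def)
  fix j
  show "\<exists>g. (g = (\<lambda>z x. x i) \<or> (\<exists>c. g = (\<lambda>z x. c))) \<and>
      (\<forall>z\<in>topspace Z. \<forall>x\<in>V. has_curve_deriv real_algebra (\<lambda>h. f z (x(j := x j + h))) (g z x))"
    using f
  proof
    assume "f = (\<lambda>z x. x i)"
    then show ?thesis
      by (intro exI[of _ "\<lambda>z x. if i = j then 1 else 0"])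
         (auto simp: has_curve_deriv_real intro!: derivative_eq_intros)
  next
    assume "\<exists>c. f = (\<lambda>z x. c)"
    then show ?thesis
      by (intro exI[of _ "\<lambda>z x. 0"]) (auto simp: has_curve_deriv_real)
  qed
qed simp

lemma points_real_line [simp]: "points real_line = UNIV"
  by (simp add: real_line_def)

lemma psmooth_fun_real_line_ident: "psmooth_fun Z real_line real_algebra (\<lambda>_ t. t)"
proof (rule psmooth_funI)
  fix U \<phi> assume c: "(U, \<phi>) \<in> charts real_line"
  then have U: "U = UNIV" "\<phi> = (\<lambda>t i. if i = 0 then t else 0)" by (auto simp: real_line_def)
  note V = chart_openin[OF euclidean_charts_real_line c]
  have "inv_into U \<phi> x = x 0" if x: "x \<in> \<phi> ` U" for x
  proof -
    obtain t where t: "t \<in> U" "x = \<phi> t" using x by blast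
    then have "inv_into U \<phi> x = t" using chart_inj[OF euclidean_charts_real_line c] by simp
    then show ?thesis using t U by simp
  qed
  then show "psmooth Z (mdim real_line) (\<phi> ` U) real_algebra (\<lambda>z x. inv_into U \<phi> x)"
    by (intro psmooth_cong[OF lc_algebra_scalar_algebra V psmooth_coordinate[OF V, of _ 0]]) simp
qed

lemma (in lc_algebra) localization_generator_smooth:
  assumes z: "z \<in> carrier A"
  shows "(\<lambda>t. \<one> \<ominus> of_real t \<odot> z) \<in> smooth_functions real_line A"
proof -
  note X = euclidean_charts_real_line
  note lc = lc_algebra_axioms
  have "psmooth_fun (discrete_topology {()}) real_line A (\<lambda>_ t. \<one> \<oplus> of_real t \<odot> (\<ominus> z))"
    by (rule psmooth_fun_add[OF X lc psmooth_fun_const[OF X lc] psmooth_fun_bilinear[OF X lc_algebra_scalar_algebra lc lc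
          cont_bilinear_real_smult psmooth_fun_real_line_ident psmooth_fun_const[OF X lc]]]) (use z in auto)
  moreover have "\<one> \<oplus> of_real t \<odot> (\<ominus> z) = \<one> \<ominus> of_real t \<odot> z" for t
    using z by (simp add: a_minus_def smult_minus_right)
  ultimately have "psmooth_fun (discrete_topology {()}) real_line A (\<lambda>_ t. \<one> \<ominus> of_real t \<odot> z)" by simp
  from restrict_psmooth_fun(2)[OF X lc this, of "()"] show ?thesis by (simp add: restrict_def)
qed

text \<open>\<open>algebra_hom\<close> does not ask for the unit to be preserved. Surjectivity
  yields it: a preimage \<open>a\<close> of \<open>\<one>\<close> gives
  \<open>h \<one> = h \<one> \<otimes> h a = h a = \<one>\<close>.\<close>

lemma (in lc_algebra) algebra_aut_one:
  assumes "algebra_aut A h"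
  shows "h \<one> = \<one>"
proof -
  have hom: "algebra_hom A A h" and bij: "bij_betw h (carrier A) (carrier A)"
    using assms unfolding algebra_aut_def by auto
  obtain a where a: "a \<in> carrier A" "h a = \<one>" using bij one_closed unfolding bij_betw_def by (metis imageE)
  have "h \<one> \<in> carrier A" using hom unfolding algebra_hom_def by auto
  moreover have "h (\<one> \<otimes> a) = h \<one> \<otimes> h a" using hom a(1) one_closed unfolding algebra_hom_def by blast
  ultimately show ?thesis using a by simp
qed

section \<open>The localized dynamical system\<close>

locale localization_system = group G + lc_algebra B
  for G :: "'g monoid" (structure) and B :: "(complex, 'a) top_algebra" +
  fixes \<alpha> :: "'g \<Rightarrow> 'a \<Rightarrow> 'a" and z :: 'a
  assumes dyn: "dynamical_system G B \<alpha>" and z: "z \<in> fixed_center G B \<alpha>"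
begin

abbreviation C where "C \<equiv> smooth_algebra real_line B"
abbreviation I where "I \<equiv> localization_ideal B z"
abbreviation gen where "gen \<equiv> (\<lambda>t. \<one>\<^bsub>B\<^esub> \<ominus>\<^bsub>B\<^esub> of_real t \<odot>\<^bsub>B\<^esub> z)"

lemma lcB: "lc_algebra B" by (rule lc_algebra_axioms)

lemma lcC: "lc_algebra C"
  by (rule lc_algebra_smooth_algebra[OF lcB euclidean_charts_real_line])

lemma zB: "z \<in> carrier B" using z unfolding fixed_center_def center_def by simp

lemma gen_carrier: "gen \<in> carrier C"
  using localization_generator_smooth[OF zB] by simp

lemma ideal_gen: "ideal (genideal C {gen}) C" and gen_in: "gen \<in> genideal C {gen}"
proof -
  interpret C: lc_algebra C by (rule lcC)
  show "ideal (genideal C {gen}) C" using gen_carrier by (intro C.genideal_ideal) (simp del: smooth_algebra_simps)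
  show "gen \<in> genideal C {gen}" using gen_carrier by (intro C.genideal_self') (simp del: smooth_algebra_simps)
qed

lemma closed_ideal: "lc_closed_ideal C I"
proof -
  interpret C: lc_algebra C by (rule lcC)
  have "ideal I C" unfolding localization_ideal_def by (rule C.ideal_closure_of[OF ideal_gen])
  moreover have "closedin (topo C) I" unfolding localization_ideal_def by (rule closedin_closure_of)
  ultimately show ?thesis
    using lcC by (simp add: lc_closed_ideal_def lc_closed_ideal_axioms_def)
qed

lemma genideal_subset_I: "genideal C {gen} \<subseteq> I"
proof -
  interpret C: lc_algebra C by (rule lcC)
  interpret J: ideal "genideal C {gen}" C by (rule ideal_gen)
  show ?thesis unfolding localization_ideal_def
    by (rule closure_of_subset) (use J.a_subset C.topspace_topo in simp)
qed

lemma aut: "g \<in> carrier G \<Longrightarrow> algebra_aut B (\<alpha> g)"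
  using dyn unfolding dynamical_system_def algebra_action_def by blast

lemma hom: "g \<in> carrier G \<Longrightarrow> algebra_hom B B (\<alpha> g)"
  using aut unfolding algebra_aut_def by blast

lemma cont_linear_\<alpha>:
  assumes g: "g \<in> carrier G"
  shows "cont_linear B B (\<alpha> g)"
proof -
  have "continuous_map (topo B) (prod_topology (discrete_topology (carrier G)) (topo B)) (\<lambda>a. (g, a))"
    using g by (intro continuous_map_pairedI) auto
  from continuous_map_compose[OF this] dyn
  have "continuous_map (topo B) (topo B) ((\<lambda>(g, a). \<alpha> g a) \<circ> (\<lambda>a. (g, a)))"
    unfolding dynamical_system_def by blast
  then show ?thesis using hom[OF g] unfolding cont_linear_def algebra_hom_def by (auto simp: o_def)
qed

lemma comp_closed:
  assumes g: "g \<in> carrier G" and f: "f \<in> carrier C"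
  shows "\<alpha> g \<circ> f \<in> carrier C"
proof -
  have "f \<in> smooth_functions real_line B" using f by simp
  then have "psmooth_fun (discrete_topology {()}) real_line B (\<lambda>_ t. \<alpha> g (f t))"
    by (intro psmooth_fun_linear[OF euclidean_charts_real_line lcB lcB cont_linear_\<alpha>[OF g]] smooth_functions_imp_psmooth_fun)
  from psmooth_fun_imp_smooth_functions[OF euclidean_charts_real_line lcB this, of "()"]
  show ?thesis by (simp add: o_def)
qed

lemma C_closed: "f \<in> carrier C \<Longrightarrow> f t \<in> carrier B"
  using smooth_functions_closed[of f real_line B t] by simp

lemma comp_add: "g \<in> carrier G \<Longrightarrow> f \<in> carrier C \<Longrightarrow> f' \<in> carrier C \<Longrightarrow> \<alpha> g \<circ> (f \<oplus>\<^bsub>C\<^esub> f') = (\<alpha> g \<circ> f) \<oplus>\<^bsub>C\<^esub> (\<alpha> g \<circ> f')"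
  using hom C_closed unfolding algebra_hom_def by (simp add: fun_eq_iff)

lemma comp_mult: "g \<in> carrier G \<Longrightarrow> f \<in> carrier C \<Longrightarrow> f' \<in> carrier C \<Longrightarrow> \<alpha> g \<circ> (f \<otimes>\<^bsub>C\<^esub> f') = (\<alpha> g \<circ> f) \<otimes>\<^bsub>C\<^esub> (\<alpha> g \<circ> f')"
  using hom C_closed unfolding algebra_hom_def by (simp add: fun_eq_iff)

lemma comp_smult: "g \<in> carrier G \<Longrightarrow> f \<in> carrier C \<Longrightarrow> \<alpha> g \<circ> (c \<odot>\<^bsub>C\<^esub> f) = c \<odot>\<^bsub>C\<^esub> (\<alpha> g \<circ> f)"
  using hom C_closed unfolding algebra_hom_def by (simp add: fun_eq_iff)

text \<open>Continuity is the exponential law again, with the composed function as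
  parameter.\<close>

lemma cont_linear_comp:
  assumes g: "g \<in> carrier G"
  shows "cont_linear C C (\<lambda>f. \<alpha> g \<circ> f)"
proof -
  have "psmooth_fun (smooth_compact_open real_line B) real_line B (\<lambda>f t. \<alpha> g (f t))"
    by (intro psmooth_fun_linear[OF euclidean_charts_real_line lcB lcB cont_linear_\<alpha>[OF g]]
        psmooth_fun_smooth_compact_open[OF euclidean_charts_real_line lcB])
  from continuous_map_smooth_compact_open[OF euclidean_charts_real_line lcB this]
  have "continuous_map (topo C) (topo C) (\<lambda>f. \<alpha> g \<circ> f)" by (simp add: o_def)
  then show ?thesis unfolding cont_linear_def using comp_add comp_smult g by blast
qed

lemma comp_gen:
  assumes g: "g \<in> carrier G"
  shows "\<alpha> g \<circ> gen = gen"
proof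
  fix t
  have "\<alpha> g z = z" using z g unfolding fixed_center_def by blast
  moreover have "\<alpha> g (of_real t \<odot>\<^bsub>B\<^esub> z) = of_real t \<odot>\<^bsub>B\<^esub> \<alpha> g z"
    using cont_linear_\<alpha>[OF g] zB unfolding cont_linear_def by blast
  ultimately show "(\<alpha> g \<circ> gen) t = gen t"
    using cont_linear_diff[OF lcB lcB cont_linear_\<alpha>[OF g]] zB algebra_aut_one[OF aut[OF g]] by simp
qed

text \<open>The functions that composition with \<open>\<alpha> g\<close> sends into the generated
  ideal form an ideal containing \<open>gen\<close>, which is fixed because \<open>z\<close> is.
  Minimality of the generated ideal, and then continuity, extend this to the closure.\<close>

lemma comp_I:
  assumes g: "g \<in> carrier G" and f: "f \<in> I"
  shows "\<alpha> g \<circ> f \<in> I"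
proof -
  interpret C: lc_algebra C by (rule lcC)
  let ?J = "genideal C {gen}"
  interpret J: ideal ?J C by (rule ideal_gen)
  let ?K = "{f \<in> carrier C. \<alpha> g \<circ> f \<in> ?J}"
  have zero: "\<alpha> g \<circ> \<zero>\<^bsub>C\<^esub> = \<zero>\<^bsub>C\<^esub>"
    using cont_linear_diff[OF lcC lcC cont_linear_comp[OF g], of "\<zero>\<^bsub>C\<^esub>" "\<zero>\<^bsub>C\<^esub>"] comp_closed[OF g C.zero_closed]
      C.zero_closed C.diff_self by (simp del: smooth_algebra_simps)
  have minus: "\<alpha> g \<circ> (\<ominus>\<^bsub>C\<^esub> f) = \<ominus>\<^bsub>C\<^esub> (\<alpha> g \<circ> f)" if "f \<in> carrier C" for f
    using cont_linear_diff[OF lcC lcC cont_linear_comp[OF g] C.zero_closed that] zero comp_closed[OF g] that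
    by (simp add: a_minus_def del: smooth_algebra_simps)
  have "ideal ?K C"
  proof (rule idealI[OF C.ring])
    show "subgroup ?K (add_monoid C)"
    proof (rule C.add.subgroupI)
      show "?K \<noteq> {}" using zero C.zero_closed J.zero_closed by (metis (mono_tags, lifting) empty_iff mem_Collect_eq)
      show "\<ominus>\<^bsub>C\<^esub> f \<in> ?K" if "f \<in> ?K" for f
        using that minus[of f] J.a_inv_closed[of "\<alpha> g \<circ> f"] C.a_inv_closed[of f] by (simp del: smooth_algebra_simps)
      show "f \<oplus>\<^bsub>C\<^esub> f' \<in> ?K" if "f \<in> ?K" "f' \<in> ?K" for f f'
        using that comp_add[OF g, of f f'] J.a_closed[of "\<alpha> g \<circ> f" "\<alpha> g \<circ> f'"] by (simp del: smooth_algebra_simps)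
    qed auto
    show "x \<otimes>\<^bsub>C\<^esub> f \<in> ?K" if "f \<in> ?K" "x \<in> carrier C" for f x
      using that comp_mult[OF g, of x f] J.I_l_closed[of "\<alpha> g \<circ> f" "\<alpha> g \<circ> x"] comp_closed[OF g, of x] by (simp del: smooth_algebra_simps)
    show "f \<otimes>\<^bsub>C\<^esub> x \<in> ?K" if "f \<in> ?K" "x \<in> carrier C" for f x
      using that comp_mult[OF g, of f x] J.I_r_closed[of "\<alpha> g \<circ> f" "\<alpha> g \<circ> x"] comp_closed[OF g, of x] by (simp del: smooth_algebra_simps)
  qed
  moreover have "{gen} \<subseteq> ?K" using gen_carrier comp_gen[OF g] gen_in by (simp del: smooth_algebra_simps)
  ultimately have "?J \<subseteq> ?K" by (rule C.genideal_minimal)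
  then have "(\<lambda>f. \<alpha> g \<circ> f) ` ?J \<subseteq> ?J" by blast
  moreover have "(\<lambda>f. \<alpha> g \<circ> f) ` (topo C closure_of ?J) \<subseteq> topo C closure_of (\<lambda>f. \<alpha> g \<circ> f) ` ?J"
    using cont_linear_comp[OF g, unfolded cont_linear_def, THEN conjunct1] by (rule continuous_map_image_closure_subset)
  ultimately have "(\<lambda>f. \<alpha> g \<circ> f) ` (topo C closure_of ?J) \<subseteq> topo C closure_of ?J"
    using closure_of_mono by blast
  then show ?thesis using f unfolding localization_ideal_def by blast
qed

interpretation CI: lc_closed_ideal C I by (rule closed_ideal)

lemma localized_action_coset:
  assumes g: "g \<in> carrier G" and f: "f \<in> carrier C"
  shows "localized_action B z \<alpha> g (I +>\<^bsub>C\<^esub> f) = I +>\<^bsub>C\<^esub> (\<alpha> g \<circ> f)"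
  unfolding localized_action_def
proof (rule CI.coset_UN[OF f])
  fix f' assume f': "f' \<in> carrier C" and d: "f' \<ominus>\<^bsub>C\<^esub> f \<in> I"
  show "(\<alpha> g \<circ> f') \<ominus>\<^bsub>C\<^esub> (\<alpha> g \<circ> f) \<in> I"
    using comp_I[OF g d] cont_linear_diff[OF lcC lcC cont_linear_comp[OF g] f' f] by (simp del: smooth_algebra_simps)
qed (rule comp_closed[OF g])

lemma comp_one: "f \<in> carrier C \<Longrightarrow> \<alpha> \<one> \<circ> f = f"
  using dyn C_closed unfolding dynamical_system_def algebra_action_def by (simp add: fun_eq_iff)

lemma comp_comp: "g \<in> carrier G \<Longrightarrow> h \<in> carrier G \<Longrightarrow> f \<in> carrier C \<Longrightarrow> \<alpha> (g \<otimes> h) \<circ> f = \<alpha> g \<circ> (\<alpha> h \<circ> f)"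
  using dyn C_closed unfolding dynamical_system_def algebra_action_def by (simp add: fun_eq_iff)

lemma dynamical_system_localization:
  "dynamical_system G (smooth_localization B z) (localized_action B z \<alpha>)"
proof -
  let ?Q = "quotient_algebra C I" and ?\<beta> = "localized_action B z \<alpha>"
  note act = localized_action_coset
  have cQ: "(I +>\<^bsub>C\<^esub> f) \<in> carrier ?Q" if "f \<in> carrier C" for f using that unfolding CI.carrier_Q by blast
  have rep: "\<exists>f\<in>carrier C. X = I +>\<^bsub>C\<^esub> f" if "X \<in> carrier ?Q" for X using that unfolding CI.carrier_Q by blast
  have cl: "?\<beta> g X \<in> carrier ?Q" if "g \<in> carrier G" "X \<in> carrier ?Q" for g X
    using rep[OF that(2)] act[OF that(1)] comp_closed[OF that(1)] cQ by auto
  have one: "?\<beta> \<one> X = X" if "X \<in> carrier ?Q" for X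
    using rep[OF that] act comp_one by auto
  have mult: "?\<beta> (g \<otimes> h) X = ?\<beta> g (?\<beta> h X)" if "g \<in> carrier G" "h \<in> carrier G" "X \<in> carrier ?Q" for g h X
    using rep[OF that(3)] that(1,2) act comp_comp comp_closed by auto
  have hom: "algebra_hom ?Q ?Q (?\<beta> g)" if g: "g \<in> carrier G" for g
    unfolding algebra_hom_def
  proof (intro conjI ballI allI)
    show "?\<beta> g \<in> carrier ?Q \<rightarrow> carrier ?Q" using cl[OF g] by blast
    fix X assume "X \<in> carrier ?Q"
    then obtain f where f: "f \<in> carrier C" "X = I +>\<^bsub>C\<^esub> f" using rep by blast
    show "?\<beta> g (c \<odot>\<^bsub>?Q\<^esub> X) = c \<odot>\<^bsub>?Q\<^esub> ?\<beta> g X" for c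
      using f act[OF g] comp_smult[OF g] comp_closed[OF g] CI.smult_Q CI.smult_closed by (simp del: smooth_algebra_simps)
    fix Y assume "Y \<in> carrier ?Q"
    then obtain f' where f': "f' \<in> carrier C" "Y = I +>\<^bsub>C\<^esub> f'" using rep by blast
    show "?\<beta> g (X \<oplus>\<^bsub>?Q\<^esub> Y) = ?\<beta> g X \<oplus>\<^bsub>?Q\<^esub> ?\<beta> g Y"
      using f f' act[OF g] comp_add[OF g] comp_closed[OF g] CI.add_Q CI.a_closed by (simp del: smooth_algebra_simps)
    show "?\<beta> g (X \<otimes>\<^bsub>?Q\<^esub> Y) = ?\<beta> g X \<otimes>\<^bsub>?Q\<^esub> ?\<beta> g Y"
      using f f' act[OF g] comp_mult[OF g] comp_closed[OF g] CI.mult_Q CI.m_closed by (simp del: smooth_algebra_simps)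
  qed
  have bij: "bij_betw (?\<beta> g) (carrier ?Q) (carrier ?Q)" if g: "g \<in> carrier G" for g
  proof (rule bij_betwI[where g = "?\<beta> (inv g)"])
    show "?\<beta> (inv g) (?\<beta> g X) = X" if "X \<in> carrier ?Q" for X
      using mult[of "inv g" g X] one[OF that] g that by simp
    show "?\<beta> g (?\<beta> (inv g) X) = X" if "X \<in> carrier ?Q" for X
      using mult[of g "inv g" X] one[OF that] g that by simp
  qed (use cl g in auto)
  have "continuous_map (topo ?Q) (topo ?Q) (?\<beta> g)" if g: "g \<in> carrier G" for g
  proof (rule CI.continuous_map_from_Q)
    have "continuous_map (topo C) (topo C) (\<lambda>f. \<alpha> g \<circ> f)" using cont_linear_comp[OF g] unfolding cont_linear_def by blast
    from continuous_map_compose[OF this CI.continuous_map_coset]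
    have "continuous_map (topo C) (topo ?Q) (\<lambda>f. I +>\<^bsub>C\<^esub> (\<alpha> g \<circ> f))" by (simp add: o_def del: smooth_algebra_simps)
    then show "continuous_map (topo C) (topo ?Q) (\<lambda>f. ?\<beta> g (I +>\<^bsub>C\<^esub> f))"
      by (rule continuous_map_eq) (use act[OF g] CI.topspace_topo in \<open>simp del: smooth_algebra_simps\<close>)
  qed
  then have "continuous_map (prod_topology (discrete_topology (carrier G)) (topo ?Q)) (topo ?Q) (\<lambda>(g, a). ?\<beta> g a)"
    by (rule continuous_map_prod_discrete)
  then show ?thesis
    unfolding dynamical_system_def smooth_localization_def algebra_action_def algebra_aut_def
    using CI.lc_algebra_quotient hom bij one mult by blast
qed

text \<open>Constant curves suffice to trivialise the localization: if \<open>z e = 0\<close> then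
  \<open>e = (1 - t z) e\<close> belongs to the defining ideal.\<close>

lemma const_in_I:
  assumes e: "e \<in> carrier B" and ze: "z \<otimes>\<^bsub>B\<^esub> e = \<zero>\<^bsub>B\<^esub>"
  shows "(\<lambda>t. e) \<in> I"
proof -
  interpret J: ideal "genideal C {gen}" C by (rule ideal_gen)
  have ec: "(\<lambda>t. e) \<in> carrier C"
    using restrict_psmooth_fun(2)[OF euclidean_charts_real_line lcB psmooth_fun_const[OF euclidean_charts_real_line lcB e], of "()" "discrete_topology {()}"]
    by (simp add: restrict_def)
  have "gen t \<otimes>\<^bsub>B\<^esub> e = e" for t
    using e zB ze by (simp add: a_minus_def l_distr l_minus smult_mult_left)
  then have "gen \<otimes>\<^bsub>C\<^esub> (\<lambda>t. e) = (\<lambda>t. e)" by (simp add: fun_eq_iff)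
  moreover have "gen \<otimes>\<^bsub>C\<^esub> (\<lambda>t. e) \<in> genideal C {gen}" using gen_in ec by (rule J.I_r_closed)
  ultimately show ?thesis using genideal_subset_I by auto
qed

lemma const_carrier: "a \<in> carrier B \<Longrightarrow> (\<lambda>t. a) \<in> carrier C"
  using restrict_psmooth_fun(2)[OF euclidean_charts_real_line lcB psmooth_fun_const[OF euclidean_charts_real_line lcB, of a], of "()" "discrete_topology {()}"]
  by (simp add: restrict_def)

lemma const_in_isotypic:
  assumes "a \<in> isotypic G B \<alpha> \<omega>"
  shows "I +>\<^bsub>C\<^esub> (\<lambda>t. a) \<in> isotypic G (smooth_localization B z) (localized_action B z \<alpha>) \<omega>"
proof -
  have a: "a \<in> carrier B" "\<And>g. g \<in> carrier G \<Longrightarrow> \<alpha> g a = \<omega> g \<odot>\<^bsub>B\<^esub> a" using assms unfolding isotypic_def by auto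
  note ac = const_carrier[OF a(1)]
  have "localized_action B z \<alpha> g (I +>\<^bsub>C\<^esub> (\<lambda>t. a)) = \<omega> g \<odot>\<^bsub>quotient_algebra C I\<^esub> (I +>\<^bsub>C\<^esub> (\<lambda>t. a))" if g: "g \<in> carrier G" for g
  proof -
    have "\<alpha> g \<circ> (\<lambda>t. a) = \<omega> g \<odot>\<^bsub>C\<^esub> (\<lambda>t. a)" using a(2)[OF g] by (simp add: fun_eq_iff)
    then show ?thesis using localized_action_coset[OF g ac] CI.smult_Q[OF ac] by (simp del: smooth_algebra_simps)
  qed
  then show ?thesis
    using ac unfolding isotypic_def smooth_localization_def CI.carrier_Q by blast
qed

lemma const_pow: "n > 0 \<Longrightarrow> a \<in> carrier B \<Longrightarrow>
  (I +>\<^bsub>C\<^esub> (\<lambda>t. a)) [^]\<^bsub>smooth_localization B z\<^esub> (n::nat) = I +>\<^bsub>C\<^esub> (\<lambda>t. a [^]\<^bsub>B\<^esub> n)"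
proof (induction n)
  case (Suc n)
  interpret QQ: lc_algebra "quotient_algebra C I" by (rule CI.lc_algebra_quotient)
  have m: "(I +>\<^bsub>C\<^esub> (\<lambda>t. b)) \<otimes>\<^bsub>quotient_algebra C I\<^esub> (I +>\<^bsub>C\<^esub> (\<lambda>t. a)) = I +>\<^bsub>C\<^esub> (\<lambda>t. b \<otimes>\<^bsub>B\<^esub> a)" if "b \<in> carrier B" for b
    using CI.mult_Q[OF const_carrier[OF that] const_carrier[OF Suc.prems(2)]] by (simp add: restrict_def)
  have q: "(I +>\<^bsub>C\<^esub> (\<lambda>t. a)) \<in> carrier (quotient_algebra C I)" using const_carrier[OF Suc.prems(2)] unfolding CI.carrier_Q by blast
  show ?case
  proof (cases "n = 0")
    case True
    then show ?thesis using q Suc.prems unfolding smooth_localization_def by simp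
  next
    case False
    then show ?thesis using Suc m[of "a [^]\<^bsub>B\<^esub> n"] unfolding smooth_localization_def by simp
  qed
qed simp

text \<open>As \<open>z\<close> annihilates the difference of \<open>a^n\<close> and the unit, the
  constant curve at this difference lies in \<open>I\<close>. The inverse of the class of
  \<open>a\<close> is its own power with exponent \<open>n - 1\<close>.\<close>

lemma const_unit:
  fixes n :: nat
  assumes a: "a \<in> carrier B" and n: "n > 0" and e: "z \<otimes>\<^bsub>B\<^esub> (a [^]\<^bsub>B\<^esub> n \<ominus>\<^bsub>B\<^esub> \<one>\<^bsub>B\<^esub>) = \<zero>\<^bsub>B\<^esub>"
  shows "(I +>\<^bsub>C\<^esub> (\<lambda>t. a)) [^]\<^bsub>smooth_localization B z\<^esub> n = \<one>\<^bsub>smooth_localization B z\<^esub>"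
    and "I +>\<^bsub>C\<^esub> (\<lambda>t. a) \<in> Units (smooth_localization B z)"
proof -
  let ?a = "I +>\<^bsub>C\<^esub> (\<lambda>t. a)"
  interpret QQ: lc_algebra "smooth_localization B z" unfolding smooth_localization_def by (rule CI.lc_algebra_quotient)
  have an: "a [^]\<^bsub>B\<^esub> n \<in> carrier B" using a by simp
  have "(\<lambda>t. a [^]\<^bsub>B\<^esub> n) \<ominus>\<^bsub>C\<^esub> \<one>\<^bsub>C\<^esub> = (\<lambda>t. a [^]\<^bsub>B\<^esub> n \<ominus>\<^bsub>B\<^esub> \<one>\<^bsub>B\<^esub>)"
  proof -
    \<comment> \<open>Subtraction in \<open>C\<close> goes through the additive inverse of an
      abstract ring; its pointwise form is obtained by cancelling a sum.\<close>
    let ?d = "\<lambda>t::real. a [^]\<^bsub>B\<^esub> n \<ominus>\<^bsub>B\<^esub> \<one>\<^bsub>B\<^esub>"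
    have d: "?d \<in> carrier C" by (rule const_carrier[OF minus_closed[OF an one_closed]])
    have "?d \<oplus>\<^bsub>C\<^esub> \<one>\<^bsub>C\<^esub> = (\<lambda>t. a [^]\<^bsub>B\<^esub> n)"
      using an by (simp add: fun_eq_iff a_minus_def a_assoc l_neg)
    then have "(\<lambda>t. a [^]\<^bsub>B\<^esub> n) \<ominus>\<^bsub>C\<^esub> \<one>\<^bsub>C\<^esub> = (?d \<oplus>\<^bsub>C\<^esub> \<one>\<^bsub>C\<^esub>) \<ominus>\<^bsub>C\<^esub> \<one>\<^bsub>C\<^esub>" by (simp only:)
    also have "\<dots> = ?d"
      using d CI.one_closed by (simp add: a_minus_def CI.a_assoc CI.r_neg del: smooth_algebra_simps)
    finally show ?thesis .
  qed
  then have "(\<lambda>t. a [^]\<^bsub>B\<^esub> n) \<ominus>\<^bsub>C\<^esub> \<one>\<^bsub>C\<^esub> \<in> I" using const_in_I[OF minus_closed[OF an one_closed] e] by simp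
  then have "I +>\<^bsub>C\<^esub> (\<lambda>t. a [^]\<^bsub>B\<^esub> n) = I +>\<^bsub>C\<^esub> \<one>\<^bsub>C\<^esub>"
    using CI.coset_eq_iff[OF const_carrier[OF an] CI.one_closed] by blast
  then show p: "?a [^]\<^bsub>smooth_localization B z\<^esub> n = \<one>\<^bsub>smooth_localization B z\<^esub>"
    using const_pow[OF n a] CI.one_Q unfolding smooth_localization_def by (simp del: smooth_algebra_simps)
  have q: "?a \<in> carrier (smooth_localization B z)"
    using const_carrier[OF a] unfolding smooth_localization_def CI.carrier_Q by blast
  obtain m where m: "n = Suc m" using n gr0_conv_Suc by blast
  show "?a \<in> Units (smooth_localization B z)"
    unfolding Units_def using q p m QQ.nat_pow_Suc2[OF q, of m] QQ.nat_pow_closed[OF q, of m]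
    by (auto intro!: bexI[of _ "?a [^]\<^bsub>smooth_localization B z\<^esub> m"])
qed

end

section \<open>Smooth functions on manifolds\<close>

lemma smooth_on_cong:
  assumes E: "lc_algebra E" and V: "openin (Euclidean_space n) V" and f: "smooth_on n V E f"
    and eq: "\<And>x. x \<in> V \<Longrightarrow> f x = g x"
  shows "smooth_on n V E g"
proof -
  have "psmooth (discrete_topology {()}) n V E (\<lambda>_. g)"
    by (rule psmooth_cong[OF E V smooth_on_imp_psmooth[OF f]]) (use eq in simp)
  from psmooth_imp_smooth_on[OF this, of "()"] show ?thesis by simp
qed

context
  fixes X :: "'p manifold"
  assumes X: "smooth_manifold X"
begin

lemma manifold_charts: "euclidean_charts X"
  by (rule smooth_manifold_imp_euclidean_charts[OF X])

lemma manifold_chart_openin: "(U, \<phi>) \<in> charts X \<Longrightarrow> openin (mtop X) U"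
  using X unfolding smooth_manifold_def by auto

lemma manifold_chart_image_openin:
  assumes c: "(U, \<phi>) \<in> charts X" and S: "openin (mtop X) S" "S \<subseteq> U"
  shows "openin (Euclidean_space (mdim X)) (\<phi> ` S)"
proof -
  have h: "homeomorphic_map (subtopology (mtop X) U) (subtopology (Euclidean_space (mdim X)) (\<phi> ` U)) \<phi>"
    using X c unfolding smooth_manifold_def by auto
  have "openin (subtopology (mtop X) U) S" using S manifold_chart_openin[OF c] by (simp add: openin_open_subtopology)
  then have "openin (subtopology (Euclidean_space (mdim X)) (\<phi> ` U)) (\<phi> ` S)"
    using h homeomorphic_imp_open_map unfolding open_map_def by blast
  then show ?thesis using chart_openin[OF manifold_charts c] openin_open_subtopology by blast
qed

section \<open>Open submanifolds and the local nature of smoothness\<close>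

lemma euclidean_charts_open_submanifold:
  assumes W: "openin (mtop X) W"
  shows "euclidean_charts (open_submanifold X W)"
  unfolding euclidean_charts_def
proof (intro conjI ballI)
  show "(\<Union>(U, \<phi>)\<in>charts (open_submanifold X W). U) = points (open_submanifold X W)"
    using manifold_charts unfolding euclidean_charts_def by (auto simp: open_submanifold_def)
  fix c assume "c \<in> charts (open_submanifold X W)"
  then obtain U \<phi> where c: "(U, \<phi>) \<in> charts X" "c = (U \<inter> W, \<phi>)" by (auto simp: open_submanifold_def)
  have "openin (Euclidean_space (mdim X)) (\<phi> ` (U \<inter> W))"
    using manifold_chart_image_openin[OF c(1), of "U \<inter> W"] manifold_chart_openin[OF c(1)] W by auto
  moreover have "inj_on \<phi> (U \<inter> W)" using chart_inj[OF manifold_charts c(1)] by (rule inj_on_subset) auto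
  ultimately show "case c of (U, \<phi>) \<Rightarrow> openin (Euclidean_space (mdim (open_submanifold X W))) (\<phi> ` U) \<and> inj_on \<phi> U"
    using c(2) by (simp add: open_submanifold_def)
qed

lemma points_open_submanifold: "openin (mtop X) W \<Longrightarrow> points (open_submanifold X W) = W"
  using openin_subset by (auto simp: open_submanifold_def)

lemma inv_into_Int: "(U, \<phi>) \<in> charts X \<Longrightarrow> x \<in> \<phi> ` (U \<inter> W) \<Longrightarrow> inv_into (U \<inter> W) \<phi> x = inv_into U \<phi> x"
proof -
  assume c: "(U, \<phi>) \<in> charts X" and "x \<in> \<phi> ` (U \<inter> W)"
  then obtain p where p: "p \<in> U \<inter> W" "x = \<phi> p" by blast
  have "inj_on \<phi> (U \<inter> W)" using chart_inj[OF manifold_charts c] by (rule inj_on_subset) auto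
  then show ?thesis using p chart_inj[OF manifold_charts c] by simp
qed

lemma psmooth_fun_open_submanifold_iff:
  assumes E: "lc_algebra E" and W: "openin (mtop X) W"
  shows "psmooth_fun Z (open_submanifold X W) E F \<longleftrightarrow>
    (\<forall>(U, \<phi>)\<in>charts X. psmooth Z (mdim X) (\<phi> ` (U \<inter> W)) E (\<lambda>z x. F z (inv_into U \<phi> x)))"
proof -
  have V: "openin (Euclidean_space (mdim X)) (\<phi> ` (U \<inter> W))" if "(U, \<phi>) \<in> charts X" for U \<phi>
    using manifold_chart_image_openin[OF that, of "U \<inter> W"] manifold_chart_openin[OF that] W by auto
  have eq: "psmooth Z (mdim X) (\<phi> ` (U \<inter> W)) E (\<lambda>z x. F z (inv_into (U \<inter> W) \<phi> x)) \<longleftrightarrow>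
     psmooth Z (mdim X) (\<phi> ` (U \<inter> W)) E (\<lambda>z x. F z (inv_into U \<phi> x))" if c: "(U, \<phi>) \<in> charts X" for U \<phi>
  proof
    assume "psmooth Z (mdim X) (\<phi> ` (U \<inter> W)) E (\<lambda>z x. F z (inv_into (U \<inter> W) \<phi> x))"
    then show "psmooth Z (mdim X) (\<phi> ` (U \<inter> W)) E (\<lambda>z x. F z (inv_into U \<phi> x))"
      by (rule psmooth_cong[OF E V[OF c]]) (simp add: inv_into_Int[OF c])
  next
    assume "psmooth Z (mdim X) (\<phi> ` (U \<inter> W)) E (\<lambda>z x. F z (inv_into U \<phi> x))"
    then show "psmooth Z (mdim X) (\<phi> ` (U \<inter> W)) E (\<lambda>z x. F z (inv_into (U \<inter> W) \<phi> x))"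
      by (rule psmooth_cong[OF E V[OF c]]) (simp add: inv_into_Int[OF c])
  qed
  then show ?thesis
    unfolding psmooth_fun_def by (auto simp: open_submanifold_def)
qed

lemma psmooth_fun_open_submanifold:
  assumes E: "lc_algebra E" and W: "openin (mtop X) W" and F: "psmooth_fun Z X E F"
  shows "psmooth_fun Z (open_submanifold X W) E F"
  unfolding psmooth_fun_open_submanifold_iff[OF E W]
proof safe
  fix U \<phi> assume c: "(U, \<phi>) \<in> charts X"
  show "psmooth Z (mdim X) (\<phi> ` (U \<inter> W)) E (\<lambda>z x. F z (inv_into U \<phi> x))"
    by (rule psmooth_subset[OF E psmooth_funD[OF F c]]) auto
qed

lemma psmooth_fun_local:
  assumes E: "lc_algebra E"
    and loc: "\<And>p. p \<in> points X \<Longrightarrow> \<exists>W. openin (mtop X) W \<and> p \<in> W \<and> psmooth_fun Z (open_submanifold X W) E F"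
  shows "psmooth_fun Z X E F"
proof (rule psmooth_funI)
  fix U \<phi> assume c: "(U, \<phi>) \<in> charts X"
  show "psmooth Z (mdim X) (\<phi> ` U) E (\<lambda>z x. F z (inv_into U \<phi> x))"
  proof (rule psmooth_local[OF E])
    fix x assume "x \<in> \<phi> ` U"
    then obtain p where p: "p \<in> U" "x = \<phi> p" by blast
    then have "p \<in> points X" using chart_subset[OF manifold_charts c] by blast
    then obtain W where W: "openin (mtop X) W" "p \<in> W" "psmooth_fun Z (open_submanifold X W) E F" using loc by blast
    have "psmooth Z (mdim X) (\<phi> ` (U \<inter> W)) E (\<lambda>z x. F z (inv_into U \<phi> x))"
      using W(3) c unfolding psmooth_fun_open_submanifold_iff[OF E W(1)] by auto
    moreover have "openin (Euclidean_space (mdim X)) (\<phi> ` (U \<inter> W))"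
      using manifold_chart_image_openin[OF c, of "U \<inter> W"] manifold_chart_openin[OF c] W by auto
    ultimately show "\<exists>V. openin (Euclidean_space (mdim X)) V \<and> x \<in> V \<and> V \<subseteq> \<phi> ` U \<and>
         psmooth Z (mdim X) V E (\<lambda>z x. F z (inv_into U \<phi> x))"
      using p W(2) by (intro exI[of _ "\<phi> ` (U \<inter> W)"]) auto
  qed
qed

text \<open>The chain rule applies on the points of a chart that \<open>s\<close> sends into one
  chart of \<open>Y\<close>; continuity of \<open>s\<close> makes this set open, and locality
  assembles the pieces.\<close>

lemma psmooth_fun_compose:
  assumes Y: "smooth_manifold Y" and s: "smooth_map X Y s" and E: "lc_algebra E" and F: "psmooth_fun Z Y E F"
  shows "psmooth_fun Z X E (\<lambda>z p. F z (s p))"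
proof (rule psmooth_funI)
  have cont: "continuous_map (mtop X) (mtop Y) s" using s unfolding smooth_map_def by blast
  fix U \<phi> assume c: "(U, \<phi>) \<in> charts X"
  show "psmooth Z (mdim X) (\<phi> ` U) E (\<lambda>z x. F z (s (inv_into U \<phi> x)))"
  proof (rule psmooth_local[OF E])
    fix x assume "x \<in> \<phi> ` U"
    then obtain p where p: "p \<in> U" "x = \<phi> p" by blast
    then have pX: "p \<in> points X" using chart_subset[OF manifold_charts c] by blast
    then have "s p \<in> points Y" using continuous_map_in_topspace[OF cont] by blast
    then obtain W \<psi> where d: "(W, \<psi>) \<in> charts Y" "s p \<in> W"
      by (rule chart_cover[OF smooth_manifold_imp_euclidean_charts[OF Y]])
    have Wo: "openin (mtop Y) W" using Y d(1) unfolding smooth_manifold_def by auto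
    let ?S = "{q \<in> U. s q \<in> W}"
    have "?S = U \<inter> {q \<in> points X. s q \<in> W}" using chart_subset[OF manifold_charts c] by auto
    then have "openin (mtop X) ?S"
      using manifold_chart_openin[OF c] openin_continuous_map_preimage[OF cont Wo] by (simp add: openin_Int)
    then have V: "openin (Euclidean_space (mdim X)) (\<phi> ` ?S)"
      by (rule manifold_chart_image_openin[OF c]) auto
    note Y' = smooth_manifold_imp_euclidean_charts[OF Y]
    have inv: "inv_into U \<phi> y \<in> ?S" if "y \<in> \<phi> ` ?S" for y
      using that chart_inj[OF manifold_charts c] by auto
    have "psmooth Z (mdim X) (\<phi> ` ?S) E (\<lambda>z x. F z (inv_into W \<psi> (\<psi> (s (inv_into U \<phi> x)))))"
    proof (rule psmooth_chain[OF E V chart_openin[OF Y' d(1)] psmooth_funD[OF F d(1)]])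
      show "\<psi> (s (inv_into U \<phi> y)) \<in> \<psi> ` W" if "y \<in> \<phi> ` ?S" for y using inv[OF that] by auto
      show "smooth_on (mdim X) (\<phi> ` ?S) real_algebra (\<lambda>y. \<psi> (s (inv_into U \<phi> y)) j)" if "j < mdim Y" for j
        using s c d(1) that unfolding smooth_map_def by blast
    qed
    then have "psmooth Z (mdim X) (\<phi> ` ?S) E (\<lambda>z x. F z (s (inv_into U \<phi> x)))"
      by (rule psmooth_cong[OF E V]) (use inv chart_inj[OF Y' d(1)] in auto)
    then show "\<exists>V. openin (Euclidean_space (mdim X)) V \<and> x \<in> V \<and> V \<subseteq> \<phi> ` U \<and>
         psmooth Z (mdim X) V E (\<lambda>z x. F z (s (inv_into U \<phi> x)))"
      using V p d(2) by (intro exI[of _ "\<phi> ` ?S"]) auto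
  qed
qed

text \<open>The slice at \<open>g\<close> is read off in the charts with domain
  \<open>U \<times> {g}\<close>, whose coordinates are those of \<open>U\<close>.\<close>

lemma smooth_map_times_discrete:
  assumes Y: "smooth_manifold Y" and s: "smooth_map (times_discrete X S) Y (\<lambda>(p, g). \<sigma> p g)" and g: "g \<in> S"
  shows "smooth_map X Y (\<lambda>p. \<sigma> p g)"
proof -
  have c1: "continuous_map (mtop X) (prod_topology (mtop X) (discrete_topology S)) (\<lambda>p. (p, g))"
    using g by (intro continuous_map_pairedI) auto
  have "continuous_map (prod_topology (mtop X) (discrete_topology S)) (mtop Y) (\<lambda>(p, g). \<sigma> p g)"
    using s unfolding smooth_map_def times_discrete_def by simp
  from continuous_map_compose[OF c1 this] have cont: "continuous_map (mtop X) (mtop Y) (\<lambda>p. \<sigma> p g)" by (simp add: o_def)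
  have "smooth_on (mdim X) (\<phi> ` {p \<in> U. \<sigma> p g \<in> W}) real_algebra (\<lambda>x. \<psi> (\<sigma> (inv_into U \<phi> x) g) j)"
    if c: "(U, \<phi>) \<in> charts X" and d: "(W, \<psi>) \<in> charts Y" and j: "j < mdim Y" for U \<phi> W \<psi> j
  proof -
    let ?S = "{p \<in> U. \<sigma> p g \<in> W}"
    have "(U \<times> {g}, \<phi> \<circ> fst) \<in> charts (times_discrete X S)" using c g by (auto simp: times_discrete_def)
    then have so: "smooth_on (mdim X) ((\<phi> \<circ> fst) ` {p \<in> U \<times> {g}. (\<lambda>(p, g). \<sigma> p g) p \<in> W}) real_algebra
        (\<lambda>x. \<psi> ((\<lambda>(p, g). \<sigma> p g) (inv_into (U \<times> {g}) (\<phi> \<circ> fst) x)) j)"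
      using s d j unfolding smooth_map_def by (fastforce simp: times_discrete_def)
    have im: "(\<phi> \<circ> fst) ` {p \<in> U \<times> {g}. (\<lambda>(p, g). \<sigma> p g) p \<in> W} = \<phi> ` ?S" by force
    have Wo: "openin (mtop Y) W" using Y d unfolding smooth_manifold_def by auto
    have "?S = U \<inter> {q \<in> points X. \<sigma> q g \<in> W}" using chart_subset[OF manifold_charts c] by auto
    then have "openin (mtop X) ?S"
      using manifold_chart_openin[OF c] openin_continuous_map_preimage[OF cont Wo] by (simp add: openin_Int)
    then have V: "openin (Euclidean_space (mdim X)) (\<phi> ` ?S)"
      by (rule manifold_chart_image_openin[OF c]) auto
    have "inv_into (U \<times> {g}) (\<phi> \<circ> fst) x = (inv_into U \<phi> x, g)" if x: "x \<in> \<phi> ` ?S" for x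
    proof -
      obtain p where p: "p \<in> U" "x = \<phi> p" using x by blast
      have inj: "inj_on \<phi> U" by (rule chart_inj[OF manifold_charts c])
      then have "inj_on (\<phi> \<circ> fst) (U \<times> {g})" by (auto simp: inj_on_def)
      from inv_into_f_f[OF this, of "(p, g)"] show ?thesis using p inv_into_f_f[OF inj p(1)] by simp
    qed
    then show ?thesis
      using smooth_on_cong[OF lc_algebra_scalar_algebra V so[unfolded im]] by simp
  qed
  then show ?thesis using cont unfolding smooth_map_def by auto
qed

end

text \<open>The one-point parameter space turns \<open>psmooth_fun\<close> into plain smoothness,
  without the extensionality built into \<open>smooth_functions\<close>.\<close>

definition rsmooth :: "'p manifold \<Rightarrow> ('p \<Rightarrow> real) \<Rightarrow> bool" where
  "rsmooth X f \<longleftrightarrow> psmooth_fun (discrete_topology {()}) X real_algebra (\<lambda>_. f)"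

context
  fixes X :: "'p manifold"
  assumes X: "euclidean_charts X"
begin

lemma rsmooth_const: "rsmooth X (\<lambda>p. c)"
  unfolding rsmooth_def using psmooth_fun_const[OF X lc_algebra_scalar_algebra, of c] by simp

lemma rsmooth_add: "rsmooth X f \<Longrightarrow> rsmooth X g \<Longrightarrow> rsmooth X (\<lambda>p. f p + g p)"
  unfolding rsmooth_def using psmooth_fun_add[OF X lc_algebra_scalar_algebra] by fastforce

lemma rsmooth_mult: "rsmooth X f \<Longrightarrow> rsmooth X g \<Longrightarrow> rsmooth X (\<lambda>p. f p * g p)"
  unfolding rsmooth_def
  using psmooth_fun_bilinear[OF X lc_algebra_scalar_algebra lc_algebra_scalar_algebra lc_algebra_scalar_algebra real_alg.cont_bilinear_mult]
  by fastforce

lemma rsmooth_diff: "rsmooth X f \<Longrightarrow> rsmooth X g \<Longrightarrow> rsmooth X (\<lambda>p. f p - g p)"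
  using rsmooth_add[OF _ rsmooth_mult[OF rsmooth_const[of "-1"]], of f g] by simp

lemma rsmooth_sum: "finite S \<Longrightarrow> (\<And>i. i \<in> S \<Longrightarrow> rsmooth X (f i)) \<Longrightarrow> rsmooth X (\<lambda>p. \<Sum>i\<in>S. f i p)"
  by (induction S rule: finite_induct) (auto intro: rsmooth_const rsmooth_add)

lemma rsmooth_prod: "finite S \<Longrightarrow> (\<And>i. i \<in> S \<Longrightarrow> rsmooth X (f i)) \<Longrightarrow> rsmooth X (\<lambda>p. \<Prod>i\<in>S. f i p)"
  by (induction S rule: finite_induct) (auto intro: rsmooth_const rsmooth_mult)

lemma rsmooth_compose_real:
  assumes f: "rsmooth X f" and T: "\<And>p. p \<in> points X \<Longrightarrow> f p \<in> T"
    and D: "\<And>k t. t \<in> T \<Longrightarrow> (D k has_real_derivative D (Suc k) t) (at t)"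
  shows "rsmooth X (\<lambda>p. D (0::nat) (f p))"
  unfolding rsmooth_def
proof (rule psmooth_funI)
  fix U \<phi> assume c: "(U, \<phi>) \<in> charts X"
  show "psmooth (discrete_topology {()}) (mdim X) (\<phi> ` U) real_algebra (\<lambda>z x. D 0 (f (inv_into U \<phi> x)))"
  proof (rule psmooth_real_compose[OF chart_openin[OF X c] psmooth_funD[OF f[unfolded rsmooth_def] c], where D = D and T = T])
    show "f (inv_into U \<phi> x) \<in> T" if "x \<in> \<phi> ` U" for x using T inv_chart_in[OF X c that] .
  qed (rule D)
qed

lemma rsmooth_inverse:
  assumes f: "rsmooth X f" and pos: "\<And>p. p \<in> points X \<Longrightarrow> f p > 0"
  shows "rsmooth X (\<lambda>p. inverse (f p))"
proof -
  \<comment> \<open>The derivatives of all orders of the reciprocal.\<close>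
  let ?D = "\<lambda>k t::real. (- 1) ^ k * fact k * inverse t ^ Suc k"
  have D: "(?D k has_real_derivative ?D (Suc k) t) (at t)" if "t \<in> {0<..}" for k t
  proof -
    have "((\<lambda>t. inverse t ^ Suc k) has_real_derivative real (Suc k) * (- (inverse t * inverse t)) * inverse t ^ k) (at t)"
      using that by (auto intro!: derivative_eq_intros simp: power2_eq_square simp del: power_Suc)
    from DERIV_cmult[OF this, of "(- 1) ^ k * fact k"] show ?thesis by (simp add: algebra_simps)
  qed
  have "rsmooth X (\<lambda>p. ?D 0 (f p))"
    by (rule rsmooth_compose_real[OF f, where D = ?D and T = "{0<..}", OF _ D]) (use pos in simp_all)
  then show ?thesis by simp
qed

lemma rsmooth_cong: "rsmooth X f \<Longrightarrow> (\<And>p. p \<in> points X \<Longrightarrow> f p = g p) \<Longrightarrow> rsmooth X g"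
  unfolding rsmooth_def using psmooth_fun_cong[OF X lc_algebra_scalar_algebra, of _ "\<lambda>_. f" "\<lambda>_. g"] by blast

end

section \<open>A smooth function that is flat at 0\<close>

definition flat_poly :: "real poly \<Rightarrow> real \<Rightarrow> real" where
  "flat_poly p t = (if t > 0 then poly p (1 / t) * exp (- 1 / t) else 0)"

definition flat_exp :: "real \<Rightarrow> real" where
  "flat_exp t = (if t > 0 then exp (- 1 / t) else 0)"

lemma flat_exp_pos: "t > 0 \<Longrightarrow> flat_exp t > 0"
  and flat_exp_zero: "t \<le> 0 \<Longrightarrow> flat_exp t = 0"
  and flat_exp_nonneg: "flat_exp t \<ge> 0"
  by (auto simp: flat_exp_def)

text \<open>The power \<open>y ^ k\<close> is there for the induction, which passes the factor
  \<open>y\<close> of \<open>pCons\<close> on to it.\<close>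

lemma poly_exp_tendsto_0:
  fixes p :: "real poly"
  shows "((\<lambda>y. y ^ k * poly p y * exp (- y)) \<longlongrightarrow> 0) at_top"
proof (induction p arbitrary: k)
  case 0 then show ?case by simp
next
  case (pCons a p)
  have "((\<lambda>y. a * (y ^ k / exp y) + y ^ Suc k * poly p y * exp (- y)) \<longlongrightarrow> a * 0 + 0) at_top"
    by (intro tendsto_add tendsto_mult tendsto_const tendsto_power_div_exp_0 pCons.IH)
  then show ?case by (simp add: exp_minus field_simps)
qed

text \<open>For \<open>t > 0\<close> the derivative of \<open>p(1/t) exp(-1/t)\<close> is
  \<open>(p - p')(1/t) exp(-1/t)\<close> divided by the square of \<open>t\<close>; the two
  \<open>pCons 0\<close> account for this square. So the family is closed under differentiation, and
  \<open>flat_exp\<close> is its member for \<open>p = 1\<close>.\<close>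

lemma flat_poly_deriv:
  "(flat_poly p has_real_derivative flat_poly (pCons 0 (pCons 0 (p - pderiv p))) t) (at t)"
proof -
  let ?q = "pCons 0 (pCons 0 (p - pderiv p))"
  consider "t > 0" | "t < 0" | "t = 0" by linarith
  then show ?thesis
  proof cases
    case 1
    have "((\<lambda>t. poly p (1 / t) * exp (- 1 / t)) has_real_derivative flat_poly ?q t) (at t)"
      using 1 by (auto intro!: derivative_eq_intros DERIV_chain2[OF poly_DERIV] simp: flat_poly_def field_simps power2_eq_square)
    moreover have "\<forall>\<^sub>F s in nhds t. poly p (1 / s) * exp (- 1 / s) = flat_poly p s"
      using eventually_nhds_in_open[of "{0<..}" t] 1 by (auto elim!: eventually_mono simp: flat_poly_def)
    ultimately show ?thesis using DERIV_cong_ev[OF refl, of "\<lambda>s. poly p (1 / s) * exp (- 1 / s)" "flat_poly p" t _ _] by blast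
  next
    case 2
    have "((\<lambda>t. 0) has_real_derivative flat_poly ?q t) (at t)" using 2 by (simp add: flat_poly_def)
    moreover have "\<forall>\<^sub>F s in nhds t. 0 = flat_poly p s"
      using eventually_nhds_in_open[of "{..<0}" t] 2 by (auto elim!: eventually_mono simp: flat_poly_def)
    ultimately show ?thesis using DERIV_cong_ev[OF refl, of "\<lambda>s. 0" "flat_poly p" t _ _] by blast
  next
    case 3
    \<comment> \<open>With \<open>y = 1 / h\<close> the right-hand difference quotient at 0 becomes
      this expression; the left-hand one is identically 0.\<close>
    have "((\<lambda>y. y ^ 1 * poly p y * exp (- y)) \<longlongrightarrow> 0) at_top" by (rule poly_exp_tendsto_0)
    moreover have "filterlim (\<lambda>h::real. inverse h) at_top (at_right 0)" by (rule filterlim_inverse_at_top_right)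
    ultimately have "((\<lambda>h. inverse h ^ 1 * poly p (inverse h) * exp (- inverse h)) \<longlongrightarrow> 0) (at_right 0)"
      by (rule filterlim_compose)
    then have r: "((\<lambda>h. (flat_poly p h - flat_poly p 0) / (h - 0)) \<longlongrightarrow> 0) (at_right 0)"
      by (rule Lim_transform_eventually) (auto simp: eventually_at_right_field flat_poly_def field_simps intro: exI[of _ 1])
    have l: "((\<lambda>h. (flat_poly p h - flat_poly p 0) / (h - 0)) \<longlongrightarrow> 0) (at_left 0)"
      by (rule Lim_transform_eventually[OF tendsto_const]) (auto simp: eventually_at_left_field flat_poly_def intro: exI[of _ "-1"])
    have "((\<lambda>h. (flat_poly p h - flat_poly p 0) / (h - 0)) \<longlongrightarrow> 0) (at 0)"
      using l r by (simp add: filterlim_at_split)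
    then show ?thesis using 3 unfolding has_field_derivative_iff by (simp add: flat_poly_def)
  qed
qed

lemma rsmooth_flat_exp:
  assumes X: "euclidean_charts X" and f: "rsmooth X f"
  shows "rsmooth X (\<lambda>p. flat_exp (f p))"
proof -
  let ?D = "\<lambda>k. flat_poly (((\<lambda>p. pCons 0 (pCons 0 (p - pderiv p))) ^^ k) 1)"
  have D: "(?D k has_real_derivative ?D (Suc k) t) (at t)" if "t \<in> UNIV" for k t using flat_poly_deriv by simp
  have "rsmooth X (\<lambda>p. ?D 0 (f p))"
    by (rule rsmooth_compose_real[OF X f, where D = ?D and T = UNIV, OF _ D]) simp_all
  moreover have "?D 0 = flat_exp" by (simp add: flat_poly_def flat_exp_def fun_eq_iff)
  ultimately show ?thesis by simp
qed

section \<open>Bump functions on a manifold\<close>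

context
  fixes X :: "'p manifold"
  assumes X: "smooth_manifold X"
begin

lemma rsmooth_open_submanifold: "openin (mtop X) W \<Longrightarrow> rsmooth X f \<Longrightarrow> rsmooth (open_submanifold X W) f"
  unfolding rsmooth_def by (rule psmooth_fun_open_submanifold[OF X lc_algebra_scalar_algebra])

lemma rsmooth_local:
  assumes "\<And>p. p \<in> points X \<Longrightarrow> \<exists>W. openin (mtop X) W \<and> p \<in> W \<and> rsmooth (open_submanifold X W) f"
  shows "rsmooth X f"
  unfolding rsmooth_def
  by (rule psmooth_fun_local[OF X lc_algebra_scalar_algebra]) (use assms in \<open>auto simp: rsmooth_def\<close>)

text \<open>In another chart the coordinate becomes a component of a transition map.\<close>

lemma rsmooth_chart_coordinate:
  assumes c: "(U, \<phi>) \<in> charts X" and i: "i < mdim X"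
  shows "rsmooth (open_submanifold X U) (\<lambda>p. \<phi> p i)"
  unfolding rsmooth_def psmooth_fun_open_submanifold_iff[OF X lc_algebra_scalar_algebra manifold_chart_openin[OF X c]]
proof safe
  fix V \<psi> assume "(V, \<psi>) \<in> charts X"
  then have "smooth_on (mdim X) (\<psi> ` (V \<inter> U)) real_algebra (\<lambda>x. \<phi> (inv_into V \<psi> x) i)"
    using X c i unfolding smooth_manifold_def by blast
  then show "psmooth (discrete_topology {()}) (mdim X) (\<psi> ` (V \<inter> U)) real_algebra (\<lambda>_ x. \<phi> (inv_into V \<psi> x) i)"
    by (rule smooth_on_imp_psmooth)
qed

lemma rsmooth_continuous:
  assumes f: "rsmooth X f"
  shows "continuous_map (mtop X) euclideanreal f"
proof (rule continuous_map_locally)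
  fix p assume p: "p \<in> points X"
  then obtain U \<phi> where c: "(U, \<phi>) \<in> charts X" "p \<in> U" by (rule chart_cover[OF manifold_charts[OF X]])
  have h: "homeomorphic_map (subtopology (mtop X) U) (subtopology (Euclidean_space (mdim X)) (\<phi> ` U)) \<phi>"
    using X c unfolding smooth_manifold_def by auto
  have ps: "psmooth (discrete_topology {()}) (mdim X) (\<phi> ` U) real_algebra (\<lambda>_ x. f (inv_into U \<phi> x))"
    by (rule psmooth_funD[OF f[unfolded rsmooth_def] c(1)])
  have "smooth_on (mdim X) (\<phi> ` U) real_algebra (\<lambda>x. f (inv_into U \<phi> x))"
    using psmooth_imp_smooth_on[OF ps, of "()"] by simp
  from this[unfolded smooth_on_def, rule_format, OF lists.Nil]
  have "continuous_map (subtopology (Euclidean_space (mdim X)) (\<phi> ` U)) euclideanreal (\<lambda>x. f (inv_into U \<phi> x))" by simp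
  from continuous_map_compose[OF homeomorphic_imp_continuous_map[OF h] this]
  have "continuous_map (subtopology (mtop X) U) euclideanreal (\<lambda>q. f (inv_into U \<phi> (\<phi> q)))" by (simp add: o_def)
  then have "continuous_map (subtopology (mtop X) U) euclideanreal f"
    by (rule continuous_map_eq) (use chart_inj[OF manifold_charts[OF X] c(1)] in auto)
  then show "\<exists>U. openin (mtop X) U \<and> p \<in> U \<and> continuous_map (subtopology (mtop X) U) euclideanreal f"
    using manifold_chart_openin[OF X c(1)] c(2) by blast
qed

lemma rsmooth_openin_less: "rsmooth X f \<Longrightarrow> openin (mtop X) {p \<in> points X. f p < c}"
  and rsmooth_openin_greater: "rsmooth X f \<Longrightarrow> openin (mtop X) {p \<in> points X. f p > c}"
  using openin_continuous_map_preimage[OF rsmooth_continuous, of f "{..<c}"]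
    openin_continuous_map_preimage[OF rsmooth_continuous, of f "{c<..}"] by simp_all

text \<open>In a chart, compose \<open>flat_exp\<close> with \<open>r * r - d\<close> for the
  squared distance \<open>d\<close> from \<open>p0\<close>. The point is that the extension by zero
  is smooth on all of \<open>X\<close>: the set where it may be nonzero must lie in a subset of the
  chart that is closed in \<open>X\<close>, and compactness provides one.\<close>

lemma ex_bump:
  assumes W: "openin (mtop X) W" and p0: "p0 \<in> W"
  shows "\<exists>b. rsmooth X b \<and> (\<forall>p. b p \<ge> 0) \<and> b p0 = 1 \<and> (\<forall>p\<in>points X. b p \<noteq> 0 \<longrightarrow> p \<in> W)"
proof -
  note XC = manifold_charts[OF X]
  have "p0 \<in> points X" using W p0 openin_subset by blast
  then obtain U \<phi> where c: "(U, \<phi>) \<in> charts X" "p0 \<in> U" by (rule chart_cover[OF XC])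
  note Uo = manifold_chart_openin[OF X c(1)]
  note inj = chart_inj[OF XC c(1)]
  let ?n = "mdim X" and ?O = "U \<inter> W"
  have Oo: "openin (mtop X) ?O" using Uo W by auto
  have "openin (Euclidean_space ?n) (\<phi> ` ?O)" by (rule manifold_chart_image_openin[OF X c(1) Oo]) auto
  moreover have "\<phi> p0 \<in> \<phi> ` ?O" using c p0 by auto
  ultimately obtain N K where NK: "openin (Euclidean_space ?n) N" "compactin (Euclidean_space ?n) K" "\<phi> p0 \<in> N" "N \<subseteq> K" "K \<subseteq> \<phi> ` ?O"
    using neighbourhood_base_of_compactin_Euclidean_space[of ?n] unfolding neighbourhood_base_of by meson
  obtain r where r: "r > 0" "\<forall>y\<in>topspace (Euclidean_space ?n). (\<forall>i<?n. \<bar>y i - \<phi> p0 i\<bar> < r) \<longrightarrow> y \<in> N"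
    by (rule openin_Euclidean_box[OF NK(1,3)])
  define d where "d p = (\<Sum>i<?n. (\<phi> p i - \<phi> p0 i) * (\<phi> p i - \<phi> p0 i))" for p
  have dN: "\<phi> p \<in> N" if p: "p \<in> U" and dp: "d p < r * r" for p
  proof -
    have "\<phi> p \<in> topspace (Euclidean_space ?n)" using p openin_subset[OF chart_openin[OF XC c(1)]] by blast
    moreover have "\<bar>\<phi> p i - \<phi> p0 i\<bar> < r" if i: "i < ?n" for i
    proof -
      have "(\<phi> p i - \<phi> p0 i) * (\<phi> p i - \<phi> p0 i) \<le> d p"
        unfolding d_def using i by (intro member_le_sum) auto
      then have "(\<phi> p i - \<phi> p0 i)\<^sup>2 < r\<^sup>2" using dp by (simp add: power2_eq_square)
      then show ?thesis using r(1) by (metis abs_of_pos power2_abs power2_less_imp_less less_imp_le)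
    qed
    ultimately show ?thesis using r(2) by blast
  qed
  have sU: "rsmooth (open_submanifold X U) d"
    unfolding d_def
    by (intro rsmooth_sum rsmooth_mult rsmooth_diff rsmooth_const rsmooth_chart_coordinate[OF c(1)]
        euclidean_charts_open_submanifold[OF X Uo]) auto
  \<comment> \<open>The constant factor is the inverse of the value at \<open>p0\<close>, where
    \<open>d\<close> vanishes.\<close>
  define b where "b p = (if p \<in> U then flat_exp (r * r - d p) * inverse (flat_exp (r * r)) else 0)" for p
  have rr: "flat_exp (r * r) > 0" using r(1) by (intro flat_exp_pos) simp
  let ?K = "{p \<in> U. \<phi> p \<in> K}"
  have h: "homeomorphic_map (subtopology (mtop X) U) (subtopology (Euclidean_space ?n) (\<phi> ` U)) \<phi>"
    using X c unfolding smooth_manifold_def by auto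
  have KU: "K \<subseteq> \<phi> ` U" using NK(5) by blast
  have "compactin (subtopology (Euclidean_space ?n) (\<phi> ` U)) K" using NK(2) KU by (simp add: compactin_subtopology)
  moreover have "\<phi> ` ?K = K" using KU by auto
  ultimately have "compactin (subtopology (mtop X) U) ?K"
    using homeomorphic_map_compactness[OF h, of ?K] openin_subset[OF Uo] by auto
  then have "compactin (mtop X) ?K" by (simp add: compactin_subtopology)
  \<comment> \<open>This uses the Hausdorff property. The complement of \<open>?K\<close> is then
    open; \<open>b\<close> vanishes on it, and together with \<open>U\<close> it covers the
    manifold.\<close>
  then have Kc: "closedin (mtop X) ?K"
    by (rule compactin_imp_closedin[OF X[unfolded smooth_manifold_def, THEN conjunct1]])
  have b0: "b p = 0" if "p \<notin> ?K" for p
  proof (cases "p \<in> U")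
    case True
    then have "\<not> d p < r * r" using dN[OF True] that NK(4) by blast
    then show ?thesis by (simp add: b_def flat_exp_zero)
  qed (simp add: b_def)
  have "rsmooth X b"
  proof (rule rsmooth_local)
    fix p assume p: "p \<in> points X"
    show "\<exists>W. openin (mtop X) W \<and> p \<in> W \<and> rsmooth (open_submanifold X W) b"
    proof (cases "p \<in> U")
      case True
      note UC = euclidean_charts_open_submanifold[OF X Uo]
      have "rsmooth (open_submanifold X U) (\<lambda>p. flat_exp (r * r - d p) * inverse (flat_exp (r * r)))"
        by (intro rsmooth_mult[OF UC] rsmooth_flat_exp[OF UC] rsmooth_diff[OF UC] rsmooth_const[OF UC] sU)
      then have "rsmooth (open_submanifold X U) b"
        by (rule rsmooth_cong[OF UC]) (simp add: points_open_submanifold[OF X Uo] b_def)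
      then show ?thesis using True Uo by blast
    next
      case False
      let ?V = "points X - ?K"
      have Vo: "openin (mtop X) ?V" using Kc by (simp add: openin_diff)
      note VC = euclidean_charts_open_submanifold[OF X Vo]
      have "rsmooth (open_submanifold X ?V) b"
        by (rule rsmooth_cong[OF VC rsmooth_const[OF VC, of 0]]) (simp only: points_open_submanifold[OF X Vo], simp add: b0)
      then show ?thesis using Vo False p by blast
    qed
  qed
  moreover have "b p \<ge> 0" for p using rr by (simp add: b_def flat_exp_nonneg)
  moreover have "b p0 = 1" using c(2) rr by (simp add: b_def d_def)
  moreover have "p \<in> W" if "b p \<noteq> 0" for p
  proof -
    have "p \<in> U" "\<phi> p \<in> K" using b0[of p] that by auto
    then obtain p' where "p' \<in> ?O" "\<phi> p = \<phi> p'" using NK(5) by auto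
    then show ?thesis using inj \<open>p \<in> U\<close> by (metis Int_iff inj_onD)
  qed
  ultimately show ?thesis by blast
qed

end

section \<open>Equivariant functions on a principal bundle\<close>

locale bundle_system = finite_comm_group G + A: lc_algebra A
  for G :: "'g monoid" (structure) and A :: "(complex, 'a) top_algebra" +
  fixes P :: "'p manifold" and M :: "'m manifold" and q :: "'p \<Rightarrow> 'm" and \<sigma> :: "'p \<Rightarrow> 'g \<Rightarrow> 'p"
    and \<pi> :: "'g \<Rightarrow> 'a \<Rightarrow> 'a"
  assumes principal: "principal_bundle P M G q \<sigma>" and action: "smooth_algebra_action G A \<pi>"
begin

abbreviation B where "B \<equiv> smooth_algebra P A"
abbreviation \<alpha> where "\<alpha> \<equiv> bundle_action P \<sigma> \<pi>"

lemma lcA: "lc_algebra A" by (rule A.lc_algebra_axioms)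

lemma manifold_P: "smooth_manifold P"
  using principal unfolding principal_bundle_def by (elim conjE)

lemma charts_P: "euclidean_charts P" by (rule manifold_charts[OF manifold_P])

lemma smooth_map_\<sigma>: "g \<in> carrier G \<Longrightarrow> smooth_map P P (\<lambda>p. \<sigma> p g)"
proof -
  have "smooth_map (times_discrete P (carrier G)) P (\<lambda>(p, g). \<sigma> p g)"
    using principal unfolding principal_bundle_def by (elim conjE)
  then show "g \<in> carrier G \<Longrightarrow> smooth_map P P (\<lambda>p. \<sigma> p g)"
    by (rule smooth_map_times_discrete[OF manifold_P manifold_P])
qed

lemma \<sigma>_in: "p \<in> points P \<Longrightarrow> g \<in> carrier G \<Longrightarrow> \<sigma> p g \<in> points P"
  using continuous_map_in_topspace[OF smooth_map_\<sigma>[of g, unfolded smooth_map_def, THEN conjunct1]] by simp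

lemma \<sigma>_one: "p \<in> points P \<Longrightarrow> \<sigma> p \<one> = p"
  and \<sigma>_mult: "p \<in> points P \<Longrightarrow> g \<in> carrier G \<Longrightarrow> h \<in> carrier G \<Longrightarrow> \<sigma> p (g \<otimes> h) = \<sigma> (\<sigma> p g) h"
  and q_\<sigma>: "p \<in> points P \<Longrightarrow> g \<in> carrier G \<Longrightarrow> q (\<sigma> p g) = q p"
  using principal unfolding principal_bundle_def by blast+

lemma \<pi>_aut: "g \<in> carrier G \<Longrightarrow> algebra_aut A (\<pi> g)"
  and \<pi>_one: "a \<in> carrier A \<Longrightarrow> \<pi> \<one> a = a"
  and \<pi>_mult: "g \<in> carrier G \<Longrightarrow> h \<in> carrier G \<Longrightarrow> a \<in> carrier A \<Longrightarrow> \<pi> (g \<otimes> h) a = \<pi> g (\<pi> h a)"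
  using action unfolding smooth_algebra_action_def algebra_action_def by blast+

lemma \<pi>_hom: "g \<in> carrier G \<Longrightarrow> algebra_hom A A (\<pi> g)"
  using \<pi>_aut unfolding algebra_aut_def by blast

lemma \<pi>_closed: "g \<in> carrier G \<Longrightarrow> a \<in> carrier A \<Longrightarrow> \<pi> g a \<in> carrier A"
  using \<pi>_hom unfolding algebra_hom_def by blast

lemma \<pi>_smult: "g \<in> carrier G \<Longrightarrow> a \<in> carrier A \<Longrightarrow> \<pi> g (c \<odot>\<^bsub>A\<^esub> a) = c \<odot>\<^bsub>A\<^esub> \<pi> g a"
  using \<pi>_hom unfolding algebra_hom_def by blast

lemma \<pi>_unit: "g \<in> carrier G \<Longrightarrow> \<pi> g \<one>\<^bsub>A\<^esub> = \<one>\<^bsub>A\<^esub>"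
  by (rule A.algebra_aut_one[OF \<pi>_aut])

lemma cont_linear_\<pi>:
  assumes g: "g \<in> carrier G"
  shows "cont_linear A A (\<pi> g)"
proof -
  have "lc_smooth A A (\<pi> g)" using action g unfolding smooth_algebra_action_def by blast
  \<comment> \<open>The case without directions: the product has the base point, of index 0, as its
    only factor.\<close>
  from this[unfolded lc_smooth_def, THEN conjunct2, rule_format, of 0]
  have c: "continuous_map (product_topology (\<lambda>_. topo A) {..0}) (topo A) (\<lambda>w. \<pi> g (w (0::nat)))" by simp
  have "continuous_map (topo A) (product_topology (\<lambda>_. topo A) {..0}) (\<lambda>a. \<lambda>i\<in>{..0::nat}. a)"
    by (auto simp: continuous_map_componentwise)
  from continuous_map_compose[OF this c]
  have "continuous_map (topo A) (topo A) (\<pi> g)" by (simp add: o_def)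
  then show ?thesis using \<pi>_hom[OF g] unfolding cont_linear_def algebra_hom_def by blast
qed

lemma psmooth_fun_action:
  assumes g: "g \<in> carrier G" and F: "psmooth_fun Z P A F"
  shows "psmooth_fun Z P A (\<lambda>z p. \<pi> g (F z (\<sigma> p g)))"
  by (rule psmooth_fun_linear[OF charts_P lcA lcA cont_linear_\<pi>[OF g]
        psmooth_fun_compose[OF manifold_P manifold_P smooth_map_\<sigma>[OF g] lcA F]])

lemma lcB: "lc_algebra B" by (rule lc_algebra_smooth_algebra[OF lcA charts_P])

lemma B_closed: "f \<in> carrier B \<Longrightarrow> p \<in> points P \<Longrightarrow> f p \<in> carrier A"
  using smooth_functions_closed[of f P A] by simp

lemma action_closed:
  assumes g: "g \<in> carrier G" and f: "f \<in> carrier B"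
  shows "\<alpha> g f \<in> carrier B"
proof -
  have "psmooth_fun (discrete_topology {()}) P A (\<lambda>_. f)" using f by (intro smooth_functions_imp_psmooth_fun) simp
  from restrict_psmooth_fun(2)[OF charts_P lcA psmooth_fun_action[OF g this], of "()"]
  show ?thesis by (simp add: bundle_action_def)
qed

lemma dynamical_system_B: "dynamical_system G B \<alpha>"
proof -
  have one: "\<alpha> \<one> f = f" if f: "f \<in> carrier B" for f
    unfolding bundle_action_def
    by (rule restrict_eq_smooth_function) (use f B_closed \<sigma>_one \<pi>_one in auto)
  have mult: "\<alpha> (g \<otimes> h) f = \<alpha> g (\<alpha> h f)" if "g \<in> carrier G" "h \<in> carrier G" "f \<in> carrier B" for g h f
    unfolding bundle_action_def
    by (rule restrict_ext) (use that B_closed \<sigma>_mult \<pi>_mult \<sigma>_in in auto)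
  have hom: "algebra_hom B B (\<alpha> g)" if g: "g \<in> carrier G" for g
    unfolding algebra_hom_def
  proof (intro conjI ballI allI)
    show "\<alpha> g \<in> carrier B \<rightarrow> carrier B" using action_closed[OF g] by blast
    note H = \<pi>_hom[OF g, unfolded algebra_hom_def]
    fix f assume f: "f \<in> carrier B"
    show "\<alpha> g (c \<odot>\<^bsub>B\<^esub> f) = c \<odot>\<^bsub>B\<^esub> \<alpha> g f" for c
      unfolding bundle_action_def smooth_algebra_simps
      by (rule restrict_ext) (use H B_closed[OF f] \<sigma>_in g in auto)
    fix f' assume f': "f' \<in> carrier B"
    show "\<alpha> g (f \<oplus>\<^bsub>B\<^esub> f') = \<alpha> g f \<oplus>\<^bsub>B\<^esub> \<alpha> g f'"
      unfolding bundle_action_def smooth_algebra_simps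
      by (rule restrict_ext) (use H B_closed[OF f] B_closed[OF f'] \<sigma>_in g in auto)
    show "\<alpha> g (f \<otimes>\<^bsub>B\<^esub> f') = \<alpha> g f \<otimes>\<^bsub>B\<^esub> \<alpha> g f'"
      unfolding bundle_action_def smooth_algebra_simps
      by (rule restrict_ext) (use H B_closed[OF f] B_closed[OF f'] \<sigma>_in g in auto)
  qed
  have bij: "bij_betw (\<alpha> g) (carrier B) (carrier B)" if g: "g \<in> carrier G" for g
  proof (rule bij_betwI[where g = "\<alpha> (inv g)"])
    show "\<alpha> (inv g) (\<alpha> g f) = f" if "f \<in> carrier B" for f
      using mult[of "inv g" g f] one[OF that] g that by simp
    show "\<alpha> g (\<alpha> (inv g) f) = f" if "f \<in> carrier B" for f
      using mult[of g "inv g" f] one[OF that] g that by simp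
  qed (use action_closed g in auto)
  have "continuous_map (topo B) (topo B) (\<alpha> g)" if g: "g \<in> carrier G" for g
    unfolding smooth_algebra_simps bundle_action_def
    by (rule continuous_map_smooth_compact_open[OF charts_P lcA restrict_psmooth_fun(1)[OF charts_P lcA
          psmooth_fun_action[OF g psmooth_fun_smooth_compact_open[OF charts_P lcA]]]]) simp
  then have "continuous_map (prod_topology (discrete_topology (carrier G)) (topo B)) (topo B) (\<lambda>(g, a). \<alpha> g a)"
    by (rule continuous_map_prod_discrete)
  then show ?thesis
    unfolding dynamical_system_def algebra_action_def algebra_aut_def
    using lcB hom bij one mult by blast
qed

section \<open>Invariant functions in the fixed centre\<close>

definition invariant :: "('p \<Rightarrow> real) \<Rightarrow> bool" where
  "invariant r \<longleftrightarrow> rsmooth P r \<and> (\<forall>p\<in>points P. \<forall>g\<in>carrier G. r (\<sigma> p g) = r p)"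

text \<open>Real functions only, because the argument on characters rests on positivity; complex
  numbers enter there just as values of the character.\<close>

definition emb :: "('p \<Rightarrow> real) \<Rightarrow> 'p \<Rightarrow> 'a" where
  "emb r = (\<lambda>p\<in>points P. of_real (r p) \<odot>\<^bsub>A\<^esub> \<one>\<^bsub>A\<^esub>)"

lemma emb_carrier: "rsmooth P r \<Longrightarrow> emb r \<in> carrier B"
proof -
  assume "rsmooth P r"
  then have "psmooth_fun (discrete_topology {()}) P A (\<lambda>_ p. of_real (r p) \<odot>\<^bsub>A\<^esub> \<one>\<^bsub>A\<^esub>)"
    unfolding rsmooth_def
    by (intro psmooth_fun_bilinear[OF charts_P lc_algebra_scalar_algebra lcA lcA A.cont_bilinear_real_smult]
        psmooth_fun_const[OF charts_P lcA]) auto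
  from restrict_psmooth_fun(2)[OF charts_P lcA this, of "()"] show ?thesis by (simp add: emb_def)
qed

lemma emb_fixed_center:
  assumes r: "invariant r"
  shows "emb r \<in> fixed_center G B \<alpha>"
proof -
  have rB: "emb r \<in> carrier B" using emb_carrier r unfolding invariant_def by blast
  have "emb r \<otimes>\<^bsub>B\<^esub> f = f \<otimes>\<^bsub>B\<^esub> emb r" if f: "f \<in> carrier B" for f
    unfolding smooth_algebra_simps
    by (rule restrict_ext) (use B_closed[OF f] in \<open>simp add: emb_def A.smult_mult_left A.smult_mult_right\<close>)
  moreover have "\<alpha> g (emb r) = emb r" if g: "g \<in> carrier G" for g
    unfolding bundle_action_def emb_def
    by (rule restrict_ext) (use r g \<sigma>_in \<pi>_smult \<pi>_unit in \<open>simp add: invariant_def\<close>)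
  ultimately show ?thesis using rB unfolding fixed_center_def center_def by blast
qed

lemma emb_add: "emb (\<lambda>p. r p + s p) = emb r \<oplus>\<^bsub>B\<^esub> emb s"
  unfolding emb_def smooth_algebra_simps by (rule restrict_ext) (simp add: A.smult_add_left)

lemma emb_mult: "emb (\<lambda>p. r p * s p) = emb r \<otimes>\<^bsub>B\<^esub> emb s"
  unfolding emb_def smooth_algebra_simps
  by (rule restrict_ext) (simp add: A.smult_mult_left A.smult_mult_right A.smult_smult mult_ac)

lemma emb_scale: "emb (\<lambda>p. c * r p) = of_real c \<odot>\<^bsub>B\<^esub> emb r"
  unfolding emb_def smooth_algebra_simps by (rule restrict_ext) (simp add: A.smult_smult)

lemma emb_one: "emb (\<lambda>p. 1) = \<one>\<^bsub>B\<^esub>"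
  unfolding emb_def smooth_algebra_simps by (rule restrict_ext) simp

lemma emb_cong: "(\<And>p. p \<in> points P \<Longrightarrow> r p = s p) \<Longrightarrow> emb r = emb s"
  unfolding emb_def by (rule restrict_ext) simp

lemma invariant_const: "invariant (\<lambda>p. c)"
  and invariant_add: "invariant r \<Longrightarrow> invariant s \<Longrightarrow> invariant (\<lambda>p. r p + s p)"
  and invariant_mult: "invariant r \<Longrightarrow> invariant s \<Longrightarrow> invariant (\<lambda>p. r p * s p)"
  and invariant_diff: "invariant r \<Longrightarrow> invariant s \<Longrightarrow> invariant (\<lambda>p. r p - s p)"
  and invariant_flat_exp: "invariant r \<Longrightarrow> invariant (\<lambda>p. flat_exp (r p))"
  unfolding invariant_def
  by (auto intro: rsmooth_const[OF charts_P] rsmooth_add[OF charts_P] rsmooth_mult[OF charts_P]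
      rsmooth_diff[OF charts_P] rsmooth_flat_exp[OF charts_P])

lemma invariant_sum: "finite S \<Longrightarrow> (\<And>i. i \<in> S \<Longrightarrow> invariant (f i)) \<Longrightarrow> invariant (\<lambda>p. \<Sum>i\<in>S. f i p)"
  and invariant_prod: "finite S \<Longrightarrow> (\<And>i. i \<in> S \<Longrightarrow> invariant (f i)) \<Longrightarrow> invariant (\<lambda>p. \<Prod>i\<in>S. f i p)"
  unfolding invariant_def by (auto intro!: rsmooth_sum[OF charts_P] rsmooth_prod[OF charts_P])

lemma invariant_inverse: "invariant r \<Longrightarrow> (\<And>p. p \<in> points P \<Longrightarrow> r p > 0) \<Longrightarrow> invariant (\<lambda>p. inverse (r p))"
  unfolding invariant_def by (auto intro: rsmooth_inverse[OF charts_P])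

text \<open>Acting by \<open>h\<close> permutes the summands through left multiplication by
  \<open>h\<close>.\<close>

lemma invariant_average:
  assumes b: "rsmooth P b"
  shows "invariant (\<lambda>p. \<Sum>g\<in>carrier G. b (\<sigma> p g))"
  unfolding invariant_def
proof (intro conjI ballI)
  have "rsmooth P (\<lambda>p. b (\<sigma> p g))" if "g \<in> carrier G" for g
    using psmooth_fun_compose[OF manifold_P manifold_P smooth_map_\<sigma>[OF that] lc_algebra_scalar_algebra b[unfolded rsmooth_def]]
    unfolding rsmooth_def .
  then show "rsmooth P (\<lambda>p. \<Sum>g\<in>carrier G. b (\<sigma> p g))" using finite_carrier by (intro rsmooth_sum[OF charts_P])
  fix p h assume p: "p \<in> points P" and h: "h \<in> carrier G"
  have "(\<Sum>g\<in>carrier G. b (\<sigma> (\<sigma> p h) g)) = (\<Sum>g\<in>carrier G. b (\<sigma> p (h \<otimes> g)))"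
    using \<sigma>_mult[OF p h] by simp
  also have "\<dots> = (\<Sum>g\<in>carrier G. b (\<sigma> p g))"
  proof (rule sum.reindex_bij_betw[of "\<lambda>g. h \<otimes> g" "carrier G" "carrier G" "\<lambda>g. b (\<sigma> p g)"])
    show "bij_betw (\<lambda>g. h \<otimes> g) (carrier G) (carrier G)"
      by (rule bij_betwI[where g = "\<lambda>g. inv h \<otimes> g"]) (use h in \<open>auto simp: m_assoc[symmetric]\<close>)
  qed
  finally show "(\<Sum>g\<in>carrier G. b (\<sigma> (\<sigma> p h) g)) = (\<Sum>g\<in>carrier G. b (\<sigma> p g))" .
qed

text \<open>A trivialization seen from above: \<open>U\<close> is saturated, \<gamma> is
  equivariant, and it is locally constant since its fibres are open. The points with
  \<open>\<gamma> p = \<one>\<close> form the section, one in each orbit in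
  \<open>U\<close>.\<close>

definition local_section :: "'p set \<Rightarrow> ('p \<Rightarrow> 'g) \<Rightarrow> bool" where
  "local_section U \<gamma> \<longleftrightarrow> openin (mtop P) U \<and> \<gamma> \<in> U \<rightarrow> carrier G \<and>
     (\<forall>p\<in>points P. \<forall>g\<in>carrier G. \<sigma> p g \<in> U \<longleftrightarrow> p \<in> U) \<and>
     (\<forall>p\<in>U. \<forall>g\<in>carrier G. \<gamma> (\<sigma> p g) = \<gamma> p \<otimes> g) \<and>
     (\<forall>g\<in>carrier G. openin (mtop P) {p \<in> U. \<gamma> p = g})"

text \<open>\<gamma> is the group component of a trivialization; as the group is discrete, its
  continuity means that its fibres are open.\<close>

lemma ex_local_section:
  assumes p0: "p0 \<in> points P"
  shows "\<exists>U \<gamma>. local_section U \<gamma> \<and> p0 \<in> U"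
proof -
  have qc: "continuous_map (mtop P) (mtop M) q"
    using principal unfolding principal_bundle_def smooth_map_def by blast
  have "\<forall>m\<in>points M. \<exists>U \<Phi>. openin (mtop M) U \<and> m \<in> U \<and>
        diffeomorphism (open_submanifold P {p \<in> points P. q p \<in> U})
          (times_discrete (open_submanifold M U) (carrier G)) \<Phi> \<and>
        (\<forall>p\<in>points P. q p \<in> U \<longrightarrow> fst (\<Phi> p) = q p \<and>
           (\<forall>g\<in>carrier G. \<Phi> (\<sigma> p g) = (q p, snd (\<Phi> p) \<otimes> g)))"
    using principal unfolding principal_bundle_def by (elim conjE)
  from this[THEN bspec, OF continuous_map_in_topspace[OF qc p0]] obtain V \<Phi> where V: "openin (mtop M) V" "q p0 \<in> V"
    and diff: "diffeomorphism (open_submanifold P {p \<in> points P. q p \<in> V}) (times_discrete (open_submanifold M V) (carrier G)) \<Phi>"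
    and eq: "\<forall>p\<in>points P. q p \<in> V \<longrightarrow> fst (\<Phi> p) = q p \<and> (\<forall>g\<in>carrier G. \<Phi> (\<sigma> p g) = (q p, snd (\<Phi> p) \<otimes> g))"
    by (elim exE conjE)
  let ?U = "{p \<in> points P. q p \<in> V}" and ?\<gamma> = "\<lambda>p. snd (\<Phi> p)"
  have Uo: "openin (mtop P) ?U" using qc V(1) by (rule openin_continuous_map_preimage)
  have "continuous_map (subtopology (mtop P) ?U) (prod_topology (subtopology (mtop M) V) (discrete_topology (carrier G))) \<Phi>"
    using diff unfolding diffeomorphism_def smooth_map_def by (simp add: open_submanifold_def times_discrete_def)
  from continuous_map_compose[OF this continuous_map_snd]
  have gc: "continuous_map (subtopology (mtop P) ?U) (discrete_topology (carrier G)) ?\<gamma>" by (simp add: o_def)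
  have "?\<gamma> \<in> ?U \<rightarrow> carrier G"
    using continuous_map_in_topspace[OF gc] by auto
  moreover have "openin (mtop P) {p \<in> ?U. ?\<gamma> p = g}" if g: "g \<in> carrier G" for g
  proof -
    have "openin (subtopology (mtop P) ?U) {p \<in> topspace (subtopology (mtop P) ?U). ?\<gamma> p \<in> {g}}"
      using gc by (rule openin_continuous_map_preimage) (use g in simp)
    then have "openin (mtop P) {p \<in> topspace (subtopology (mtop P) ?U). ?\<gamma> p \<in> {g}}"
      using openin_open_subtopology[OF Uo] by blast
    moreover have "{p \<in> topspace (subtopology (mtop P) ?U). ?\<gamma> p \<in> {g}} = {p \<in> ?U. ?\<gamma> p = g}" by auto
    ultimately show ?thesis by simp
  qed
  moreover have "\<forall>p\<in>points P. \<forall>g\<in>carrier G. \<sigma> p g \<in> ?U \<longleftrightarrow> p \<in> ?U" using \<sigma>_in q_\<sigma> by auto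
  moreover have "\<forall>p\<in>?U. \<forall>g\<in>carrier G. ?\<gamma> (\<sigma> p g) = ?\<gamma> p \<otimes> g" using eq by auto
  ultimately have "local_section ?U ?\<gamma>" using Uo unfolding local_section_def by blast
  then show ?thesis using p0 V(2) by (intro exI[of _ ?U] exI[of _ ?\<gamma>]) simp
qed

text \<open>The cut-off \<open>u\<close> makes the locally constant section a global element without changing it
  where \<open>v\<close> does not vanish.\<close>

definition good :: "('p \<Rightarrow> real) \<Rightarrow> bool" where
  "good v \<longleftrightarrow> invariant v \<and> (\<exists>u U \<gamma> W. invariant u \<and> local_section U \<gamma> \<and> openin (mtop P) W \<and>
     points P \<subseteq> U \<union> W \<and> (\<forall>p\<in>W. u p = 0) \<and> (\<forall>p\<in>points P. v p \<noteq> 0 \<longrightarrow> u p = 1))"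

text \<open>The set where the product is nonzero only shrinks, so the same cut-off and section
  serve.\<close>

lemma good_mult:
  assumes "good v" "invariant r"
  shows "good (\<lambda>p. v p * r p)"
proof -
  from assms(1) obtain u U \<gamma> W where v: "invariant v" and u: "invariant u" "local_section U \<gamma>" "openin (mtop P) W"
     "points P \<subseteq> U \<union> W" "\<forall>p\<in>W. u p = 0" "\<forall>p\<in>points P. v p \<noteq> 0 \<longrightarrow> u p = 1"
    unfolding good_def by (elim exE conjE)
  have "\<forall>p\<in>points P. v p * r p \<noteq> 0 \<longrightarrow> u p = 1" using u(6) by simp
  with invariant_mult[OF v assms(2)] u(1-5) show ?thesis
    unfolding good_def by (intro conjI exI)
qed

lemma ex_good:
  assumes p0: "p0 \<in> points P"
  shows "\<exists>v. good v \<and> (\<forall>p. v p \<ge> 0) \<and> v p0 > 0"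
proof -
  obtain U \<gamma> where U: "local_section U \<gamma>" "p0 \<in> U" using ex_local_section[OF p0] by blast
  have Uo: "openin (mtop P) U" using U(1) unfolding local_section_def by blast
  obtain b where b: "rsmooth P b" "\<forall>p. b p \<ge> 0" "b p0 = 1" "\<forall>p\<in>points P. b p \<noteq> 0 \<longrightarrow> p \<in> U"
    using ex_bump[OF manifold_P Uo U(2)] by blast
  \<comment> \<open>Averaging makes \<open>b\<close> invariant. As \<open>U\<close> is saturated the
    average still vanishes outside \<open>U\<close>, and the summand of \<open>\<one>\<close> alone
    gives \<open>w p0 \<ge> 1\<close>.\<close>
  define w where "w p = (\<Sum>g\<in>carrier G. b (\<sigma> p g))" for p
  have w: "invariant w" unfolding w_def by (rule invariant_average[OF b(1)])
  have wp0: "w p0 \<ge> 1"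
  proof -
    have "b (\<sigma> p0 \<one>) \<le> w p0" unfolding w_def using b(2) finite_carrier by (intro member_le_sum) auto
    then show ?thesis using \<sigma>_one[OF p0] b(3) by simp
  qed
  have w0: "w p = 0" if p: "p \<in> points P" "p \<notin> U" for p
    unfolding w_def
  proof (rule sum.neutral, rule ballI)
    fix g assume g: "g \<in> carrier G"
    have "\<sigma> p g \<notin> U" using U(1) p g unfolding local_section_def by blast
    then show "b (\<sigma> p g) = 0" using b(4) \<sigma>_in[OF p(1) g] by blast
  qed
  \<comment> \<open>Two levels of \<open>w\<close> separate the functions: \<open>v\<close> lives
    where \<open>w > 1/2\<close>, and \<open>u\<close> is the usual smooth transition from 0, for
    \<open>w \<le> 1/4\<close>, to 1, for \<open>w \<ge> 1/2\<close>. The conditions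
    \<open>w > 1/4\<close> and \<open>w < 1/2\<close> together cover all values, so the denominator
    is positive.\<close>
  define v where "v p = flat_exp (w p - 1 / 2)" for p
  define u where "u p = flat_exp (w p - 1 / 4) * inverse (flat_exp (w p - 1 / 4) + flat_exp (1 / 2 - w p))" for p
  have pos: "flat_exp (w p - 1 / 4) + flat_exp (1 / 2 - w p) > 0" for p
  proof (cases "w p > 1 / 4")
    case True then show ?thesis using flat_exp_pos[of "w p - 1 / 4"] flat_exp_nonneg[of "1 / 2 - w p"] by simp
  next
    case False then show ?thesis using flat_exp_pos[of "1 / 2 - w p"] flat_exp_nonneg[of "w p - 1 / 4"] by simp
  qed
  have "invariant v" unfolding v_def by (intro invariant_flat_exp invariant_diff w invariant_const)
  moreover have "invariant u" unfolding u_def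
    by (intro invariant_mult invariant_inverse invariant_add invariant_flat_exp invariant_diff w invariant_const pos)
  moreover have "openin (mtop P) {p \<in> points P. w p < 1 / 4}"
    using w unfolding invariant_def by (blast intro: rsmooth_openin_less[OF manifold_P])
  moreover have "points P \<subseteq> U \<union> {p \<in> points P. w p < 1 / 4}" using w0 by fastforce
  moreover have "\<forall>p\<in>{p \<in> points P. w p < 1 / 4}. u p = 0" by (auto simp: u_def flat_exp_zero)
  moreover have "\<forall>p\<in>points P. v p \<noteq> 0 \<longrightarrow> u p = 1"
  proof (intro ballI impI)
    fix p assume vp: "v p \<noteq> 0"
    have "w p > 1 / 2" using vp flat_exp_zero[of "w p - 1 / 2"] unfolding v_def by (cases "w p > 1 / 2") auto
    then have "flat_exp (1 / 2 - w p) = 0" by (intro flat_exp_zero) simp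
    then show "u p = 1" using pos[of p] unfolding u_def by simp
  qed
  ultimately have "good v" using U(1) unfolding good_def
    by (intro conjI exI[of _ u] exI[of _ U] exI[of _ \<gamma>] exI[of _ "{p \<in> points P. w p < 1 / 4}"])
  moreover have "v p0 > 0" unfolding v_def using wp0 by (intro flat_exp_pos) simp
  ultimately show ?thesis using flat_exp_nonneg unfolding v_def by blast
qed

section \<open>Trivialising the localization at a good function\<close>

lemma minus_B: "f \<in> carrier B \<Longrightarrow> f' \<in> carrier B \<Longrightarrow> p \<in> points P \<Longrightarrow> (f \<ominus>\<^bsub>B\<^esub> f') p = f p \<ominus>\<^bsub>A\<^esub> f' p"
proof -
  assume f: "f \<in> carrier B" "f' \<in> carrier B" and p: "p \<in> points P"
  interpret BB: lc_algebra B by (rule lcB)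
  have d: "f \<ominus>\<^bsub>B\<^esub> f' \<in> carrier B" using f by (rule BB.minus_closed)
  have "(f \<ominus>\<^bsub>B\<^esub> f') \<oplus>\<^bsub>B\<^esub> f' = f" using f by (simp add: a_minus_def BB.a_assoc BB.l_neg del: smooth_algebra_simps)
  then have "((f \<ominus>\<^bsub>B\<^esub> f') \<oplus>\<^bsub>B\<^esub> f') p = f p" by (simp only:)
  then have "(f \<ominus>\<^bsub>B\<^esub> f') p \<oplus>\<^bsub>A\<^esub> f' p = f p" using p by simp
  then show ?thesis
    using B_closed[OF d p] B_closed[OF f(2) p] by (metis A.add.inv_closed A.add.m_assoc A.r_neg A.r_zero a_minus_def)
qed

text \<open>Multiples of the unit are chosen because \<open>\<pi> g\<close> fixes the unit, so that
  equivariance depends on \<gamma> alone. The order of \<open>s\<close> enters through its dual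
  character, whose values have power 1 for this exponent.\<close>

lemma good_trivial:
  assumes v: "good v"
  shows "trivial_nc_principal_bundle G (smooth_localization B (emb v)) (localized_action B (emb v) \<alpha>)"
proof -
  obtain u U \<gamma> W where u: "invariant u" and sec: "local_section U \<gamma>" and W: "openin (mtop P) W"
    and UW: "points P \<subseteq> U \<union> W" and u0: "\<forall>p\<in>W. u p = 0" and u1: "\<forall>p\<in>points P. v p \<noteq> 0 \<longrightarrow> u p = 1"
    using v unfolding good_def by (elim exE conjE)
  have vi: "invariant v" using v unfolding good_def by (elim conjE)
  have Uo: "openin (mtop P) U" and \<gamma>: "\<And>p. p \<in> U \<Longrightarrow> \<gamma> p \<in> carrier G"
    and Uinv: "\<And>p g. p \<in> points P \<Longrightarrow> g \<in> carrier G \<Longrightarrow> \<sigma> p g \<in> U \<longleftrightarrow> p \<in> U"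
    and \<gamma>m: "\<And>p g. p \<in> U \<Longrightarrow> g \<in> carrier G \<Longrightarrow> \<gamma> (\<sigma> p g) = \<gamma> p \<otimes> g"
    and \<gamma>o: "\<And>g. g \<in> carrier G \<Longrightarrow> openin (mtop P) {p \<in> U. \<gamma> p = g}"
    using sec unfolding local_section_def by auto
  interpret BB: lc_algebra B by (rule lcB)
  interpret L: localization_system G B \<alpha> "emb v"
    using lcB dynamical_system_B emb_fixed_center[OF vi]
    by (simp add: localization_system_def localization_system_axioms_def is_group)
  obtain S where S: "minimal_generators G S" "internal_cyclic_product G S"
    using ex_minimal_internal_cyclic_product by blast
  have "\<exists>x\<in>isotypic G (smooth_localization B (emb v)) (localized_action B (emb v) \<alpha>) (dual_generator G S s).
       x \<in> Units (smooth_localization B (emb v)) \<and> x [^]\<^bsub>smooth_localization B (emb v)\<^esub> ord s = \<one>\<^bsub>smooth_localization B (emb v)\<^esub>"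
    if s: "s \<in> S" for s
  proof -
    let ?\<chi> = "dual_generator G S s"
    have \<chi>: "?\<chi> \<in> hom G circle_group" "\<And>g. g \<in> carrier G \<Longrightarrow> ?\<chi> g ^ ord s = 1"
      using dual_generator[OF S s] by auto
    have \<chi>m: "?\<chi> (g \<otimes> h) = ?\<chi> g * ?\<chi> h" if "g \<in> carrier G" "h \<in> carrier G" for g h
      using hom_mult[OF \<chi>(1) that] by (simp add: circle_group_def)
    have sc: "s \<in> carrier G" using S(1) s unfolding minimal_generators_def by blast
    have n: "ord s > 0" using ord_ge_1[OF finite_carrier sc] by simp
    define a0 where "a0 p = (if p \<in> U then (of_real (u p) * ?\<chi> (\<gamma> p)) \<odot>\<^bsub>A\<^esub> \<one>\<^bsub>A\<^esub> else \<zero>\<^bsub>A\<^esub>)" for p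
    define a where "a = restrict a0 (points P)"
    \<comment> \<open>On an open fibre of \<gamma> the character value is constant and
      \<open>a0\<close> inherits smoothness from \<open>u\<close>; a point outside \<open>U\<close>
      lies in \<open>W\<close>, where \<open>u\<close> and hence \<open>a0\<close> vanishes.\<close>
    have "psmooth_fun (discrete_topology {()}) P A (\<lambda>_. a0)"
    proof (rule psmooth_fun_local[OF manifold_P lcA])
      fix p assume p: "p \<in> points P"
      show "\<exists>W. openin (mtop P) W \<and> p \<in> W \<and> psmooth_fun (discrete_topology {()}) (open_submanifold P W) A (\<lambda>_. a0)"
      proof (cases "p \<in> U")
        case True
        let ?V = "{p' \<in> U. \<gamma> p' = \<gamma> p}"
        have Vo: "openin (mtop P) ?V" using \<gamma>o \<gamma>[OF True] by blast
        note VC = euclidean_charts_open_submanifold[OF manifold_P Vo]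
        have "rsmooth (open_submanifold P ?V) u"
          using rsmooth_open_submanifold[OF manifold_P Vo] u unfolding invariant_def by blast
        then have "psmooth_fun (discrete_topology {()}) (open_submanifold P ?V) A (\<lambda>_ p'. of_real (u p') \<odot>\<^bsub>A\<^esub> (?\<chi> (\<gamma> p) \<odot>\<^bsub>A\<^esub> \<one>\<^bsub>A\<^esub>))"
          unfolding rsmooth_def
          by (intro psmooth_fun_bilinear[OF VC lc_algebra_scalar_algebra lcA lcA A.cont_bilinear_real_smult] psmooth_fun_const[OF VC lcA]) auto
        then have "psmooth_fun (discrete_topology {()}) (open_submanifold P ?V) A (\<lambda>_. a0)"
        proof (rule psmooth_fun_cong[OF VC lcA])
          fix p' assume "p' \<in> points (open_submanifold P ?V)"
          then have "p' \<in> ?V" by (simp only: points_open_submanifold[OF manifold_P Vo])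
          then show "of_real (u p') \<odot>\<^bsub>A\<^esub> (?\<chi> (\<gamma> p) \<odot>\<^bsub>A\<^esub> \<one>\<^bsub>A\<^esub>) = a0 p'"
            unfolding a0_def by (simp add: A.smult_smult)
        qed
        then show ?thesis using Vo True by blast
      next
        case False
        then have pW: "p \<in> W" using UW p by blast
        note WC = euclidean_charts_open_submanifold[OF manifold_P W]
        have "psmooth_fun (discrete_topology {()}) (open_submanifold P W) A (\<lambda>_. a0)"
        proof (rule psmooth_fun_cong[OF WC lcA psmooth_fun_const[OF WC lcA A.zero_closed]])
          fix p' assume "p' \<in> points (open_submanifold P W)"
          then have "p' \<in> W" by (simp only: points_open_submanifold[OF manifold_P W])
          then show "\<zero>\<^bsub>A\<^esub> = a0 p'" unfolding a0_def using u0 by simp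
        qed
        then show ?thesis using W pW by blast
      qed
    qed
    from restrict_psmooth_fun(2)[OF charts_P lcA this, of "()"] have aB: "a \<in> carrier B" by (simp add: a_def)
    have "\<alpha> g a = ?\<chi> g \<odot>\<^bsub>B\<^esub> a" if g: "g \<in> carrier G" for g
      unfolding bundle_action_def smooth_algebra_simps
    proof (rule restrict_ext)
      fix p assume p: "p \<in> points P"
      show "\<pi> g (a (\<sigma> p g)) = ?\<chi> g \<odot>\<^bsub>A\<^esub> a p"
      proof (cases "p \<in> U")
        case True
        have "u (\<sigma> p g) = u p" using u p g unfolding invariant_def by blast
        then have "a (\<sigma> p g) = (of_real (u p) * (?\<chi> (\<gamma> p) * ?\<chi> g)) \<odot>\<^bsub>A\<^esub> \<one>\<^bsub>A\<^esub>"
          using True Uinv[OF p g] \<sigma>_in[OF p g] \<gamma>m[OF True g] \<chi>m[OF \<gamma>[OF True] g] by (simp add: a_def a0_def)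
        then show ?thesis
          using True p g by (simp add: \<pi>_smult \<pi>_unit a_def a0_def A.smult_smult mult_ac)
      next
        case False
        have "\<pi> g \<zero>\<^bsub>A\<^esub> = \<zero>\<^bsub>A\<^esub>" using \<pi>_smult[OF g A.zero_closed, of 0] \<pi>_closed[OF g A.zero_closed] by simp
        then show ?thesis using False p Uinv[OF p g] \<sigma>_in[OF p g] by (simp add: a_def a0_def)
      qed
    qed
    then have iso: "a \<in> isotypic G B \<alpha> ?\<chi>" using aB unfolding isotypic_def by blast
    have pw: "(a [^]\<^bsub>B\<^esub> k) p = (of_real (u p) * ?\<chi> (\<gamma> p)) ^ k \<odot>\<^bsub>A\<^esub> \<one>\<^bsub>A\<^esub>" if p: "p \<in> points P" "p \<in> U" for p and k :: nat
    proof (induction k)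
      case 0 then show ?case using p by simp
    next
      case (Suc k)
      have "(a [^]\<^bsub>B\<^esub> Suc k) p = (a [^]\<^bsub>B\<^esub> k) p \<otimes>\<^bsub>A\<^esub> a p" using p by simp
      also have "\<dots> = (of_real (u p) * ?\<chi> (\<gamma> p)) ^ Suc k \<odot>\<^bsub>A\<^esub> \<one>\<^bsub>A\<^esub>"
        unfolding Suc using p by (simp add: a_def a0_def A.smult_mult_left A.smult_mult_right A.smult_smult mult_ac)
      finally show ?case .
    qed
    have an: "a [^]\<^bsub>B\<^esub> ord s \<in> carrier B" using aB by (rule BB.nat_pow_closed)
    have "emb v \<otimes>\<^bsub>B\<^esub> (a [^]\<^bsub>B\<^esub> ord s \<ominus>\<^bsub>B\<^esub> \<one>\<^bsub>B\<^esub>) = \<zero>\<^bsub>B\<^esub>"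
      unfolding smooth_algebra_simps(2,4)
    proof (rule restrict_ext)
      fix p assume p: "p \<in> points P"
      have d: "(a [^]\<^bsub>B\<^esub> ord s \<ominus>\<^bsub>B\<^esub> \<one>\<^bsub>B\<^esub>) p = (a [^]\<^bsub>B\<^esub> ord s) p \<ominus>\<^bsub>A\<^esub> \<one>\<^bsub>A\<^esub>"
        using minus_B[OF an BB.one_closed p] p by simp
      show "emb v p \<otimes>\<^bsub>A\<^esub> (a [^]\<^bsub>B\<^esub> ord s \<ominus>\<^bsub>B\<^esub> \<one>\<^bsub>B\<^esub>) p = \<zero>\<^bsub>A\<^esub>"
      proof (cases "v p = 0")
        case True
        then have "emb v p = \<zero>\<^bsub>A\<^esub>" using p by (simp add: emb_def)
        then show ?thesis unfolding d using B_closed[OF an p] by simp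
      next
        case False
        \<comment> \<open>Since \<open>u\<close> vanishes on \<open>W\<close>, the point lies
          outside \<open>W\<close> and therefore in \<open>U\<close>; there the power reduces to
          that of a character value.\<close>
        then have up: "u p = 1" using u1 p by blast
        then have pU: "p \<in> U" using UW u0 p by force
        have "(a [^]\<^bsub>B\<^esub> ord s) p = \<one>\<^bsub>A\<^esub>" using pw[OF p pU, of "ord s"] up \<chi>(2)[OF \<gamma>[OF pU]] by simp
        then show ?thesis unfolding d using p by (simp add: emb_def)
      qed
    qed
    then show ?thesis
      using L.const_in_isotypic[OF iso] L.const_unit[OF aB n] by blast
  qed
  then show ?thesis
    unfolding trivial_nc_principal_bundle_def using L.dynamical_system_localization S by blast
qed

end

section \<open>Characters\<close>

context bundle_system
begin

text \<open>Second countability gives the Lindelof property, so countably many sets of positivity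
  cover. Nonemptiness allows them to be enumerated by all of \<open>nat\<close>, with repetitions if
  need be.\<close>

lemma ex_good_sequence:
  assumes ne: "points P \<noteq> {}"
  shows "\<exists>v. (\<forall>n::nat. good (v n) \<and> (\<forall>p. v n p \<ge> 0)) \<and> (\<forall>p\<in>points P. \<exists>n. v n p > 0)"
proof -
  let ?ok = "\<lambda>v. good v \<and> (\<forall>p. v p \<ge> 0)"
  let ?\<U> = "{{p \<in> points P. v p > 0} | v. ?ok v}"
  have "openin (mtop P) {p \<in> points P. v p > 0}" if "?ok v" for v
    using that rsmooth_openin_greater[OF manifold_P, of v 0] unfolding good_def invariant_def by (elim conjE)
  then have op: "\<forall>U\<in>?\<U>. openin (mtop P) U" by blast
  have cov: "\<Union>?\<U> = points P"
  proof
    show "points P \<subseteq> \<Union>?\<U>"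
    proof
      fix p assume p: "p \<in> points P"
      obtain v where "?ok v" "v p > 0" using ex_good[OF p] by blast
      then show "p \<in> \<Union>?\<U>" using p by (intro UnionI[of "{p \<in> points P. v p > 0}"]) auto
    qed
  qed auto
  have "second_countable (mtop P)" using manifold_P unfolding smooth_manifold_def by (elim conjE)
  then have "Lindelof_space (mtop P)" by (rule second_countable_imp_Lindelof_space)
  then obtain \<V> where \<V>: "countable \<V>" "\<V> \<subseteq> ?\<U>" "\<Union>\<V> = points P"
    using op cov unfolding Lindelof_space_def by meson
  have ne\<V>: "\<V> \<noteq> {}" using \<V>(3) ne by (metis Union_empty)
  have "\<exists>v. ?ok v \<and> from_nat_into \<V> n = {p \<in> points P. v p > 0}" for n
    using from_nat_into[OF ne\<V>, of n] \<V>(2) by blast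
  then obtain v where v: "\<And>n. ?ok (v n)" "\<And>n. from_nat_into \<V> n = {p \<in> points P. v n p > 0}" by metis
  have "\<exists>n. v n p > 0" if p: "p \<in> points P" for p
  proof -
    obtain V where V: "V \<in> \<V>" "p \<in> V" using \<V>(3) p by blast
    obtain n where "from_nat_into \<V> n = V" using from_nat_into_surj[OF \<V>(1) V(1)] by blast
    then show ?thesis using V(2) v(2)[of n] by blast
  qed
  then show ?thesis using v(1) by blast
qed

text \<open>Damping the \<open>n\<close>-th function by \<open>flat_exp (1 / (n + 1) - v j)\<close> for \<open>j < n\<close> makes the
  family locally finite: it vanishes eventually near any point where some \<open>v j\<close> is positive.\<close>

lemma ex_locally_finite_good_sequence:
  assumes ne: "points P \<noteq> {}"
  shows "\<exists>w. (\<forall>n::nat. good (w n) \<and> (\<forall>p. w n p \<ge> 0)) \<and> (\<forall>p\<in>points P. \<exists>n. w n p > 0) \<and>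
    (\<forall>p\<in>points P. \<exists>W N. openin (mtop P) W \<and> p \<in> W \<and> (\<forall>p'\<in>W. \<forall>n\<ge>N. w n p' = 0))"
proof -
  obtain v where v: "\<And>n::nat. good (v n)" "\<And>n p. v n p \<ge> 0" "\<And>p. p \<in> points P \<Longrightarrow> \<exists>n. v n p > 0"
    using ex_good_sequence[OF ne] by blast
  have vi: "invariant (v n)" for n using v(1)[of n] unfolding good_def by (elim conjE)
  define w where "w n p = v n p * (\<Prod>j<n. flat_exp (1 / real (Suc n) - v j p))" for n p
  have 1: "good (w n)" for n
    unfolding w_def by (intro good_mult v(1) invariant_prod invariant_flat_exp invariant_diff invariant_const vi) auto
  have 2: "w n p \<ge> 0" for n p
    unfolding w_def using v(2) by (intro mult_nonneg_nonneg prod_nonneg) (auto simp: flat_exp_nonneg)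
  have 3: "\<exists>n. w n p > 0" if p: "p \<in> points P" for p
  proof -
    \<comment> \<open>At the first index with \<open>v n p > 0\<close> all earlier functions vanish,
      so no damping factor is zero.\<close>
    define n where "n = (LEAST n. v n p > 0)"
    have vn: "v n p > 0" unfolding n_def using v(3)[OF p] by (rule LeastI_ex)
    have "flat_exp (1 / real (Suc n) - v j p) > 0" if "j < n" for j
    proof -
      have "v j p = 0" using not_less_Least[OF that[unfolded n_def]] v(2)[of j p] by linarith
      then show ?thesis by (intro flat_exp_pos) simp
    qed
    then have "(\<Prod>j<n. flat_exp (1 / real (Suc n) - v j p)) > 0" by (intro prod_pos) simp
    then have "w n p > 0" unfolding w_def using vn by (intro mult_pos_pos)
    then show ?thesis by blast
  qed
  have 4: "\<exists>W N. openin (mtop P) W \<and> p \<in> W \<and> (\<forall>p'\<in>W. \<forall>n\<ge>N. w n p' = 0)" if p: "p \<in> points P" for p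
  proof -
    obtain k where k: "v k p > 0" using v(3)[OF p] by blast
    let ?W = "{p' \<in> points P. v k p' > v k p / 2}"
    have "openin (mtop P) ?W"
      using vi[of k] rsmooth_openin_greater[OF manifold_P] unfolding invariant_def by (elim conjE)
    moreover have "p \<in> ?W" using p k by simp
    \<comment> \<open>For \<open>n \<ge> m\<close> the number \<open>1 / real (Suc n)\<close> lies
      below \<open>v k\<close> on \<open>?W\<close>, so the damping factor of \<open>k\<close>
      vanishes; \<open>n \<ge> Suc k\<close> ensures that this factor occurs.\<close>
    moreover obtain m where m: "inverse (real (Suc m)) < v k p / 2" using reals_Archimedean[of "v k p / 2"] k by auto
    have "w n p' = 0" if p': "p' \<in> ?W" and n: "n \<ge> max (Suc k) m" for p' n
    proof -
      have "1 / real (Suc n) \<le> inverse (real (Suc m))" using n by (simp add: field_simps)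
      then have "flat_exp (1 / real (Suc n) - v k p') = 0" using m p' by (intro flat_exp_zero) auto
      then have "(\<Prod>j<n. flat_exp (1 / real (Suc n) - v j p')) = 0" using n by (intro prod_zero) auto
      then show ?thesis by (simp add: w_def)
    qed
    ultimately show ?thesis by blast
  qed
  show ?thesis by (intro exI[of _ w] conjI allI ballI 1 2 3 4)
qed

lemma character_nonzero_on_good:
  assumes \<omega>: "\<omega> \<in> characters (subalgebra_on B (fixed_center G B \<alpha>))"
  shows "\<exists>v. good v \<and> \<omega> (emb v) \<noteq> 0"
proof (rule ccontr)
  assume "\<not> (\<exists>v. good v \<and> \<omega> (emb v) \<noteq> 0)"
  then have zero: "\<omega> (emb v) = 0" if "good v" for v using that by blast
  let ?F = "fixed_center G B \<alpha>"
  interpret BB: lc_algebra B by (rule lcB)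
  have add: "\<omega> (x \<oplus>\<^bsub>B\<^esub> y) = \<omega> x + \<omega> y" and mult: "\<omega> (x \<otimes>\<^bsub>B\<^esub> y) = \<omega> x * \<omega> y" if "x \<in> ?F" "y \<in> ?F" for x y
    using \<omega> that unfolding characters_def algebra_hom_def subalgebra_on_def by (simp_all del: smooth_algebra_simps)
  have smult: "\<omega> (c \<odot>\<^bsub>B\<^esub> x) = c * \<omega> x" if "x \<in> ?F" for c x
    using \<omega> that unfolding characters_def algebra_hom_def subalgebra_on_def by (simp del: smooth_algebra_simps)
  obtain x0 where x0: "x0 \<in> ?F" "\<omega> x0 \<noteq> 0"
    using \<omega> unfolding characters_def subalgebra_on_def by auto
  \<comment> \<open>Seen through \<open>emb\<close>, the character is a complex-valued homomorphism
    on the real algebra of invariant functions.\<close>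
  define \<Omega> where "\<Omega> r = \<omega> (emb r)" for r
  have \<Omega>_add: "\<Omega> (\<lambda>p. r p + s p) = \<Omega> r + \<Omega> s" and \<Omega>_mult: "\<Omega> (\<lambda>p. r p * s p) = \<Omega> r * \<Omega> s"
    if "invariant r" "invariant s" for r s
    unfolding \<Omega>_def using that by (simp_all only: emb_add emb_mult add mult emb_fixed_center)
  have \<Omega>_scale: "\<Omega> (\<lambda>p. c * r p) = of_real c * \<Omega> r" if "invariant r" for c r
    unfolding \<Omega>_def using that by (simp only: emb_scale smult emb_fixed_center)
  have \<Omega>_cong: "\<Omega> r = \<Omega> s" if "\<And>p. p \<in> points P \<Longrightarrow> r p = s p" for r s
    unfolding \<Omega>_def using emb_cong[of r s] that by simp
  \<comment> \<open>A character is only required to be nonzero; some \<open>x0\<close> with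
    \<open>\<omega> x0 \<noteq> 0\<close> forces the unit to have value 1.\<close>
  have \<Omega>_one: "\<Omega> (\<lambda>p. 1) = 1"
  proof -
    have "x0 \<in> carrier B" using x0(1) unfolding fixed_center_def center_def by blast
    then have "\<omega> x0 * \<omega> \<one>\<^bsub>B\<^esub> = \<omega> x0"
      using mult[OF x0(1) emb_fixed_center[OF invariant_const[of 1]]] by (simp only: emb_one BB.r_one)
    then show ?thesis using x0(2) unfolding \<Omega>_def emb_one by simp
  qed
  have \<Omega>_pos: "\<Omega> r \<noteq> 0" if r: "invariant r" and pos: "\<And>p. p \<in> points P \<Longrightarrow> r p > 0" for r
  proof -
    have "\<Omega> (\<lambda>p. r p * inverse (r p)) = \<Omega> r * \<Omega> (\<lambda>p. inverse (r p))"
      by (rule \<Omega>_mult[OF r invariant_inverse[OF r pos]])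
    moreover have "r p * inverse (r p) = 1" if "p \<in> points P" for p using pos[OF that] by simp
    then have "\<Omega> (\<lambda>p. r p * inverse (r p)) = \<Omega> (\<lambda>p. 1)" by (rule \<Omega>_cong)
    ultimately show ?thesis using \<Omega>_one by auto
  qed
  \<comment> \<open>Over the empty manifold the functions 1 and 0 coincide, which contradicts
    \<open>\<Omega>_one\<close>.\<close>
  have ne: "points P \<noteq> {}"
  proof
    assume "points P = {}"
    then have "\<Omega> (\<lambda>p. 1) = \<Omega> (\<lambda>p. 0 * 1)" by (intro \<Omega>_cong) simp
    then show False using \<Omega>_scale[OF invariant_const[of 1], of 0] \<Omega>_one by simp
  qed
  obtain w where w: "\<And>n::nat. good (w n)" "\<And>n p. w n p \<ge> 0" "\<And>p. p \<in> points P \<Longrightarrow> \<exists>n. w n p > 0"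
    and loc: "\<And>p. p \<in> points P \<Longrightarrow> \<exists>W N. openin (mtop P) W \<and> p \<in> W \<and> (\<forall>p'\<in>W. \<forall>n\<ge>N. w n p' = 0)"
    using ex_locally_finite_good_sequence[OF ne] by blast
  have wi: "invariant (w n)" for n using w(1)[of n] unfolding good_def by (elim conjE)
  \<comment> \<open>Only finitely many terms are nonzero at each point, so \<open>F\<close> is
    linear in the coefficients. The functions \<open>f\<close>, \<open>h\<close> and
    \<open>T\<close> are the values of \<open>F\<close> at the sequences 1, \<open>real\<close> and
    \<open>t\<close>.\<close>
  define F where "F c p = (\<Sum>n. c n * w n p)" for c :: "nat \<Rightarrow> real" and p
  have fin: "\<exists>N. \<forall>n\<ge>N. w n p = 0" if "p \<in> points P" for p using loc[OF that] by blast
  have Fsum: "F c p = (\<Sum>n<N. c n * w n p)" if "\<forall>n\<ge>N. w n p = 0" for c p N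
    unfolding F_def using that by (intro suminf_finite) auto
  have Fadd: "F c p + F c' p = F (\<lambda>n. c n + c' n) p" if p: "p \<in> points P" for c c' p
  proof -
    obtain N where N: "\<forall>n\<ge>N. w n p = 0" using fin[OF p] by blast
    show ?thesis unfolding Fsum[OF N] by (simp add: sum.distrib[symmetric] distrib_right)
  qed
  have Fi: "invariant (F c)" for c
    unfolding invariant_def
  proof (intro conjI ballI)
    show "rsmooth P (F c)"
    proof (rule rsmooth_local[OF manifold_P])
      fix p assume p: "p \<in> points P"
      obtain W N where W: "openin (mtop P) W" "p \<in> W" "\<forall>p'\<in>W. \<forall>n\<ge>N. w n p' = 0" using loc[OF p] by blast
      note WC = euclidean_charts_open_submanifold[OF manifold_P W(1)]
      have "rsmooth P (\<lambda>p. \<Sum>n<N. c n * w n p)"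
        using wi unfolding invariant_def by (intro rsmooth_sum[OF charts_P] rsmooth_mult[OF charts_P] rsmooth_const[OF charts_P]) auto
      then have "rsmooth (open_submanifold P W) (\<lambda>p. \<Sum>n<N. c n * w n p)"
        by (rule rsmooth_open_submanifold[OF manifold_P W(1)])
      then have "rsmooth (open_submanifold P W) (F c)"
      proof (rule rsmooth_cong[OF WC])
        fix p' assume "p' \<in> points (open_submanifold P W)"
        then have "p' \<in> W" by (simp only: points_open_submanifold[OF manifold_P W(1)])
        then have "\<forall>n\<ge>N. w n p' = 0" using W(3) by blast
        from Fsum[OF this, of c] show "(\<Sum>n<N. c n * w n p') = F c p'" by simp
      qed
      then show "\<exists>W. openin (mtop P) W \<and> p \<in> W \<and> rsmooth (open_submanifold P W) (F c)" using W(1,2) by blast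
    qed
    fix p g assume "p \<in> points P" "g \<in> carrier G"
    then show "F c (\<sigma> p g) = F c p" using wi unfolding invariant_def F_def by simp
  qed
  have F0: "F c p \<ge> 0" if p: "p \<in> points P" and c: "\<And>n. c n \<ge> 0" for c p
  proof -
    obtain N where N: "\<forall>n\<ge>N. w n p = 0" using fin[OF p] by blast
    show ?thesis unfolding Fsum[OF N] using c w(2) by (intro sum_nonneg) auto
  qed
  have Fpos: "F c p > 0" if p: "p \<in> points P" and c: "\<And>n. c n \<ge> 0" and n: "c n > 0" "w n p > 0" for c p n
  proof -
    obtain N where N: "\<forall>n\<ge>N. w n p = 0" using fin[OF p] by blast
    then have "n < N" using n(2) by (metis less_irrefl not_less)
    then show ?thesis unfolding Fsum[OF N] using c w(2) n by (intro sum_pos2[of _ n]) auto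
  qed
  have \<Omega>_fin: "\<Omega> (\<lambda>p. \<Sum>n<N. c n * w n p) = 0" for c and N :: nat
  proof (induction N)
    case 0
    have "\<Omega> (\<lambda>p. 0 * 1) = 0" using \<Omega>_scale[OF invariant_const[of 1], of 0] by simp
    then show ?case by simp
  next
    case (Suc N)
    have "\<Omega> (\<lambda>p. (\<Sum>n<N. c n * w n p) + c N * w N p) = \<Omega> (\<lambda>p. \<Sum>n<N. c n * w n p) + \<Omega> (\<lambda>p. c N * w N p)"
      by (intro \<Omega>_add invariant_sum invariant_mult invariant_const wi) auto
    moreover have "\<Omega> (\<lambda>p. c N * w N p) = 0" using \<Omega>_scale[OF wi, of "c N" N] zero[OF w(1)[of N]] by (simp add: \<Omega>_def)
    ultimately show ?case using Suc by simp
  qed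
  let ?f = "F (\<lambda>n. 1)" and ?h = "F real"
  have f0: "\<Omega> ?f \<noteq> 0"
  proof (rule \<Omega>_pos[OF Fi])
    fix p assume p: "p \<in> points P"
    obtain n where "w n p > 0" using w(3)[OF p] by blast
    then show "?f p > 0" by (intro Fpos[OF p, of _ n]) auto
  qed
  \<comment> \<open>By this choice \<open>\<Omega> ?h = z * \<Omega> ?f\<close>. Subtracting a real
    multiple of \<open>?f\<close> from \<open>?h\<close> can absorb only the real part
    \<open>a\<close>; the imaginary part \<open>b\<close> is dealt with by squaring.\<close>
  define z where "z = \<Omega> ?h / \<Omega> ?f"
  define a b where "a = Re z" and "b = Im z"
  obtain N :: nat where N: "a < real N" using reals_Archimedean2 by blast
  \<comment> \<open>From \<open>N\<close> on the coefficients \<open>n - a\<close> are positive by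
    the choice of \<open>N\<close>. The first \<open>N\<close> terms are cut away, at no cost since
    \<open>\<Omega>\<close> kills finite sums.\<close>
  define t where "t n = (if n < N then 0 else real n - a)" for n
  let ?T = "F t" and ?s = "\<lambda>p. \<Sum>n<N. (real n - a) * w n p" and ?s1 = "\<lambda>p. \<Sum>n<N. 1 * w n p"
  have si: "invariant ?s" "invariant ?s1" by (intro invariant_sum invariant_mult invariant_const wi; simp)+
  have "\<Omega> ?h = \<Omega> (\<lambda>p. ?T p + (a * ?f p + ?s p))"
  proof (rule \<Omega>_cong)
    fix p assume p: "p \<in> points P"
    \<comment> \<open>Once the finite sum is also written as a value of \<open>F\<close>, the
      identity reduces to one between coefficient sequences.\<close>
    have s: "?s p = F (\<lambda>n. if n < N then real n - a else 0) p"
      unfolding F_def by (subst suminf_finite[of "{..<N}"]) auto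
    have af: "a * ?f p = F (\<lambda>n. a) p"
    proof -
      obtain K where K: "\<forall>n\<ge>K. w n p = 0" using fin[OF p] by blast
      show ?thesis unfolding Fsum[OF K] by (simp add: sum_distrib_left)
    qed
    have "(\<lambda>n. t n + (a + (if n < N then real n - a else 0))) = real" by (auto simp: t_def fun_eq_iff)
    then show "?h p = ?T p + (a * ?f p + ?s p)" unfolding s af Fadd[OF p] by simp
  qed
  also have "\<dots> = \<Omega> ?T + (of_real a * \<Omega> ?f + 0)"
    using \<Omega>_add[OF Fi[of t] invariant_add[OF invariant_mult[OF invariant_const[of a] Fi[of "\<lambda>n. 1"]] si(1)]]
      \<Omega>_add[OF invariant_mult[OF invariant_const[of a] Fi[of "\<lambda>n. 1"]] si(1)] \<Omega>_scale[OF Fi[of "\<lambda>n. 1"], of a] \<Omega>_fin by simp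
  finally have "\<Omega> ?T = (z - of_real a) * \<Omega> ?f" using f0 by (simp add: z_def field_simps)
  moreover have "z - of_real a = \<i> * of_real b" by (simp add: a_def b_def complex_eq_iff)
  ultimately have T: "\<Omega> ?T = \<i> * of_real b * \<Omega> ?f" by simp
  \<comment> \<open>By \<open>T\<close>, squaring gives minus \<open>b * b\<close> times the square
    of \<open>\<Omega> ?f\<close>, which the second summand cancels. \<open>?s1\<close> restores
    positivity where \<open>?T\<close> is zero: there some \<open>w n\<close> with
    \<open>n < N\<close> is positive. Being a finite sum, it is killed as well.\<close>
  let ?G = "\<lambda>p. (?T p * ?T p + (b * b) * (?f p * ?f p)) + ?s1 p"
  have G1: "\<Omega> ?G = (\<Omega> ?T * \<Omega> ?T + of_real (b * b) * (\<Omega> ?f * \<Omega> ?f)) + 0"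
  proof -
    note ff = invariant_mult[OF Fi[of "\<lambda>n. 1"] Fi[of "\<lambda>n. 1"]] and TT = invariant_mult[OF Fi[of t] Fi[of t]]
    note bff = invariant_mult[OF invariant_const[of "b * b"] ff]
    show ?thesis
      using \<Omega>_add[OF invariant_add[OF TT bff] si(2)] \<Omega>_add[OF TT bff] \<Omega>_scale[OF ff, of "b * b"]
        \<Omega>_mult[OF Fi[of t] Fi[of t]] \<Omega>_mult[OF Fi[of "\<lambda>n. 1"] Fi[of "\<lambda>n. 1"]] \<Omega>_fin[of "\<lambda>n. 1" N] by (simp only:)
  qed
  also have "\<dots> = 0" unfolding T by (simp add: algebra_simps)
  finally have G0: "\<Omega> ?G = 0" .
  have "\<Omega> ?G \<noteq> 0"
  proof (rule \<Omega>_pos)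
    show "invariant ?G" by (intro invariant_add invariant_mult invariant_const Fi si)
    fix p assume p: "p \<in> points P"
    have nn: "?T p * ?T p \<ge> 0" "(b * b) * (?f p * ?f p) \<ge> 0" "?s1 p \<ge> 0" using w(2) by (auto intro!: sum_nonneg)
    obtain n where n: "w n p > 0" using w(3)[OF p] by blast
    show "?G p > 0"
    proof (cases "n < N")
      case True
      then have "?s1 p > 0" using n w(2) by (intro sum_pos2[of _ n]) auto
      then show ?thesis using nn by linarith
    next
      case False
      have "?T p > 0"
        by (rule Fpos[OF p, of _ n]) (use False N n in \<open>auto simp: t_def\<close>)
      then have "?T p * ?T p > 0" by simp
      then show ?thesis using nn by linarith
    qed
  qed
  then show False using G0 by blast
qed

lemma nc_principal_bundle_B: "nc_principal_bundle G B \<alpha>"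
  unfolding nc_principal_bundle_def
proof (intro conjI ballI)
  show "dynamical_system G B \<alpha>" by (rule dynamical_system_B)
  fix \<omega> assume "\<omega> \<in> characters (subalgebra_on B (fixed_center G B \<alpha>))"
  then obtain v where v: "good v" "\<omega> (emb v) \<noteq> 0" using character_nonzero_on_good by blast
  have "invariant v" using v(1) unfolding good_def by (elim conjE)
  then show "\<exists>z\<in>fixed_center G B \<alpha>. \<omega> z \<noteq> 0 \<and>
      trivial_nc_principal_bundle G (smooth_localization B z) (localized_action B z \<alpha>)"
    using v(2) good_trivial[OF v(1)] by (intro bexI[of _ "emb v"] conjI emb_fixed_center)
qed

end

theorem theorem5p15:
  fixes \<Lambda> :: "'g monoid"
    and P :: "'p manifold" and M :: "'m manifold"
    and q :: "'p \<Rightarrow> 'm" and \<sigma> :: "'p \<Rightarrow> 'g \<Rightarrow> 'p"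
    and A :: "(complex, 'a) top_algebra"
    and \<pi> :: "'g \<Rightarrow> 'a \<Rightarrow> 'a"
  assumes "comm_group \<Lambda>" and "finite (carrier \<Lambda>)"
    and "principal_bundle P M \<Lambda> q \<sigma>"
    and "frechet_algebra A" and "trivial_center A"
    and "smooth_algebra_action \<Lambda> A \<pi>"
  shows "nc_principal_bundle \<Lambda> (smooth_algebra P A) (bundle_action P \<sigma> \<pi>)"
proof -
  have lc: "lc_algebra A" using assms(4) unfolding frechet_algebra_def by blast
  interpret bundle_system \<Lambda> A P M q \<sigma> \<pi>
    by (intro bundle_system.intro finite_comm_group.intro finite_comm_group_axioms.intro bundle_system_axioms.intro)
       (rule assms lc)+
  show ?thesis by (rule nc_principal_bundle_B)
qed

end
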